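(* Let $\Omega \subseteq \mathbf{R}^3$ be a bounded $C^1$ domain. Then for coefficients $A \in W^{1,\infty}(\Omega;\mathbf{R}^3)$ and real-valued $q_\pm \in W^{1,\infty}(\Omega)$, the Cauchy data set $C_V$ uniquely determines $A_{\mathrm{tan}}|_{\partial\Omega}$ and $q_{\pm}|_{\partial\Omega}$. That is: if $A_j \in W^{1,\infty}(\Omega;\mathbf{R}^3)$ and $q_{\pm,j} \in W^{1,\infty}(\Omega)$ (real-valued), $j=1,2$, $V_j = P_0(A_j) + \begin{pmatrix} q_{+,j} I_2 & 0 \\ 0 & q_{-,j} I_2\end{pmatrix}$, and $C_{V_1} = C_{V_2}$, then $(A_1)_{\mathrm{tan}} = (A_2)_{\mathrm{tan}}$, $q_{+,1} = q_{+,2}$ and $q_{-,1} = q_{-,2}$ at every point of $\partial\Omega$.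
   Context: $\nu$ is the outer unit normal to $\partial\Omega$ and $A_{\mathrm{tan}} = A - (A\cdot\nu)\nu$ is the tangential component of $A$ on $\partial\Omega$. $W^{1,\infty}(\Omega)$ functions are identified with their continuous representatives on $\overline{\Omega}$. $D=-i\nabla$. $P_0$ is the Pauli Dirac symbol: for $\xi \in \mathbf{C}^3$, $P_0(\xi) = \begin{pmatrix} 0 & \sigma\cdot\xi \\ \sigma\cdot\xi & 0\end{pmatrix}$ (a $4\times 4$ matrix), where $\sigma = (\sigma_1,\sigma_2,\sigma_3)$ with $\sigma_1 = \begin{pmatrix} 0&1\\1&0\end{pmatrix}$, $\sigma_2 = \begin{pmatrix} 0&-i\\i&0\end{pmatrix}$, $\sigma_3 = \begin{pmatrix} 1&0\\0&-1\end{pmatrix}$. For a potential $V = P_0(A)+Q$, $Q = \begin{pmatrix} q_+ I_2 & 0 \\ 0 & q_- I_2\end{pmatrix}$, let $\mathcal{L}_V = P_0(D) + V$, acting on $4$-vectors $u = \begin{pmatrix} u_+ \\ u_-\end{pmatrix}$ with $u_\pm \in L^2(\Omega)^2$ (complex valued). Let $\mathcal{H}(\Omega) = \{ w \in L^2(\Omega)^2 : \sigma\cdot D w \in L^2(\Omega)^2\}$. The Cauchy data set is $$C_V = \{ (u_+|_{\partial\Omega}, u_-|_{\partial\Omega}) : u \in \mathcal{H}(\Omega)^2 \text{ and } \mathcal{L}_V u = 0 \text{ in } \Omega\},$$ where the traces are taken in the abstract sense: $w|_{\partial\Omega}$ denotes the class of $w\in\mathcal{H}(\Omega)$ in the quotient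 of $\mathcal{H}(\Omega)$ by the $\mathbf{C}^2$-valued $H^1_0(\Omega)$ functions. *)

theory Defs
  imports "HOL-Analysis.Analysis"
begin

definition horiz :: "real^3 \<Rightarrow> real^2" where
  "horiz y = vector [y $ 1, y $ 2]"

text \<open>
  After the orthogonal change of coordinates \<open>T\<close>, the set \<open>\<Omega>\<close> is, near \<open>p\<close>, the region strictly
  above the graph of the continuously differentiable function \<open>\<gamma>\<close> with gradient \<open>G\<close>.
\<close>

definition C1_chart ::
  "(real^3) set \<Rightarrow> real^3 \<Rightarrow> (real^3 \<Rightarrow> real^3) \<Rightarrow> real \<Rightarrow> (real^2 \<Rightarrow> real) \<Rightarrow> (real^2 \<Rightarrow> real^2) \<Rightarrow> bool"
where
  "C1_chart \<Omega> p T r \<gamma> G \<longleftrightarrow>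
     orthogonal_transformation T \<and> 0 < r \<and>
     (\<forall>y. (\<gamma> has_derivative (\<lambda>h. G y \<bullet> h)) (at y)) \<and> continuous_on UNIV G \<and>
     \<Omega> \<inter> ball p r = {x \<in> ball p r. \<gamma> (horiz (T x)) < T x $ 3}"

definition C1_domain :: "(real^3) set \<Rightarrow> bool" where
  "C1_domain \<Omega> \<longleftrightarrow>
     open \<Omega> \<and> connected \<Omega> \<and> \<Omega> \<noteq> {} \<and> (\<forall>p\<in>frontier \<Omega>. \<exists>T r \<gamma> G. C1_chart \<Omega> p T r \<gamma> G)"

text \<open>
  In the coordinates of a chart the outer unit normal is
  \<open>(\<nabla>\<gamma>, -1) / sqrt (1 + |\<nabla>\<gamma>|\<^sup>2)\<close>; it does not depend on the chart, see \<open>outer_normal_eq\<close> below.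
\<close>

definition chart_normal ::
  "real^3 \<Rightarrow> (real^3 \<Rightarrow> real^3) \<Rightarrow> (real^2 \<Rightarrow> real^2) \<Rightarrow> real^3 \<Rightarrow> bool"
where
  "chart_normal p T G n \<longleftrightarrow>
     (let g = G (horiz (T p))
      in T n = (1 / sqrt (1 + (norm g)\<^sup>2)) *\<^sub>R vector [g $ 1, g $ 2, - 1])"

definition outer_normal :: "(real^3) set \<Rightarrow> real^3 \<Rightarrow> real^3" where
  "outer_normal \<Omega> p = (THE n. \<exists>T r \<gamma> G. C1_chart \<Omega> p T r \<gamma> G \<and> chart_normal p T G n)"

definition tangential :: "(real^3) set \<Rightarrow> (real^3 \<Rightarrow> real^3) \<Rightarrow> real^3 \<Rightarrow> real^3" where
  "tangential \<Omega> A x = A x - (A x \<bullet> outer_normal \<Omega> x) *\<^sub>R outer_normal \<Omega> x"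


definition pd :: "3 \<Rightarrow> (real^3 \<Rightarrow> 'b::real_normed_vector) \<Rightarrow> real^3 \<Rightarrow> 'b" where
  "pd j f x = frechet_derivative f (at x) (axis j 1)"

fun Ck :: "nat \<Rightarrow> (real^3 \<Rightarrow> 'b::real_normed_vector) \<Rightarrow> bool" where
  "Ck 0 f \<longleftrightarrow> continuous_on UNIV f"
| "Ck (Suc k) f \<longleftrightarrow> (\<forall>x. f differentiable (at x)) \<and> (\<forall>j. Ck k (pd j f))"

definition test_functions :: "(real^3) set \<Rightarrow> (real^3 \<Rightarrow> 'b::real_normed_vector) set" where
  "test_functions \<Omega> =
     {f. (\<forall>k. Ck k f) \<and> compact (closure {x. f x \<noteq> 0}) \<and> closure {x. f x \<noteq> 0} \<subseteq> \<Omega>}"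

text \<open>
  Real-valued scalar test functions suffice to express identities between distributions, also
  complex-valued ones, since a distribution is complex linear in the test function.
\<close>

definition weak_pd ::
  "(real^3) set \<Rightarrow> 3 \<Rightarrow> (real^3 \<Rightarrow> 'b::euclidean_space) \<Rightarrow> (real^3 \<Rightarrow> 'b) \<Rightarrow> bool"
where
  "weak_pd \<Omega> j f g \<longleftrightarrow>
     (\<forall>\<phi>::real^3 \<Rightarrow> real. \<phi> \<in> test_functions \<Omega> \<longrightarrow>
        (LINT x|lebesgue_on \<Omega>. pd j \<phi> x *\<^sub>R f x) = - (LINT x|lebesgue_on \<Omega>. \<phi> x *\<^sub>R g x))"


text \<open>
  All spaces consist of functions, not of classes modulo null sets. Their definitions only depend
  on such classes on \<open>\<Omega>\<close>, except for the representatives in \<open>W1inf_cont\<close>.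
\<close>

definition L2 :: "(real^3) set \<Rightarrow> (real^3 \<Rightarrow> 'b::euclidean_space) set" where
  "L2 \<Omega> = {f. f \<in> borel_measurable (lebesgue_on \<Omega>) \<and>
               integrable (lebesgue_on \<Omega>) (\<lambda>x. (norm (f x))\<^sup>2)}"

definition L2_norm :: "(real^3) set \<Rightarrow> (real^3 \<Rightarrow> 'b::euclidean_space) \<Rightarrow> real" where
  "L2_norm \<Omega> f = sqrt (LINT x|lebesgue_on \<Omega>. (norm (f x))\<^sup>2)"

definition Linf :: "(real^3) set \<Rightarrow> (real^3 \<Rightarrow> 'b::euclidean_space) set" where
  "Linf \<Omega> = {f. f \<in> borel_measurable (lebesgue_on \<Omega>) \<and>
                 (\<exists>C. AE x in lebesgue_on \<Omega>. norm (f x) \<le> C)}"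

definition W1inf :: "(real^3) set \<Rightarrow> (real^3 \<Rightarrow> 'b::euclidean_space) set" where
  "W1inf \<Omega> = {f \<in> Linf \<Omega>. \<forall>j. \<exists>g\<in>Linf \<Omega>. weak_pd \<Omega> j f g}"

text \<open>
  The representatives in \<open>W\<^sup>1\<^sup>,\<^sup>\<infinity>(\<Omega>)\<close> that are continuous up to the boundary; their values on
  \<open>frontier \<Omega>\<close> are the boundary values.
\<close>

definition W1inf_cont :: "(real^3) set \<Rightarrow> (real^3 \<Rightarrow> 'b::euclidean_space) set" where
  "W1inf_cont \<Omega> = {f \<in> W1inf \<Omega>. continuous_on (closure \<Omega>) f}"

text \<open>The closure of the test functions in \<open>H\<^sup>1(\<Omega>)\<close>; \<open>g\<close> is the weak gradient of \<open>f\<close>.\<close>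

definition H10 :: "(real^3) set \<Rightarrow> (real^3 \<Rightarrow> 'b::euclidean_space) set" where
  "H10 \<Omega> = {f \<in> L2 \<Omega>. \<exists>g. (\<forall>j. g j \<in> L2 \<Omega> \<and> weak_pd \<Omega> j f (g j)) \<and>
     (\<exists>\<phi>::nat \<Rightarrow> real^3 \<Rightarrow> 'b. (\<forall>n. \<phi> n \<in> test_functions \<Omega>) \<and>
        (\<lambda>n. L2_norm \<Omega> (\<lambda>x. \<phi> n x - f x)) \<longlonglongrightarrow> 0 \<and>
        (\<forall>j. (\<lambda>n. L2_norm \<Omega> (\<lambda>x. pd j (\<phi> n) x - g j x)) \<longlonglongrightarrow> 0))}"


definition pauli :: "3 \<Rightarrow> complex^2^2" where
  "pauli j = (if j = 1 then vector [vector [0, 1], vector [1, 0]]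
              else if j = 2 then vector [vector [0, - \<i>], vector [\<i>, 0]]
              else vector [vector [1, 0], vector [0, - 1]])"

definition sigma_dot :: "complex^3 \<Rightarrow> complex^2^2" where
  "sigma_dot \<xi> = (\<chi> a b. \<Sum>j\<in>UNIV. \<xi> $ j * pauli j $ a $ b)"

text \<open>
  Four-vectors and \<open>4 \<times> 4\<close> matrices are indexed by the sum type \<open>2 + 2\<close>, where \<open>Inl\<close> is the
  upper and \<open>Inr\<close> the lower block.
\<close>

definition upper :: "complex^(2+2) \<Rightarrow> complex^2" where
  "upper u = (\<chi> a. u $ Inl a)"

definition lower :: "complex^(2+2) \<Rightarrow> complex^2" where
  "lower u = (\<chi> a. u $ Inr a)"

definition block ::
  "complex^2^2 \<Rightarrow> complex^2^2 \<Rightarrow> complex^2^2 \<Rightarrow> complex^2^2 \<Rightarrow> complex^(2+2)^(2+2)"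
where
  "block M11 M12 M21 M22 = (\<chi> a b.
     case a of
       Inl i \<Rightarrow> (case b of Inl k \<Rightarrow> M11 $ i $ k | Inr k \<Rightarrow> M12 $ i $ k)
     | Inr i \<Rightarrow> (case b of Inl k \<Rightarrow> M21 $ i $ k | Inr k \<Rightarrow> M22 $ i $ k))"

definition P0 :: "complex^3 \<Rightarrow> complex^(2+2)^(2+2)" where
  "P0 \<xi> = block 0 (sigma_dot \<xi>) (sigma_dot \<xi>) 0"

definition potential ::
  "(real^3 \<Rightarrow> real^3) \<Rightarrow> (real^3 \<Rightarrow> real) \<Rightarrow> (real^3 \<Rightarrow> real) \<Rightarrow> real^3 \<Rightarrow> complex^(2+2)^(2+2)"
where
  "potential A qp qm x =
     P0 (\<chi> j. complex_of_real (A x $ j)) +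
     block (mat (complex_of_real (qp x))) 0 0 (mat (complex_of_real (qm x)))"

text \<open>
  The distribution \<open>D\<^sub>j w = -\<i> \<partial>\<^sub>j w\<close> applied to \<open>\<phi>\<close>; the two minus signs, from \<open>-\<i>\<close> and from
  moving the derivative to \<open>\<phi>\<close>, cancel.
\<close>

definition dist_D ::
  "(real^3) set \<Rightarrow> 3 \<Rightarrow> (real^3 \<Rightarrow> complex^'m) \<Rightarrow> (real^3 \<Rightarrow> real) \<Rightarrow> complex^'m"
where
  "dist_D \<Omega> j w \<phi> = \<i> *s (LINT x|lebesgue_on \<Omega>. pd j \<phi> x *\<^sub>R w x)"

definition dist_sigma_D ::
  "(real^3) set \<Rightarrow> (real^3 \<Rightarrow> complex^2) \<Rightarrow> (real^3 \<Rightarrow> real) \<Rightarrow> complex^2"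
where
  "dist_sigma_D \<Omega> w \<phi> = (\<Sum>j\<in>UNIV. sigma_dot (axis j 1) *v dist_D \<Omega> j w \<phi>)"

definition dist_P0_D ::
  "(real^3) set \<Rightarrow> (real^3 \<Rightarrow> complex^(2+2)) \<Rightarrow> (real^3 \<Rightarrow> real) \<Rightarrow> complex^(2+2)"
where
  "dist_P0_D \<Omega> u \<phi> = (\<Sum>j\<in>UNIV. P0 (axis j 1) *v dist_D \<Omega> j u \<phi>)"

definition dist_L ::
  "(real^3) set \<Rightarrow> (real^3 \<Rightarrow> complex^(2+2)^(2+2)) \<Rightarrow> (real^3 \<Rightarrow> complex^(2+2)) \<Rightarrow>
     (real^3 \<Rightarrow> real) \<Rightarrow> complex^(2+2)"
where
  "dist_L \<Omega> V u \<phi> = dist_P0_D \<Omega> u \<phi> + (LINT x|lebesgue_on \<Omega>. \<phi> x *\<^sub>R (V x *v u x))"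

definition H_space :: "(real^3) set \<Rightarrow> (real^3 \<Rightarrow> complex^2) set" where
  "H_space \<Omega> = {w \<in> L2 \<Omega>. \<exists>g\<in>L2 \<Omega>. \<forall>\<phi>\<in>test_functions \<Omega>.
     dist_sigma_D \<Omega> w \<phi> = (LINT x|lebesgue_on \<Omega>. \<phi> x *\<^sub>R g x)}"


definition trace_rel :: "(real^3) set \<Rightarrow> ((real^3 \<Rightarrow> complex^2) \<times> (real^3 \<Rightarrow> complex^2)) set" where
  "trace_rel \<Omega> = {(w, w'). w \<in> H_space \<Omega> \<and> w' \<in> H_space \<Omega> \<and> (\<lambda>x. w' x - w x) \<in> H10 \<Omega>}"

definition trace :: "(real^3) set \<Rightarrow> (real^3 \<Rightarrow> complex^2) \<Rightarrow> (real^3 \<Rightarrow> complex^2) set" where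
  "trace \<Omega> w = trace_rel \<Omega> `` {w}"

definition cauchy_data ::
  "(real^3) set \<Rightarrow> (real^3 \<Rightarrow> complex^(2+2)^(2+2)) \<Rightarrow>
     ((real^3 \<Rightarrow> complex^2) set \<times> (real^3 \<Rightarrow> complex^2) set) set"
where
  "cauchy_data \<Omega> V = {(trace \<Omega> (upper \<circ> u), trace \<Omega> (lower \<circ> u)) | u.
     upper \<circ> u \<in> H_space \<Omega> \<and> lower \<circ> u \<in> H_space \<Omega> \<and>
     (\<forall>\<phi>\<in>test_functions \<Omega>. dist_L \<Omega> V u \<phi> = 0)}"


lemma chart_normal_ray:
  assumes chart: "C1_chart \<Omega> p T r \<gamma> G" and p: "p \<in> frontier \<Omega>" and n: "chart_normal p T G n"
  shows "norm n = 1"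
    and "v \<bullet> n < 0 \<Longrightarrow> \<exists>d>0. \<forall>t. 0 < t \<and> t < d \<longrightarrow> p + t *\<^sub>R v \<in> \<Omega>"
    and "v \<bullet> n > 0 \<Longrightarrow> \<exists>d>0. \<forall>t. 0 < t \<and> t < d \<longrightarrow> p + t *\<^sub>R v \<notin> \<Omega>"
proof -
  define g where "g = G (horiz (T p))"
  define s where "s = sqrt (1 + (norm g)\<^sup>2)"
  define F where "F x = \<gamma> (horiz (T x)) - T x $ 3" for x
  have T: "orthogonal_transformation T" and r: "0 < r"
    and \<gamma>: "\<And>y. (\<gamma> has_derivative (\<lambda>h. G y \<bullet> h)) (at y)"
    and \<Omega>: "\<Omega> \<inter> ball p r = {x \<in> ball p r. \<gamma> (horiz (T x)) < T x $ 3}"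
    using chart unfolding C1_chart_def by auto
  have s: "s > 0" "s\<^sup>2 = 1 + (norm g)\<^sup>2"
    unfolding s_def by (auto simp: add_pos_nonneg)
  have Tn: "T n = (1 / s) *\<^sub>R vector [g $ 1, g $ 2, - 1]"
    using n unfolding chart_normal_def g_def s_def Let_def by simp
  have lin: "linear T" and blT: "bounded_linear T"
    using T orthogonal_transformation_linear linear_conv_bounded_linear by blast+
  have g2: "(norm g)\<^sup>2 = (g $ 1)\<^sup>2 + (g $ 2)\<^sup>2"
    unfolding power2_norm_eq_inner inner_vec_def sum_2 by (simp add: power2_eq_square)
  have "(norm (vector [g $ 1, g $ 2, - 1] :: real^3))\<^sup>2 = s\<^sup>2"
    using g2 s(2) unfolding power2_norm_eq_inner inner_vec_def sum_3
    by (simp add: power2_eq_square)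
  then have "norm (vector [g $ 1, g $ 2, - 1] :: real^3) = s"
    using s(1) by (metis less_imp_le norm_ge_zero power2_eq_imp_eq)
  then have "norm (T n) = 1" using Tn s(1) by simp
  then show "norm n = 1" using T orthogonal_transformation_norm by metis
  have hl: "linear horiz"
    by (rule linearI) (simp_all add: horiz_def vec_eq_iff forall_2)
  have blh: "bounded_linear (horiz \<circ> T)"
    using linear_compose[OF lin hl] linear_conv_bounded_linear by blast
  have contF: "continuous_on UNIV F"
  proof -
    have "continuous_on UNIV \<gamma>"
      using \<gamma> by (meson continuous_at_imp_continuous_on has_derivative_continuous)
    moreover have "continuous_on UNIV (\<lambda>x. horiz (T x))"
      using linear_continuous_on[OF blh] by (simp add: o_def)
    ultimately have "continuous_on UNIV (\<lambda>x. \<gamma> (horiz (T x)))"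
      using continuous_on_compose2 by blast
    then show ?thesis
      unfolding F_def using linear_continuous_on[OF blT]
      by (intro continuous_intros) auto
  qed
  have in\<Omega>: "x \<in> \<Omega> \<longleftrightarrow> F x < 0" if "x \<in> ball p r" for x
  proof -
    have "x \<in> \<Omega> \<inter> ball p r \<longleftrightarrow> x \<in> {x \<in> ball p r. \<gamma> (horiz (T x)) < T x $ 3}"
      by (simp only: \<Omega>)
    then show ?thesis using that unfolding F_def by simp
  qed
  have Fp: "F p = 0"
  proof (rule ccontr)
    assume "F p \<noteq> 0"
    then consider "F p < 0" | "F p > 0" by linarith
    then show False
    proof cases
      case 1
      have "open ({x. F x < 0} \<inter> ball p r)"
        using open_Collect_less[OF contF continuous_on_const] by blast
      moreover have "{x. F x < 0} \<inter> ball p r \<subseteq> \<Omega>" using in\<Omega> by auto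
      ultimately have "p \<in> interior \<Omega>" using 1 r by (auto intro!: interiorI)
      then show False using p by (simp add: frontier_def)
    next
      case 2
      have "open ({x. 0 < F x} \<inter> ball p r)"
        using open_Collect_less[OF continuous_on_const contF] by blast
      moreover have "({x. 0 < F x} \<inter> ball p r) \<inter> \<Omega> = {}" using in\<Omega> by fastforce
      ultimately have "({x. 0 < F x} \<inter> ball p r) \<inter> closure \<Omega> = {}"
        using open_Int_closure_eq_empty by blast
      then show False using 2 r p by (auto simp: frontier_def)
    qed
  qed
  have der: "((\<lambda>t. F (p + t *\<^sub>R v)) has_real_derivative s * (v \<bullet> n)) (at 0)" for v
  proof -
    have e: "((\<lambda>t. horiz (T (p + t *\<^sub>R v))) has_derivative (\<lambda>t. t *\<^sub>R horiz (T v))) (at 0)"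
      by (simp add: linear_add[OF lin] linear_add[OF hl] linear_scale[OF lin] linear_scale[OF hl])
        (auto intro!: derivative_eq_intros)
    have e1: "((\<lambda>t. \<gamma> (horiz (T (p + t *\<^sub>R v)))) has_derivative (\<lambda>t. g \<bullet> (t *\<^sub>R horiz (T v)))) (at 0)"
      using has_derivative_compose[OF e, of \<gamma> "\<lambda>h. g \<bullet> h"] \<gamma>[of "horiz (T p)"]
      unfolding g_def by simp
    have e2: "((\<lambda>t. T (p + t *\<^sub>R v) $ 3) has_derivative (\<lambda>t. t * T v $ 3)) (at 0)"
      by (simp add: linear_add[OF lin] linear_scale[OF lin]) (auto intro!: derivative_eq_intros)
    have "v \<bullet> n = T v \<bullet> T n" using T unfolding orthogonal_transformation_def by simp
    then have "s * (v \<bullet> n) = T v \<bullet> vector [g $ 1, g $ 2, - 1]"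
      using s(1) by (simp add: Tn)
    also have "\<dots> = g \<bullet> horiz (T v) - T v $ 3"
      by (simp add: inner_vec_def sum_2 sum_3 horiz_def algebra_simps)
    finally have eq: "s * (v \<bullet> n) = g \<bullet> horiz (T v) - T v $ 3" .
    have "(\<lambda>t. g \<bullet> (t *\<^sub>R horiz (T v)) - t * T v $ 3) = (*) (s * (v \<bullet> n))"
      unfolding eq by (rule ext) (simp add: left_diff_distrib)
    then show ?thesis
      using has_derivative_diff[OF e1 e2] unfolding has_field_derivative_def F_def by simp
  qed
  have near: "\<exists>e>0. \<forall>t. 0 < t \<and> t < e \<longrightarrow> p + t *\<^sub>R v \<in> ball p r" for v
  proof (intro exI conjI allI impI)
    show "0 < r / (norm v + 1)" using r by (simp add: add_nonneg_pos)
    fix t assume t: "0 < t \<and> t < r / (norm v + 1)"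
    moreover have "0 < norm v + 1" by (simp add: add_nonneg_pos)
    ultimately have "t * (norm v + 1) < r" by (simp only: pos_less_divide_eq)
    then have "t * norm v < r" using t by (simp add: algebra_simps)
    then show "p + t *\<^sub>R v \<in> ball p r" using t by (simp add: dist_norm)
  qed
  show "\<exists>d>0. \<forall>t. 0 < t \<and> t < d \<longrightarrow> p + t *\<^sub>R v \<in> \<Omega>" if "v \<bullet> n < 0"
  proof -
    have "s * (v \<bullet> n) < 0" using that s(1) by (simp add: mult_pos_neg)
    from DERIV_neg_dec_right[OF der this] obtain d where
      d: "d > 0" "\<And>h. 0 < h \<Longrightarrow> h < d \<Longrightarrow> F (p + h *\<^sub>R v) < 0"
      by (auto simp: Fp)
    obtain e where "e > 0" "\<And>t. 0 < t \<and> t < e \<Longrightarrow> p + t *\<^sub>R v \<in> ball p r" using near by blast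
    then show ?thesis using d in\<Omega> by (intro exI[of _ "min d e"]) auto
  qed
  show "\<exists>d>0. \<forall>t. 0 < t \<and> t < d \<longrightarrow> p + t *\<^sub>R v \<notin> \<Omega>" if "v \<bullet> n > 0"
  proof -
    have "s * (v \<bullet> n) > 0" using that s(1) by simp
    from DERIV_pos_inc_right[OF der this] obtain d where
      d: "d > 0" "\<And>h. 0 < h \<Longrightarrow> h < d \<Longrightarrow> F (p + h *\<^sub>R v) > 0"
      by (auto simp: Fp)
    obtain e where "e > 0" "\<And>t. 0 < t \<and> t < e \<Longrightarrow> p + t *\<^sub>R v \<in> ball p r" using near by blast
    then show ?thesis using d in\<Omega> by (intro exI[of _ "min d e"]) (auto simp: not_less less_imp_le)
  qed
qed

lemma chart_normal_exists:
  assumes "C1_chart \<Omega> p T r \<gamma> G"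
  shows "\<exists>n. chart_normal p T G n"
proof -
  have "surj T" using assms unfolding C1_chart_def by (simp add: orthogonal_transformation_surj)
  then have "\<exists>n. T n = y" for y by (metis surjD)
  then show ?thesis unfolding chart_normal_def Let_def .
qed

lemma outer_normal_eq:
  assumes "C1_chart \<Omega> p T r \<gamma> G" "p \<in> frontier \<Omega>" "chart_normal p T G n"
  shows "outer_normal \<Omega> p = n"
  unfolding outer_normal_def
proof (rule the_equality)
  show "\<exists>T r \<gamma> G. C1_chart \<Omega> p T r \<gamma> G \<and> chart_normal p T G n" using assms by blast
next
  fix m assume "\<exists>T r \<gamma> G. C1_chart \<Omega> p T r \<gamma> G \<and> chart_normal p T G m"
  then obtain T' r' \<gamma>' G' where m: "C1_chart \<Omega> p T' r' \<gamma>' G'" "chart_normal p T' G' m" by blast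
  note N = chart_normal_ray[OF assms] and M = chart_normal_ray[OF m(1) assms(2) m(2)]
  show "m = n"
  proof (rule ccontr)
    assume "m \<noteq> n"
    have nn: "n \<bullet> n = 1" "m \<bullet> m = 1" using N(1) M(1) by (simp_all add: norm_eq_1)
    have "0 < (n - m) \<bullet> (n - m)" using \<open>m \<noteq> n\<close> by simp
    then have "n \<bullet> m < 1" using nn by (simp add: inner_diff inner_commute)
    then have "(m - n) \<bullet> n < 0" "(m - n) \<bullet> m > 0"
      using nn by (simp_all add: inner_diff inner_commute)
    then obtain d e where d: "d > 0" "\<And>t. 0 < t \<and> t < d \<Longrightarrow> p + t *\<^sub>R (m - n) \<in> \<Omega>"
      and e: "e > 0" "\<And>t. 0 < t \<and> t < e \<Longrightarrow> p + t *\<^sub>R (m - n) \<notin> \<Omega>"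
      using N(2) M(3) by meson
    have "0 < min d e / 2 \<and> min d e / 2 < d" "0 < min d e / 2 \<and> min d e / 2 < e"
      using d(1) e(1) by auto
    from d(2)[OF this(1)] e(2)[OF this(2)] show False by contradiction
  qed
qed

end

theory Submission
  imports Defs
begin

text \<open>
  Let \<open>u\<close> solve \<open>L\<^sub>V\<^sub>1 u = 0\<close> and let \<open>v\<close> solve \<open>L\<^sub>V\<^sub>2 v = 0\<close>. If the Cauchy data agree, there is a solution
  \<open>u\<^sub>2\<close> of \<open>L\<^sub>V\<^sub>2 u\<^sub>2 = 0\<close> such that \<open>u - u\<^sub>2\<close> is a limit of test functions in \<open>H\<^sup>1\<close>, and integrating by parts
  against \<open>v\<close> shows that the integral of \<open>\<langle>(V\<^sub>1 - V\<^sub>2) u, v\<rangle>\<close> over the domain vanishes (\<open>integral_identity\<close>).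
  The boundary values are read off from this identity by choosing \<open>u\<close> and \<open>v\<close> concentrated at a
  boundary point \<open>p\<close>.

  The concentrated functions are \<open>\<bar>z\<bar>\<^sup>-\<^sup>3 (\<sigma> \<cdot> z) c\<close> with \<open>z = x - y\<close>. They are annihilated by \<open>\<sigma> \<cdot> D\<close> away
  from the pole \<open>y\<close>, which is placed at \<open>p + \<delta> n\<close>, outside the domain, with \<open>n\<close> the outer normal. The
  square of their \<open>L\<^sup>2\<close> norm is of order \<open>1 / \<delta>\<close>. After multiplication by \<open>\<delta>\<close> and rescaling around the
  pole the domain becomes the half space \<open>z \<bullet> n < -1\<close> as \<open>\<delta> \<rightarrow> 0\<close>, and the coefficients freeze at
  \<open>p\<close> (\<open>exterior_cone\<close>, \<open>concentration_limit\<close>). In the limit \<open>\<langle>(V\<^sub>1 - V\<^sub>2) u, v\<rangle>\<close> is a sum of coefficient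
  differences at \<open>p\<close> times explicit integrals. With both spinors in the upper or both in the lower
  block only \<open>q\<^sub>+\<close> or \<open>q\<^sub>-\<close> occurs, multiplied by the positive integral of \<open>\<bar>z\<bar>\<^sup>-\<^sup>4\<close>. With one spinor in each
  block only \<open>a = A\<^sub>1(p) - A\<^sub>2(p)\<close> occurs. If \<open>t\<close> denotes the tangential part of \<open>a\<close>, the constant spinors
  \<open>c\<close> and \<open>(\<sigma> \<cdot> t) c\<close> produce an integrand whose average over the rotations by right angles about \<open>n\<close> is
  \<open>- \<bar>t\<bar>\<^sup>2 (z \<bullet> n)\<^sup>2 / \<bar>z\<bar>\<^sup>6\<close>, so that \<open>t = 0\<close> (\<open>tangential_half_space_integral\<close>).

  The singular functions solve the free equation only. They are corrected to solutions of the full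
  equations by terms \<open>r\<close> with \<open>\<delta> \<parallel>r\<parallel>\<^sup>2\<close> as small as desired in the limit. For this there is a Carleman estimate with a weight
  \<open>w(x\<^sub>1)\<close>: up to an isometry \<open>P\<^sub>0(D)\<close> is \<open>\<partial>\<^sub>1\<close> plus a symmetric operator that commutes with \<open>\<partial>\<^sub>1\<close>, so that
  conjugation with \<open>exp w\<close> produces the positive commutator term \<open>w''\<close> and nothing else
  (\<open>carleman_estimate\<close>). For \<open>w(s) = \<tau> s\<^sup>2 / 2 + sqrt (s\<^sup>2 + \<eta>\<^sup>2)\<close>, with \<open>s\<close> measured from the plane
  \<open>x\<^sub>1 = p\<^sub>1\<close>, the weight is bounded uniformly in \<open>\<eta>\<close>, although \<open>w''\<close> is about \<open>1 / \<eta>\<close> on that plane; \<open>\<tau>\<close> absorbs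
  the potential (\<open>dirac_op_a_priori_estimate\<close>). By duality in \<open>L\<^sup>2\<close> the equation for the correction of a
  free solution \<open>u\<close> has a solution with \<open>\<parallel>r\<parallel>\<^sup>2 \<le> C \<integral> \<bar>u\<bar>\<^sup>2 / w''\<close>, where \<open>C\<close> does not depend on \<open>\<eta>\<close>
  (\<open>dirac_solution_near_free_solution\<close>). As \<open>u\<close> concentrates at \<open>p\<close>, where \<open>1 / w'' \<le> \<eta>\<close>, the limit superior
  of \<open>\<delta> \<parallel>r\<parallel>\<^sup>2\<close> is at most a constant times \<open>\<eta>\<close>, and \<open>\<eta>\<close> is arbitrary (\<open>boundary_form_zero\<close>).

  The inner product \<open>\<bullet>\<close> on complex vectors is the real part of the hermitian one.
\<close>

section \<open>Partial derivatives and smooth functions\<close>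

abbreviation smooth :: "(real^3 \<Rightarrow> 'b::real_normed_vector) \<Rightarrow> bool" where
  "smooth f \<equiv> \<forall>k. Ck k f"

lemma frechet_has_derivative:
  "f differentiable (at x) \<Longrightarrow> (f has_derivative frechet_derivative f (at x)) (at x)"
  by (simp add: frechet_derivative_works)

lemma pd_eq:
  assumes "(f has_derivative f') (at x)"
  shows "pd j f x = f' (axis j 1)"
  using frechet_derivative_at[OF assms] by (simp add: pd_def)

lemma pd_line:
  assumes "f differentiable (at (x + t *\<^sub>R axis j 1))"
  shows "((\<lambda>s. f (x + s *\<^sub>R axis j 1)) has_vector_derivative pd j f (x + t *\<^sub>R axis j 1)) (at t)"
proof -
  let ?D = "frechet_derivative f (at (x + t *\<^sub>R axis j 1))"
  have D: "(f has_derivative ?D) (at (x + t *\<^sub>R axis j 1))"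
    using assms by (simp add: frechet_derivative_works)
  have "((\<lambda>s. x + s *\<^sub>R axis j 1) has_derivative (\<lambda>s. s *\<^sub>R axis j 1)) (at t)"
    by (auto intro!: derivative_eq_intros)
  from has_derivative_compose[OF this D]
  have "((\<lambda>s. f (x + s *\<^sub>R axis j 1)) has_derivative (\<lambda>s. ?D (s *\<^sub>R axis j 1))) (at t)" .
  moreover have "?D (s *\<^sub>R axis j 1) = s *\<^sub>R ?D (axis j 1)" for s
    using linear_frechet_derivative[OF assms] by (rule linear_scale)
  ultimately show ?thesis
    unfolding has_vector_derivative_def pd_def by simp
qed

lemma pd_line0:
  assumes "f differentiable (at x)"
  shows "((\<lambda>s. f (x + s *\<^sub>R axis j 1)) has_vector_derivative pd j f x) (at 0)"
  using pd_line[of f x 0 j] assms by simp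

lemma Ck_continuous: "Ck k f \<Longrightarrow> continuous_on UNIV f"
  by (cases k)
    (auto simp: continuous_on_eq_continuous_at intro: differentiable_imp_continuous_within)

lemma Ck_Suc_imp_Ck: "Ck (Suc k) f \<Longrightarrow> Ck k f"
proof (induction k arbitrary: f)
  case 0
  then show ?case using Ck_continuous[of "Suc 0" f] by (simp only: Ck.simps(1))
next
  case (Suc k)
  then have "Ck (Suc k) (pd j f)" for j using Ck.simps(2)[of "Suc k" f] by blast
  then have "Ck k (pd j f)" for j using Suc.IH by blast
  moreover have "\<forall>x. f differentiable (at x)" using Suc.prems Ck.simps(2)[of "Suc k" f] by blast
  ultimately show ?case by simp
qed

lemma smooth_differentiable: "smooth f \<Longrightarrow> f differentiable (at x)"
  using Ck.simps(2) by blast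

lemma smooth_pd: "smooth f \<Longrightarrow> smooth (pd j f)"
  using Ck.simps(2) by blast

lemma smooth_continuous: "smooth f \<Longrightarrow> continuous_on S f"
  using Ck_continuous continuous_on_subset by blast

lemma pd_add:
  assumes "f differentiable (at x)" "g differentiable (at x)"
  shows "pd j (\<lambda>x. f x + g x) x = pd j f x + pd j g x"
  using pd_eq[OF has_derivative_add[OF frechet_has_derivative[OF assms(1)]
        frechet_has_derivative[OF assms(2)]]]
  by (simp add: pd_def)

lemma pd_linear:
  assumes "bounded_linear L" "f differentiable (at x)"
  shows "pd j (\<lambda>x. L (f x)) x = L (pd j f x)"
  using pd_eq[OF bounded_linear.has_derivative[OF assms(1) frechet_has_derivative[OF assms(2)]]]
  by (simp add: pd_def)

lemma pd_scaleR:
  assumes "f differentiable (at x)" "g differentiable (at x)"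
  shows "pd j (\<lambda>x. f x *\<^sub>R g x) x = f x *\<^sub>R pd j g x + pd j f x *\<^sub>R g x"
  using pd_eq[OF has_derivative_scaleR[OF frechet_has_derivative[OF assms(1)]
        frechet_has_derivative[OF assms(2)]]]
  by (simp add: pd_def)

lemma Ck_add: "Ck k f \<Longrightarrow> Ck k g \<Longrightarrow> Ck k (\<lambda>x. f x + g x)"
proof (induction k arbitrary: f g)
  case 0
  then show ?case by (simp add: continuous_on_add)
next
  case (Suc k)
  then have "pd j (\<lambda>x. f x + g x) = (\<lambda>x. pd j f x + pd j g x)" for j
    by (intro ext pd_add) auto
  with Suc show ?case by simp
qed

lemma Ck_linear: "bounded_linear L \<Longrightarrow> Ck k f \<Longrightarrow> Ck k (\<lambda>x. L (f x))"
proof (induction k arbitrary: f)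
  case 0
  then show ?case by (auto intro: bounded_linear.continuous_on)
next
  case (Suc k)
  then have "pd j (\<lambda>x. L (f x)) = (\<lambda>x. L (pd j f x))" for j
    by (intro ext pd_linear) auto
  moreover have "(\<lambda>x. L (f x)) differentiable (at x)" for x
    using Suc.prems(2) bounded_linear.has_derivative[OF Suc.prems(1) frechet_has_derivative]
    unfolding differentiable_def[of "\<lambda>x. L (f x)"] by fastforce
  ultimately show ?case using Suc by simp
qed

lemma Ck_scaleR: "Ck k f \<Longrightarrow> Ck k g \<Longrightarrow> Ck k (\<lambda>x. f x *\<^sub>R g x)"
proof (induction k arbitrary: f g)
  case 0
  then show ?case by (simp add: continuous_on_scaleR)
next
  case (Suc k)
  then have "pd j (\<lambda>x. f x *\<^sub>R g x) = (\<lambda>x. f x *\<^sub>R pd j g x + pd j f x *\<^sub>R g x)" for j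
    by (intro ext pd_scaleR) auto
  with Suc show ?case
    using Ck_Suc_imp_Ck[of k f] Ck_Suc_imp_Ck[of k g] by (auto intro!: Ck_add)
qed

lemma Ck_const: "Ck k (\<lambda>x. c)"
proof (induction k arbitrary: c)
  case 0
  then show ?case by simp
next
  case (Suc k)
  have "pd j (\<lambda>x. c) = (\<lambda>x. 0)" for j
    by (rule ext, rule pd_eq) (rule has_derivative_const)
  with Suc show ?case by simp
qed

text \<open>
  Schwarz's theorem on mixed second derivatives: write \<open>f (x + t e\<^sub>i) - f x\<close> as the integral of
  \<open>\<partial>\<^sub>i f\<close>, differentiate under the integral sign in direction \<open>j\<close>, and then take the derivative
  in \<open>t\<close> at \<open>0\<close>.
\<close>

lemma pd_commute:
  fixes f :: "real^3 \<Rightarrow> 'b::banach"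
  assumes "smooth f"
  shows "pd i (pd j f) x = pd j (pd i f) x"
proof -
  let ?ei = "axis i 1 :: real^3" and ?ej = "axis j 1 :: real^3"
  note d = smooth_differentiable[OF assms] smooth_differentiable[OF smooth_pd[OF assms]]
  have cij: "continuous_on UNIV (pd j (pd i f))"
    by (intro smooth_continuous smooth_pd assms)
  have FTC: "integral (cbox 0 t) (\<lambda>s. pd i f (y + s *\<^sub>R ?ei)) = f (y + t *\<^sub>R ?ei) - f y" 
    if "0 \<le> t" for y t
    using fundamental_theorem_of_calculus[OF that, of "\<lambda>s. f (y + s *\<^sub>R ?ei)" "\<lambda>s. pd i f (y + s *\<^sub>R ?ei)"]
      has_vector_derivative_at_within[OF pd_line[OF d(1)]]
    by (auto dest: integral_unique)
  have step: "pd j f (x + t *\<^sub>R ?ei) - pd j f x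
      = integral (cbox 0 t) (\<lambda>s. pd j (pd i f) (x + s *\<^sub>R ?ei))" if t: "0 \<le> t" for t
  proof -
    have "((\<lambda>r. integral (cbox 0 t) (\<lambda>s. pd i f ((x + s *\<^sub>R ?ei) + r *\<^sub>R ?ej)))
      has_vector_derivative
        integral (cbox 0 t) (\<lambda>s. pd j (pd i f) ((x + s *\<^sub>R ?ei) + 0 *\<^sub>R ?ej))) (at 0 within UNIV)"
    proof (rule leibniz_rule_vector_derivative[where f="\<lambda>r s. pd i f ((x + s *\<^sub>R ?ei) + r *\<^sub>R ?ej)"
          and fx = "\<lambda>r s. pd j (pd i f) ((x + s *\<^sub>R ?ei) + r *\<^sub>R ?ej)"])
      fix r s :: real
      show "((\<lambda>r. pd i f ((x + s *\<^sub>R ?ei) + r *\<^sub>R ?ej)) has_vector_derivative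
          pd j (pd i f) ((x + s *\<^sub>R ?ei) + r *\<^sub>R ?ej)) (at r)"
        by (rule pd_line[OF d(2)])
    next
      fix r :: real
      have "continuous_on (cbox 0 t) (\<lambda>s. pd i f ((x + s *\<^sub>R ?ei) + r *\<^sub>R ?ej))"
        by (rule continuous_on_compose2[OF smooth_continuous[OF smooth_pd[OF assms], of UNIV]])
          (auto intro!: continuous_intros)
      then show "(\<lambda>s. pd i f ((x + s *\<^sub>R ?ei) + r *\<^sub>R ?ej)) integrable_on cbox 0 t"
        by (rule integrable_continuous)
    next
      show "continuous_on (UNIV \<times> cbox 0 t) (\<lambda>(r, s). pd j (pd i f) ((x + s *\<^sub>R ?ei) + r *\<^sub>R ?ej))"
        unfolding split_beta
        by (rule continuous_on_compose2[OF cij]) (auto intro!: continuous_intros)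
    qed auto
    moreover have "integral (cbox 0 t) (\<lambda>s. pd i f ((x + s *\<^sub>R ?ei) + r *\<^sub>R ?ej))
        = f ((x + t *\<^sub>R ?ei) + r *\<^sub>R ?ej) - f (x + r *\<^sub>R ?ej)" for r
      using FTC[OF t, of "x + r *\<^sub>R ?ej"] by (simp add: algebra_simps)
    ultimately have "((\<lambda>r. f ((x + t *\<^sub>R ?ei) + r *\<^sub>R ?ej) - f (x + r *\<^sub>R ?ej)) has_vector_derivative
        integral (cbox 0 t) (\<lambda>s. pd j (pd i f) (x + s *\<^sub>R ?ei))) (at 0)"
      by simp
    moreover have "((\<lambda>r. f ((x + t *\<^sub>R ?ei) + r *\<^sub>R ?ej) - f (x + r *\<^sub>R ?ej)) has_vector_derivative
        pd j f (x + t *\<^sub>R ?ei) - pd j f x) (at 0)"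
      by (intro has_vector_derivative_diff pd_line0 d)
    ultimately show ?thesis by (rule vector_derivative_unique_at[symmetric])
  qed
  have "((\<lambda>t. integral {0..t} (\<lambda>s. pd j (pd i f) (x + s *\<^sub>R ?ei))) has_vector_derivative
      pd j (pd i f) (x + 0 *\<^sub>R ?ei)) (at 0 within {0..1})"
    by (rule integral_has_vector_derivative)
      (auto intro!: continuous_on_compose2[OF cij] continuous_intros)
  then have "((\<lambda>t. pd j f (x + t *\<^sub>R ?ei) - pd j f x) has_vector_derivative pd j (pd i f) x)
      (at 0 within {0..1})"
    using has_vector_derivative_transform[of 0 "{0..1}" "\<lambda>t. pd j f (x + t *\<^sub>R ?ei) - pd j f x"]
    by (simp add: step)
  moreover have "((\<lambda>t. pd j f (x + t *\<^sub>R ?ei) - pd j f x) has_vector_derivative pd i (pd j f) x)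
      (at 0 within {0..1})"
    using has_vector_derivative_diff[OF pd_line0[OF d(2)] has_vector_derivative_const]
    by (simp add: has_vector_derivative_at_within)
  ultimately show ?thesis
    using vector_derivative_unique_within[of 0 "{0..1::real}"]
    by (metis at_within_Icc_at_right trivial_limit_at_right_real zero_less_one)
qed

section \<open>Integration by parts\<close>

lemma integrable_bounded_support:
  fixes h :: "'a::euclidean_space \<Rightarrow> 'b::euclidean_space"
  assumes "continuous_on UNIV h" "bounded K" "\<And>x. x \<notin> K \<Longrightarrow> h x = 0"
  shows "integrable lborel h"
proof -
  obtain R where R: "K \<subseteq> ball 0 R"
    using bounded_subset_ballD[OF assms(2)] by blast
  have "integrable lborel (\<lambda>x. indicator (cball 0 R) x *\<^sub>R h x)"
    by (rule borel_integrable_compact) (auto intro: continuous_on_subset[OF assms(1)])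
  moreover have "indicator (cball 0 R) x *\<^sub>R h x = h x" for x
  proof (cases "x \<in> cball 0 R")
    case False
    then have "x \<notin> K" using R by auto
    then show ?thesis using assms(3) by simp
  qed simp
  ultimately show ?thesis by (simp only:)
qed

text \<open>
  The integral of \<open>n (f (x + e\<^sub>j / n) - f x)\<close> vanishes by translation invariance, and dominated
  convergence identifies its limit.
\<close>

lemma integral_partial_derivative_zero:
  fixes f g :: "real^3 \<Rightarrow> real"
  assumes f: "continuous_on UNIV f" and g: "continuous_on UNIV g"
    and d: "\<And>x. ((\<lambda>t. f (x + t *\<^sub>R axis j 1)) has_vector_derivative g x) (at 0)"
    and K: "bounded K" "\<And>x. x \<notin> K \<Longrightarrow> f x = 0" "\<And>x. x \<notin> K \<Longrightarrow> g x = 0"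
  shows "integrable lborel g" and "integral\<^sup>L lborel g = 0"
proof -
  let ?e = "axis j 1 :: real^3"
  obtain R where R: "R > 0" "K \<subseteq> ball 0 R"
    using bounded_subset_ballD[OF K(1)] by blast
  show "integrable lborel g" by (rule integrable_bounded_support[OF g K(1,3)])
  have fi: "integrable lborel f" by (rule integrable_bounded_support[OF f K(1,2)])
  have line: "((\<lambda>t. f (x + t *\<^sub>R ?e)) has_vector_derivative g (x + t *\<^sub>R ?e)) (at t)" for x t
  proof -
    have "((\<lambda>s. s - t) has_vector_derivative 1) (at t)" 
      by (auto intro!: derivative_eq_intros simp: has_vector_derivative_def)
    moreover have "((\<lambda>s. f ((x + t *\<^sub>R ?e) + s *\<^sub>R ?e)) has_vector_derivative g (x + t *\<^sub>R ?e)) (at (t - t))"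
      using d[of "x + t *\<^sub>R ?e"] by simp
    ultimately have "(((\<lambda>s. f ((x + t *\<^sub>R ?e) + s *\<^sub>R ?e)) \<circ> (\<lambda>s. s - t)) has_vector_derivative 1 *\<^sub>R g (x + t *\<^sub>R ?e)) (at t)"
      by (rule vector_diff_chain_at)
    then show ?thesis by (simp add: o_def algebra_simps)
  qed
  have "\<exists>B. \<forall>x. \<bar>g x\<bar> \<le> B"
  proof -
    have "compact (g ` cball 0 R)"
      by (intro compact_continuous_image continuous_on_subset[OF g]) auto
    then obtain B where B: "\<And>x. x \<in> cball 0 R \<Longrightarrow> \<bar>g x\<bar> \<le> B"
      using compact_imp_bounded bounded_iff by (metis imageI real_norm_def)
    have "\<bar>g x\<bar> \<le> max B 0" for x
    proof (cases "x \<in> cball 0 R")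
      case True
      then show ?thesis using B by fastforce
    next
      case False
      then have "x \<notin> K" using R(2) by auto
      then show ?thesis using K(3) by simp
    qed
    then show ?thesis by blast
  qed
  then obtain B where B: "\<And>x. \<bar>g x\<bar> \<le> B" by blast
  then have B0: "0 \<le> B" by (meson abs_ge_zero order_trans)
  define q where "q n x = (f (x + inverse (real (Suc n)) *\<^sub>R ?e) - f x) / inverse (real (Suc n))" for n x
  have lip: "\<bar>f (x + t *\<^sub>R ?e) - f x\<bar> \<le> B * t" if t: "0 \<le> t" for x t
  proof -
    have "norm (f (x + t *\<^sub>R ?e) - f (x + 0 *\<^sub>R ?e)) \<le> B * norm (t - 0)"
    proof (rule differentiable_bound[of "{0..t}" "\<lambda>s. f (x + s *\<^sub>R ?e)" "\<lambda>s h. h *\<^sub>R g (x + s *\<^sub>R ?e)"])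
      fix s
      show "((\<lambda>s. f (x + s *\<^sub>R ?e)) has_derivative (\<lambda>h. h *\<^sub>R g (x + s *\<^sub>R ?e))) (at s within {0..t})"
        using line[of x s] by (simp add: has_vector_derivative_def has_derivative_at_withinI)
      show "onorm (\<lambda>h. h *\<^sub>R g (x + s *\<^sub>R ?e)) \<le> B"
        by (rule onorm_le) (use mult_left_mono[OF B abs_ge_zero] in \<open>simp add: abs_mult mult.commute\<close>)
    qed (use t in auto)
    then show ?thesis using t by simp
  qed
  have lim: "(\<lambda>n. q n x) \<longlonglongrightarrow> g x" for x
  proof -
    have "((\<lambda>t. f (x + t *\<^sub>R ?e)) has_real_derivative g x) (at 0)"
      using d[of x] by (simp add: has_real_derivative_iff_has_vector_derivative)
    then have "((\<lambda>t. (f (x + t *\<^sub>R ?e) - f x) / t) \<longlongrightarrow> g x) (at 0)"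
      by (simp add: DERIV_def)
    moreover have "filterlim (\<lambda>n. inverse (real (Suc n))) (at 0) sequentially"
      by (rule filterlim_atI[OF LIMSEQ_inverse_real_of_nat]) auto
    ultimately show ?thesis
      unfolding q_def by (rule filterlim_compose)
  qed
  have shift: "integrable lborel (\<lambda>x. f (x + v))" "(LINT x|lborel. f (x + v)) = (LINT x|lborel. f x)" for v
  proof -
    have "integrable (distr lborel borel (\<lambda>x. v + x)) f"
      using fi by (simp add: lborel_distr_plus)
    then show "integrable lborel (\<lambda>x. f (x + v))"
      by (subst (asm) integrable_distr_eq)
        (use f in \<open>auto simp: add.commute borel_measurable_continuous_onI\<close>)
    have "(LINT x|lborel. f x) = (LINT x|distr lborel borel (\<lambda>x. v + x). f x)"
      by (simp add: lborel_distr_plus)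
    also have "\<dots> = (LINT x|lborel. f (v + x))"
      by (rule integral_distr) (use f in \<open>auto simp: borel_measurable_continuous_onI\<close>)
    finally show "(LINT x|lborel. f (x + v)) = (LINT x|lborel. f x)"
      by (simp add: add.commute)
  qed
  have q0: "integrable lborel (q n)" "(LINT x|lborel. q n x) = 0" for n
    unfolding q_def using shift fi by simp_all
  have "(\<lambda>n. LINT x|lborel. q n x) \<longlonglongrightarrow> (LINT x|lborel. g x)"
  proof (rule integral_dominated_convergence)
    show "integrable lborel (\<lambda>x. indicator (cball 0 (R + 1)) x *\<^sub>R B :: real)"
      by (rule borel_integrable_compact) auto
    show "AE x in lborel. norm (q n x) \<le> indicator (cball 0 (R + 1)) x *\<^sub>R B" for n
    proof (rule AE_I2)
      fix x
      show "norm (q n x) \<le> indicator (cball 0 (R + 1)) x *\<^sub>R B"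
      proof (cases "x \<in> cball 0 (R + 1)")
        case True
        have "0 < inverse (real (Suc n))" by simp
        then show ?thesis using True lip[of "inverse (real (Suc n))" x]
          unfolding q_def by (auto simp: abs_divide divide_le_eq)
      next
        case False
        let ?y = "x + inverse (real (Suc n)) *\<^sub>R ?e"
        have "norm (inverse (real (Suc n)) *\<^sub>R ?e) \<le> 1"
          by (simp add: norm_axis_1 field_simps)
        then have "norm x \<le> norm ?y + 1"
          using norm_triangle_ineq4[of ?y "inverse (real (Suc n)) *\<^sub>R ?e"] by simp
        then have "x \<notin> K" "?y \<notin> K" using False R(2) by (auto simp: subset_iff)
        then show ?thesis using K(2) B0 by (simp add: q_def)
      qed
    qed
    show "AE x in lborel. (\<lambda>n. q n x) \<longlonglongrightarrow> g x" using lim by simp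
    show "g \<in> borel_measurable lborel"
      using g by (simp add: borel_measurable_continuous_onI)
    show "q n \<in> borel_measurable lborel" for n
      using q0(1) by (rule borel_measurable_integrable)
  qed
  then have "(\<lambda>n. 0::real) \<longlonglongrightarrow> (LINT x|lborel. g x)" by (simp only: q0(2))
  then show "integral\<^sup>L lborel g = 0" by (simp add: LIMSEQ_const_iff)
qed

section \<open>A Carleman estimate\<close>

lemma inner_line_derivative:
  fixes f g :: "real^3 \<Rightarrow> 'b::euclidean_space"
  assumes "smooth f" "smooth g" "bounded_linear B"
  shows "((\<lambda>t. f (x + t *\<^sub>R axis j 1) \<bullet> B (g (x + t *\<^sub>R axis j 1))) has_real_derivative
      pd j f x \<bullet> B (g x) + f x \<bullet> B (pd j g x)) (at 0)"
proof -
  have f: "((\<lambda>t. f (x + t *\<^sub>R axis j 1)) has_vector_derivative pd j f x) (at 0)"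
    and g: "((\<lambda>t. g (x + t *\<^sub>R axis j 1)) has_vector_derivative pd j g x) (at 0)"
    by (rule pd_line0[OF smooth_differentiable[OF assms(1)]],
        rule pd_line0[OF smooth_differentiable[OF assms(2)]])
  have "((\<lambda>t. f (x + t *\<^sub>R axis j 1) \<bullet> B (g (x + t *\<^sub>R axis j 1))) has_vector_derivative
      f (x + 0 *\<^sub>R axis j 1) \<bullet> B (pd j g x) + pd j f x \<bullet> B (g (x + 0 *\<^sub>R axis j 1))) (at 0)"
    by (rule bounded_bilinear.has_vector_derivative[OF bounded_bilinear_inner f
          bounded_linear.has_vector_derivative[OF assms(3) g]])
  then show ?thesis
    by (simp add: has_real_derivative_iff_has_vector_derivative add.commute)
qed

lemma pd_zero_outside_closed:
  assumes "closed K" "\<And>x. x \<notin> K \<Longrightarrow> f x = 0" "x \<notin> K"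
  shows "pd j f x = 0"
proof -
  have "((\<lambda>_. 0) has_derivative (\<lambda>_. 0)) (at x)" by (rule has_derivative_const)
  then have "(f has_derivative (\<lambda>_. 0)) (at x)"
    by (rule has_derivative_transform_within_open[of _ _ _ _ "- K"]) (use assms in auto)
  from pd_eq[OF this] show ?thesis .
qed

lemma DERIV_cong_eq:
  assumes "(f has_real_derivative D) F" "\<And>x. f x = g x" "D = D'"
  shows "(g has_real_derivative D') F"
  using assms by (metis ext)

text \<open>
  Write the operator as \<open>a + b\<close> with \<open>a = \<partial>\<^sub>1\<phi> + w' \<phi>\<close> and \<open>b = B \<partial>\<^sub>2\<phi> + C \<partial>\<^sub>3\<phi> - w' \<phi>\<close>. Then \<open>\<bar>a + b\<bar>\<^sup>2 \<ge> 2 a \<bullet> b\<close>, and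
  \<open>2 exp (2 w) a \<bullet> b\<close> differs from \<open>exp (2 w) w'' \<bar>\<phi>\<bar>\<^sup>2\<close> by a divergence \<open>\<partial>\<^sub>1X + \<partial>\<^sub>2Y + \<partial>\<^sub>3Z\<close>, because \<open>B\<close> and
  \<open>C\<close> are skew and second derivatives commute. This is the commutator argument for \<open>\<partial>\<^sub>1 + S\<close> with
  \<open>S = B \<partial>\<^sub>2 + C \<partial>\<^sub>3\<close> symmetric.
\<close>

lemma carleman_estimate:
  fixes \<phi> :: "real^3 \<Rightarrow> 'b::euclidean_space"
  assumes \<phi>: "smooth \<phi>" and K: "compact K" "\<And>x. x \<notin> K \<Longrightarrow> \<phi> x = 0"
    and B: "bounded_linear B" "\<And>u v. u \<bullet> B v = - (B u \<bullet> v)"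
    and C: "bounded_linear C" "\<And>u v. u \<bullet> C v = - (C u \<bullet> v)"
    and w: "\<And>s. (w has_real_derivative w' s) (at s)" "\<And>s. (w' has_real_derivative w'' s) (at s)"
      "continuous_on UNIV w''"
  shows "(LINT x|lborel. exp (2 * w (x $ 1)) * (w'' (x $ 1) * (norm (\<phi> x))\<^sup>2)) \<le>
    (LINT x|lborel. exp (2 * w (x $ 1)) * (norm (pd 1 \<phi> x + B (pd 2 \<phi> x) + C (pd 3 \<phi> x)))\<^sup>2)"
proof -
  have bK: "bounded K" and cK: "closed K"
    using K(1) compact_imp_bounded compact_imp_closed by auto
  have z1: "pd j \<phi> x = 0" if "x \<notin> K" for x j
    using pd_zero_outside_closed[OF cK K(2) that] .
  have z2: "pd i (pd j \<phi>) x = 0" if "x \<notin> K" for x i j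
    using pd_zero_outside_closed[OF cK z1 that] .
  have s: "smooth (pd j \<phi>)" "smooth (pd i (pd j \<phi>))" for i j
    by (rule smooth_pd[OF \<phi>], rule smooth_pd[OF smooth_pd[OF \<phi>]])
  have cw: "continuous_on UNIV w" "continuous_on UNIV w'"
    by (simp_all add: continuous_on_eq_continuous_at DERIV_isCont[OF w(1)] DERIV_isCont[OF w(2)])
  have cx: "continuous_on UNIV (\<lambda>x::real^3. x $ 1)" by (intro continuous_intros)
  note cc [continuous_intros] = 
    smooth_continuous[OF \<phi>] smooth_continuous[OF s(1)] smooth_continuous[OF s(2)]
    continuous_on_compose2[OF cw(1) cx] continuous_on_compose2[OF cw(2) cx]
    continuous_on_compose2[OF w(3) cx]
    bounded_linear.continuous_on[OF B(1)] bounded_linear.continuous_on[OF C(1)]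
  define E where "E x = exp (2 * w (x $ 1))" for x :: "real^3"
  have cE [continuous_intros]: "continuous_on UNIV E"
    unfolding E_def by (intro continuous_intros) auto
  define a where "a x = pd 1 \<phi> x + w' (x $ 1) *\<^sub>R \<phi> x" for x
  define b where "b x = B (pd 2 \<phi> x) + C (pd 3 \<phi> x) - w' (x $ 1) *\<^sub>R \<phi> x" for x
  define X where "X x = E x * (\<phi> x \<bullet> B (pd 2 \<phi> x) + \<phi> x \<bullet> C (pd 3 \<phi> x) - w' (x $ 1) * (\<phi> x \<bullet> \<phi> x))" for x
  define Y where "Y x = - (E x * (\<phi> x \<bullet> B (pd 1 \<phi> x)))" for x
  define Z where "Z x = - (E x * (\<phi> x \<bullet> C (pd 1 \<phi> x)))" for x
  define X' where "X' x = 2 * w' (x $ 1) * X x +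
      E x * (pd 1 \<phi> x \<bullet> B (pd 2 \<phi> x) + \<phi> x \<bullet> B (pd 1 (pd 2 \<phi>) x)
        + (pd 1 \<phi> x \<bullet> C (pd 3 \<phi> x) + \<phi> x \<bullet> C (pd 1 (pd 3 \<phi>) x))
        - (w'' (x $ 1) * (\<phi> x \<bullet> \<phi> x) + w' (x $ 1) * (2 * (pd 1 \<phi> x \<bullet> \<phi> x))))" for x
  define Y' where "Y' x = - (E x * (pd 2 \<phi> x \<bullet> B (pd 1 \<phi> x) + \<phi> x \<bullet> B (pd 2 (pd 1 \<phi>) x)))" for x
  define Z' where "Z' x = - (E x * (pd 3 \<phi> x \<bullet> C (pd 1 \<phi> x) + \<phi> x \<bullet> C (pd 3 (pd 1 \<phi>) x)))" for x
  have ax: "axis 1 1 $ (1::3) = (1::real)" "axis 2 1 $ (1::3) = (0::real)" "axis 3 1 $ (1::3) = (0::real)"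
    by (simp_all add: axis_def)
  have lB: "((\<lambda>t. \<phi> (x + t *\<^sub>R axis j 1) \<bullet> B (pd k \<phi> (x + t *\<^sub>R axis j 1))) has_real_derivative
      pd j \<phi> x \<bullet> B (pd k \<phi> x) + \<phi> x \<bullet> B (pd j (pd k \<phi>) x)) (at 0)" for j k x
    by (rule inner_line_derivative[OF \<phi> s(1) B(1)])
  have lC: "((\<lambda>t. \<phi> (x + t *\<^sub>R axis j 1) \<bullet> C (pd k \<phi> (x + t *\<^sub>R axis j 1))) has_real_derivative
      pd j \<phi> x \<bullet> C (pd k \<phi> x) + \<phi> x \<bullet> C (pd j (pd k \<phi>) x)) (at 0)" for j k x
    by (rule inner_line_derivative[OF \<phi> s(1) C(1)])
  have lI: "((\<lambda>t. \<phi> (x + t *\<^sub>R axis j 1) \<bullet> \<phi> (x + t *\<^sub>R axis j 1)) has_real_derivative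
      2 * (pd j \<phi> x \<bullet> \<phi> x)) (at 0)" for x j
    using inner_line_derivative[OF \<phi> \<phi> bounded_linear_ident, of x j] by (simp add: inner_commute)
  have w1: "((\<lambda>t. w (x $ 1 + t)) has_real_derivative w' (x $ 1)) (at 0)"
    and w2: "((\<lambda>t. w' (x $ 1 + t)) has_real_derivative w'' (x $ 1)) (at 0)" for x :: "real^3"
    using w(1,2)[of "x $ 1"] DERIV_shift[of w "w' (x $ 1)" 0 "x $ 1"]
      DERIV_shift[of w' "w'' (x $ 1)" 0 "x $ 1"] by (simp_all add: add.commute)
  have dE: "((\<lambda>t. E (x + t *\<^sub>R axis 1 1)) has_real_derivative E x * (2 * w' (x $ 1))) (at 0)" for x
    using DERIV_chain2[OF DERIV_exp DERIV_cmult[OF w1[of x], of 2]] by (simp add: E_def ax)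
  have E0: "E (x + t *\<^sub>R axis 2 1) = E x" "E (x + t *\<^sub>R axis 3 1) = E x" for x t
    by (simp_all add: E_def ax)
  have dX: "((\<lambda>t. X (x + t *\<^sub>R axis 1 1)) has_real_derivative X' x) (at 0)" for x
    using DERIV_mult[OF dE[of x] DERIV_diff[OF DERIV_add[OF lB[of x 1 2] lC[of x 1 3]]
          DERIV_mult[OF w2[of x] lI[of x 1]]]]
    by (rule DERIV_cong_eq) (simp_all add: X_def X'_def ax algebra_simps)
  have dY: "((\<lambda>t. Y (x + t *\<^sub>R axis 2 1)) has_real_derivative Y' x) (at 0)" for x
    using DERIV_minus[OF DERIV_cmult[OF lB[of x 2 1], of "E x"]] 
    unfolding Y_def Y'_def E0 .
  have dZ: "((\<lambda>t. Z (x + t *\<^sub>R axis 3 1)) has_real_derivative Z' x) (at 0)" for x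
    using DERIV_minus[OF DERIV_cmult[OF lC[of x 3 1], of "E x"]] 
    unfolding Z_def Z'_def E0 .
  have lin0: "B 0 = 0" "C 0 = 0"
    by (simp_all add: linear_0 bounded_linear.linear B(1) C(1))
  have zX: "X x = 0" "X' x = 0" and zY: "Y x = 0" "Y' x = 0" and zZ: "Z x = 0" "Z' x = 0" if "x \<notin> K" for x
    using that by (simp_all add: X_def X'_def Y_def Y'_def Z_def Z'_def K(2) z1)
  have "continuous_on UNIV X" unfolding X_def by (intro continuous_intros) auto
  moreover have "continuous_on UNIV X'" unfolding X'_def X_def by (intro continuous_intros) auto
  ultimately have iX: "integrable lborel X'" "integral\<^sup>L lborel X' = 0"
    using integral_partial_derivative_zero[of X X' 1 K] dX bK zX
    by (simp_all add: has_real_derivative_iff_has_vector_derivative)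
  have "continuous_on UNIV Y" unfolding Y_def by (intro continuous_intros)
  moreover have "continuous_on UNIV Y'" unfolding Y'_def by (intro continuous_intros)
  ultimately have iY: "integrable lborel Y'" "integral\<^sup>L lborel Y' = 0"
    using integral_partial_derivative_zero[of Y Y' 2 K] dY bK zY
    by (simp_all add: has_real_derivative_iff_has_vector_derivative)
  have "continuous_on UNIV Z" unfolding Z_def by (intro continuous_intros)
  moreover have "continuous_on UNIV Z'" unfolding Z'_def by (intro continuous_intros)
  ultimately have iZ: "integrable lborel Z'" "integral\<^sup>L lborel Z' = 0"
    using integral_partial_derivative_zero[of Z Z' 3 K] dZ bK zZ
    by (simp_all add: has_real_derivative_iff_has_vector_derivative)
  let ?l = "\<lambda>x. E x * (w'' (x $ 1) * (norm (\<phi> x))\<^sup>2)"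
  let ?r = "\<lambda>x. E x * (norm (pd 1 \<phi> x + B (pd 2 \<phi> x) + C (pd 3 \<phi> x)))\<^sup>2"
  have il: "integrable lborel ?l" and ir: "integrable lborel ?r"
    by (rule integrable_bounded_support[OF _ bK], (intro continuous_intros; simp),
        simp add: K(2) z1 lin0)+
  have key: "X' x + Y' x + Z' x = 2 * E x * (a x \<bullet> b x) - ?l x" for x
  proof -
    have "pd 2 \<phi> x \<bullet> B (pd 1 \<phi> x) = - (pd 1 \<phi> x \<bullet> B (pd 2 \<phi> x))"
      "pd 3 \<phi> x \<bullet> C (pd 1 \<phi> x) = - (pd 1 \<phi> x \<bullet> C (pd 3 \<phi> x))"
      using B(2) C(2) by (simp_all add: inner_commute)
    moreover have "pd 2 (pd 1 \<phi>) x = pd 1 (pd 2 \<phi>) x" "pd 3 (pd 1 \<phi>) x = pd 1 (pd 3 \<phi>) x"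
      using pd_commute[OF \<phi>] by auto
    ultimately show ?thesis
      unfolding X'_def Y'_def Z'_def X_def a_def b_def power2_norm_eq_inner
      by (simp add: inner_simps algebra_simps inner_commute)
  qed
  have sq: "2 * (a x \<bullet> b x) \<le> (norm (pd 1 \<phi> x + B (pd 2 \<phi> x) + C (pd 3 \<phi> x)))\<^sup>2" for x
  proof -
    have "pd 1 \<phi> x + B (pd 2 \<phi> x) + C (pd 3 \<phi> x) = a x + b x" by (simp add: a_def b_def)
    then show ?thesis
      using inner_ge_zero[of "a x"] inner_ge_zero[of "b x"]
      by (simp add: power2_norm_eq_inner inner_simps inner_commute)
  qed
  have "X' x + Y' x + Z' x \<le> ?r x - ?l x" for x
    using mult_left_mono[OF sq[of x], of "E x"] key[of x] by (simp add: E_def mult.assoc mult.left_commute)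
  then have "(LINT x|lborel. X' x + Y' x + Z' x) \<le> (LINT x|lborel. ?r x - ?l x)"
    using iX iY iZ il ir by (intro integral_mono) auto
  then show ?thesis using iX iY iZ il ir by (simp add: E_def)
qed

section \<open>The Hilbert space of square integrable functions\<close>

text \<open>
  The arguments are functions, so this is only a semidefinite form; linearity holds on square integrable
  arguments.
\<close>

definition L2_inner :: "(real^3) set \<Rightarrow> (real^3 \<Rightarrow> 'b::euclidean_space) \<Rightarrow> (real^3 \<Rightarrow> 'b) \<Rightarrow> real" where
  "L2_inner \<Omega> f g = (LINT x|lebesgue_on \<Omega>. f x \<bullet> g x)"

lemma L2_D:
  assumes "f \<in> L2 \<Omega>"
  shows "f \<in> borel_measurable (lebesgue_on \<Omega>)" "integrable (lebesgue_on \<Omega>) (\<lambda>x. (norm (f x))\<^sup>2)"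
  using assms by (auto simp: L2_def)

lemma L2_dominated:
  assumes "g \<in> L2 \<Omega>" "f \<in> borel_measurable (lebesgue_on \<Omega>)"
    "\<And>x. x \<in> \<Omega> \<Longrightarrow> norm (f x) \<le> C * norm (g x)"
  shows "f \<in> L2 \<Omega>"
  unfolding L2_def
proof (intro CollectI conjI assms(2))
  show "integrable (lebesgue_on \<Omega>) (\<lambda>x. (norm (f x))\<^sup>2)"
  proof (rule Bochner_Integration.integrable_bound)
    show "integrable (lebesgue_on \<Omega>) (\<lambda>x. C\<^sup>2 * (norm (g x))\<^sup>2)"
      using L2_D(2)[OF assms(1)] by simp
    show "(\<lambda>x. (norm (f x))\<^sup>2) \<in> borel_measurable (lebesgue_on \<Omega>)"
      using assms(2) by measurable
    show "AE x in lebesgue_on \<Omega>. norm ((norm (f x))\<^sup>2) \<le> norm (C\<^sup>2 * (norm (g x))\<^sup>2)"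
    proof (rule AE_I2)
      fix x assume "x \<in> space (lebesgue_on \<Omega>)"
      then have "norm (f x) \<le> C * norm (g x)" using assms(3) by (simp add: space_restrict_space)
      then have "(norm (f x))\<^sup>2 \<le> (C * norm (g x))\<^sup>2" by (intro power_mono) auto
      then show "norm ((norm (f x))\<^sup>2) \<le> norm (C\<^sup>2 * (norm (g x))\<^sup>2)"
        by (simp add: power_mult_distrib)
    qed
  qed
qed

lemma L2_inner_integrable:
  assumes "f \<in> L2 \<Omega>" "g \<in> L2 \<Omega>"
  shows "integrable (lebesgue_on \<Omega>) (\<lambda>x. f x \<bullet> g x)"
proof (rule Bochner_Integration.integrable_bound)
  show "integrable (lebesgue_on \<Omega>) (\<lambda>x. (norm (f x))\<^sup>2 + (norm (g x))\<^sup>2)"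
    using L2_D(2)[OF assms(1)] L2_D(2)[OF assms(2)] by simp
  show "(\<lambda>x. f x \<bullet> g x) \<in> borel_measurable (lebesgue_on \<Omega>)"
    using L2_D(1)[OF assms(1)] L2_D(1)[OF assms(2)] by measurable
  show "AE x in lebesgue_on \<Omega>. norm (f x \<bullet> g x) \<le> norm ((norm (f x))\<^sup>2 + (norm (g x))\<^sup>2)"
  proof (rule AE_I2)
    fix x
    have "\<bar>f x \<bullet> g x\<bar> \<le> norm (f x) * norm (g x)" by (rule Cauchy_Schwarz_ineq2)
    also have "\<dots> \<le> (norm (f x))\<^sup>2 + (norm (g x))\<^sup>2"
      using sum_squares_bound[of "norm (f x)" "norm (g x)"]
        mult_nonneg_nonneg[OF norm_ge_zero[of "f x"] norm_ge_zero[of "g x"]] by linarith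
    finally show "norm (f x \<bullet> g x) \<le> norm ((norm (f x))\<^sup>2 + (norm (g x))\<^sup>2)" by simp
  qed
qed

lemma L2_linear_combination:
  assumes "f \<in> L2 \<Omega>" "g \<in> L2 \<Omega>"
  shows "(\<lambda>x. f x + s *\<^sub>R g x) \<in> L2 \<Omega>"
proof -
  have "integrable (lebesgue_on \<Omega>) (\<lambda>x. (norm (f x))\<^sup>2 + 2 * s * (f x \<bullet> g x) + s\<^sup>2 * (norm (g x))\<^sup>2)"
    using L2_D(2)[OF assms(1)] L2_D(2)[OF assms(2)] L2_inner_integrable[OF assms] by simp
  moreover have "(norm (f x))\<^sup>2 + 2 * s * (f x \<bullet> g x) + s\<^sup>2 * (norm (g x))\<^sup>2 = (norm (f x + s *\<^sub>R g x))\<^sup>2" for x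
    unfolding power2_norm_eq_inner by (simp add: inner_simps inner_commute power2_eq_square)
  moreover have "(\<lambda>x. f x + s *\<^sub>R g x) \<in> borel_measurable (lebesgue_on \<Omega>)"
    using L2_D(1)[OF assms(1)] L2_D(1)[OF assms(2)] by measurable
  ultimately show ?thesis by (simp add: L2_def)
qed

lemma L2_add: "f \<in> L2 \<Omega> \<Longrightarrow> g \<in> L2 \<Omega> \<Longrightarrow> (\<lambda>x. f x + g x) \<in> L2 \<Omega>"
  using L2_linear_combination[of f \<Omega> g 1] by simp

lemma L2_diff: "f \<in> L2 \<Omega> \<Longrightarrow> g \<in> L2 \<Omega> \<Longrightarrow> (\<lambda>x. f x - g x) \<in> L2 \<Omega>"
  using L2_linear_combination[of f \<Omega> g "-1"] by simp

lemma L2_zero: "(\<lambda>x. 0) \<in> L2 \<Omega>"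
  by (simp add: L2_def)

lemma L2_sum: "finite I \<Longrightarrow> (\<And>i. i \<in> I \<Longrightarrow> f i \<in> L2 \<Omega>) \<Longrightarrow> (\<lambda>x. \<Sum>i\<in>I. f i x) \<in> L2 \<Omega>"
  by (induction I rule: finite_induct) (auto intro!: L2_add L2_zero)

lemma L2_bounded_linear:
  assumes "bounded_linear B" "f \<in> L2 \<Omega>"
  shows "(\<lambda>x. B (f x)) \<in> L2 \<Omega>"
proof (rule L2_dominated[OF assms(2)])
  have "B \<in> borel_measurable borel"
    using assms(1) by (simp add: borel_measurable_continuous_onI linear_continuous_on)
  then show "(\<lambda>x. B (f x)) \<in> borel_measurable (lebesgue_on \<Omega>)"
    using L2_D(1)[OF assms(2)] by (rule measurable_compose[rotated])
  show "norm (B (f x)) \<le> onorm B * norm (f x)" for x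
    by (rule onorm[OF assms(1)])
qed

lemma L2_inner_commute: "L2_inner \<Omega> f g = L2_inner \<Omega> g f"
  by (simp add: L2_inner_def inner_commute)

lemma L2_inner_self: "L2_inner \<Omega> f f = (LINT x|lebesgue_on \<Omega>. (norm (f x))\<^sup>2)"
  by (simp add: L2_inner_def power2_norm_eq_inner)

lemma L2_inner_self_nonneg: "0 \<le> L2_inner \<Omega> f f"
  by (simp add: L2_inner_self)

lemma L2_inner_linear_combination:
  assumes "f \<in> L2 \<Omega>" "g \<in> L2 \<Omega>" "h \<in> L2 \<Omega>"
  shows "L2_inner \<Omega> (\<lambda>x. f x + s *\<^sub>R g x) h = L2_inner \<Omega> f h + s * L2_inner \<Omega> g h"
  unfolding L2_inner_def
  using L2_inner_integrable[OF assms(1,3)] L2_inner_integrable[OF assms(2,3)]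
  by (simp add: inner_simps)

lemma L2_inner_diff:
  assumes "f \<in> L2 \<Omega>" "g \<in> L2 \<Omega>" "h \<in> L2 \<Omega>"
  shows "L2_inner \<Omega> (\<lambda>x. f x - g x) h = L2_inner \<Omega> f h - L2_inner \<Omega> g h"
  using L2_inner_linear_combination[OF assms, of "-1"] by simp

lemma L2_inner_expand:
  assumes "f \<in> L2 \<Omega>" "g \<in> L2 \<Omega>"
  shows "L2_inner \<Omega> (\<lambda>x. f x + s *\<^sub>R g x) (\<lambda>x. f x + s *\<^sub>R g x) =
     L2_inner \<Omega> f f + 2 * s * L2_inner \<Omega> f g + s\<^sup>2 * L2_inner \<Omega> g g"
proof -
  let ?h = "\<lambda>x. f x + s *\<^sub>R g x"
  have "L2_inner \<Omega> ?h ?h = L2_inner \<Omega> f ?h + s * L2_inner \<Omega> g ?h"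
    by (rule L2_inner_linear_combination[OF assms L2_linear_combination[OF assms]])
  moreover have "L2_inner \<Omega> f ?h = L2_inner \<Omega> f f + s * L2_inner \<Omega> f g"
    using L2_inner_linear_combination[OF assms assms(1), of s]
    by (metis L2_inner_commute)
  moreover have "L2_inner \<Omega> g ?h = L2_inner \<Omega> f g + s * L2_inner \<Omega> g g"
    using L2_inner_linear_combination[OF assms assms(2), of s]
    by (metis L2_inner_commute)
  ultimately show ?thesis by (simp add: power2_eq_square algebra_simps)
qed

lemma L2_inner_scale: "L2_inner \<Omega> (\<lambda>x. c *\<^sub>R f x) (\<lambda>x. c *\<^sub>R g x) = c\<^sup>2 * L2_inner \<Omega> f g"
  unfolding L2_inner_def inner_scaleR_left inner_scaleR_right
  by (simp add: power2_eq_square mult.assoc)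

lemma L2_Cauchy_Schwarz:
  assumes f: "f \<in> L2 \<Omega>" and g: "g \<in> L2 \<Omega>"
  shows "(L2_inner \<Omega> f g)\<^sup>2 \<le> L2_inner \<Omega> f f * L2_inner \<Omega> g g"
proof -
  define a b c where "a = L2_inner \<Omega> f f" and "b = L2_inner \<Omega> f g" and "c = L2_inner \<Omega> g g"
  have q: "0 \<le> a + 2 * s * b + s\<^sup>2 * c" for s
    using L2_inner_self_nonneg[of \<Omega> "\<lambda>x. f x + s *\<^sub>R g x"] L2_inner_expand[OF f g, of s]
    by (simp add: a_def b_def c_def)
  have c: "0 \<le> c" "0 \<le> a" unfolding a_def c_def by (rule L2_inner_self_nonneg)+
  show ?thesis
  proof (cases "c = 0")
    case True
    have "b = 0"
    proof (rule ccontr)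
      assume "b \<noteq> 0"
      then show False using q[of "- (a + 1) / (2 * b)"] True by (simp add: field_simps)
    qed
    then show ?thesis using c by (simp add: a_def b_def c_def)
  next
    case False
    then have "0 < c" using c by simp
    then have "0 \<le> (a + 2 * (- b / c) * b + (- b / c)\<^sup>2 * c) * c" using q[of "- b / c"] by simp
    also have "\<dots> = a * c - b\<^sup>2" using \<open>0 < c\<close> by (simp add: field_simps power2_eq_square)
    finally show ?thesis by (simp add: a_def b_def c_def)
  qed
qed

text \<open>
  On a bounded set a Cauchy sequence in \<open>L\<^sup>2\<close> is one in \<open>L\<^sup>1\<close>, so a subsequence converges almost everywhere,
  and Fatou's lemma shows that this limit is a limit in \<open>L\<^sup>2\<close>.
\<close>

lemma L2_complete:
  fixes f :: "nat \<Rightarrow> real^3 \<Rightarrow> 'b::euclidean_space"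
  assumes \<Omega>: "bounded \<Omega>" "open \<Omega>" and f: "\<And>n. f n \<in> L2 \<Omega>"
    and cauchy: "\<And>e. 0 < e \<Longrightarrow> \<exists>N. \<forall>m\<ge>N. \<forall>n\<ge>N. 
      L2_inner \<Omega> (\<lambda>x. f m x - f n x) (\<lambda>x. f m x - f n x) < e"
  obtains g where "g \<in> L2 \<Omega>" "(\<lambda>n. L2_inner \<Omega> (\<lambda>x. f n x - g x) (\<lambda>x. f n x - g x)) \<longlonglongrightarrow> 0"
proof -
  let ?M = "lebesgue_on \<Omega>"
  have lm: "\<Omega> \<in> lmeasurable" using \<Omega> lmeasurable_open by blast
  have "integrable lebesgue (indicat_real \<Omega>)"
    by (rule integrable_real_indicator) (use lm in \<open>simp_all add: fmeasurable_def del: emeasure_completion\<close>)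
  then have one: "(\<lambda>x. 1::real) \<in> L2 \<Omega>"
    unfolding L2_def by (simp add: lm fmeasurableD integrable_restrict_space)
  define d where "d m n x = f m x - f n x" for m n x
  have d: "d m n \<in> L2 \<Omega>" for m n unfolding d_def by (intro L2_diff f)
  have nd: "(\<lambda>x. norm (d m n x)) \<in> L2 \<Omega>" for m n
    by (rule L2_dominated[OF d[of m n], where C = 1]) (use L2_D(1)[OF d[of m n]] in auto)
  have int_one: "integrable ?M (\<lambda>x. norm (h x))" if "h \<in> L2 \<Omega>" for h :: "real^3 \<Rightarrow> 'b"
  proof -
    have "(\<lambda>x. norm (h x)) \<in> L2 \<Omega>" 
      by (rule L2_dominated[OF that, where C = 1]) (use L2_D(1)[OF that] in auto)
    from L2_inner_integrable[OF this one] show ?thesis by simp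
  qed
  have int: "integrable ?M (f n)" for n
    using int_one[OF f[of n]] L2_D(1)[OF f[of n]] by (simp add: integrable_norm_iff)
  define \<mu> where "\<mu> = L2_inner \<Omega> (\<lambda>x. 1) (\<lambda>x. 1::real)"
  have \<mu>: "0 \<le> \<mu>" unfolding \<mu>_def by (rule L2_inner_self_nonneg)
  have L1: "(LINT x|?M. norm (d m n x))\<^sup>2 \<le> L2_inner \<Omega> (d m n) (d m n) * \<mu>" for m n
    using L2_Cauchy_Schwarz[OF nd one, of m n]
    by (simp add: L2_inner_self \<mu>_def) (simp add: L2_inner_def)
  obtain r where r: "strict_mono r" "AE x in ?M. Cauchy (\<lambda>i. f (r i) x)"
  proof (rule cauchy_L1_AE_cauchy_subseq[OF int])
    fix e :: real assume e: "0 < e"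
    then obtain N where N: "\<And>m n. m \<ge> N \<Longrightarrow> n \<ge> N \<Longrightarrow> L2_inner \<Omega> (d m n) (d m n) < e\<^sup>2 / (\<mu> + 1)"
      using cauchy[of "e\<^sup>2 / (\<mu> + 1)"] \<mu> unfolding d_def by (auto simp: zero_less_divide_iff)
    have "(LINT x|?M. norm (d m n x)) < e" if "m \<ge> N" "n \<ge> N" for m n
    proof -
      have "(LINT x|?M. norm (d m n x))\<^sup>2 \<le> L2_inner \<Omega> (d m n) (d m n) * (\<mu> + 1)"
        using L1[of m n] L2_inner_self_nonneg[of \<Omega> "d m n"] by (simp add: distrib_left)
      also have "\<dots> < e\<^sup>2" using N[OF that] \<mu> by (simp add: pos_less_divide_eq)
      finally show ?thesis using e by (simp add: power2_less_imp_less)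
    qed
    then show "\<exists>N. \<forall>i\<ge>N. \<forall>j\<ge>N. LINT x|?M. norm (f i x - f j x) < e" 
      unfolding d_def by blast
  qed
  \<comment> \<open>Where the limit does not exist, \<open>lim\<close> has an arbitrary value; the exceptional set is null.\<close>
  define g where "g x = lim (\<lambda>i. f (r i) x)" for x
  have mf [measurable]: "f n \<in> borel_measurable ?M" for n using L2_D(1)[OF f] .
  have mg [measurable]: "g \<in> borel_measurable ?M"
    unfolding g_def by (rule borel_measurable_lim_metric) (rule mf)
  have lim: "AE x in ?M. (\<lambda>i. f (r i) x) \<longlonglongrightarrow> g x"
    using r(2) unfolding g_def by eventually_elim (simp add: Cauchy_convergent_iff convergent_LIMSEQ_iff)
  have close: "(\<integral>\<^sup>+x. ennreal ((norm (f n x - g x))\<^sup>2) \<partial>?M) \<le> ennreal e"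
    if N: "\<And>m. m \<ge> N \<Longrightarrow> L2_inner \<Omega> (d n m) (d n m) < e" for n N e
  proof -
    have "(\<integral>\<^sup>+x. ennreal ((norm (f n x - g x))\<^sup>2) \<partial>?M)
        = (\<integral>\<^sup>+x. liminf (\<lambda>i. ennreal ((norm (f n x - f (r i) x))\<^sup>2)) \<partial>?M)"
    proof (rule nn_integral_cong_AE, use lim in eventually_elim)
      case (elim x)
      have "(\<lambda>i. ennreal ((norm (f n x - f (r i) x))\<^sup>2)) \<longlonglongrightarrow> ennreal ((norm (f n x - g x))\<^sup>2)"
        by (intro tendsto_ennrealI tendsto_intros elim)
      from lim_imp_Liminf[OF trivial_limit_sequentially this] show ?case by (rule sym)
    qed
    also have "\<dots> \<le> liminf (\<lambda>i. \<integral>\<^sup>+x. ennreal ((norm (f n x - f (r i) x))\<^sup>2) \<partial>?M)"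
      by (rule nn_integral_liminf) measurable
    also have "\<dots> = liminf (\<lambda>i. ennreal (L2_inner \<Omega> (d n (r i)) (d n (r i))))"
      using L2_D(2)[OF d] by (simp add: nn_integral_eq_integral L2_inner_self d_def)
    also have "\<dots> \<le> ennreal e"
    proof (rule Liminf_le)
      have "\<forall>\<^sub>F i in sequentially. N \<le> r i"
        using filterlim_subseq[OF r(1)] by (simp add: filterlim_at_top)
      then show "\<forall>\<^sub>F i in sequentially. ennreal (L2_inner \<Omega> (d n (r i)) (d n (r i))) \<le> ennreal e"
        by eventually_elim (use N in \<open>force intro: ennreal_leI\<close>)
    qed simp
    finally show ?thesis .
  qed
  have fg: "(\<lambda>x. f n x - g x) \<in> L2 \<Omega>" "L2_inner \<Omega> (\<lambda>x. f n x - g x) (\<lambda>x. f n x - g x) \<le> e" 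
    if N: "\<And>m. m \<ge> N \<Longrightarrow> L2_inner \<Omega> (d n m) (d n m) < e" for n N e
  proof -
    have e: "0 \<le> e" using N[of N] L2_inner_self_nonneg[of \<Omega> "d n N"] by simp
    note c = close[OF N, of N, simplified]
    have "integrable ?M (\<lambda>x. (norm (f n x - g x))\<^sup>2)"
      by (rule integrableI_bounded) 
        (measurable, use le_less_trans[OF c ennreal_less_top] in simp)
    then show "(\<lambda>x. f n x - g x) \<in> L2 \<Omega>" unfolding L2_def by auto
    have "(LINT x|?M. (norm (f n x - g x))\<^sup>2) \<le> e"
      using c e by (intro integral_real_bounded) auto
    then show "L2_inner \<Omega> (\<lambda>x. f n x - g x) (\<lambda>x. f n x - g x) \<le> e"
      by (simp add: L2_inner_self)
  qed
  show ?thesis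
  proof
    obtain N where "\<And>m. m \<ge> N \<Longrightarrow> L2_inner \<Omega> (d N m) (d N m) < 1"
      using cauchy[of 1] unfolding d_def by auto
    from L2_diff[OF f fg(1)[OF this], of N N] show "g \<in> L2 \<Omega>" by simp
    show "(\<lambda>n. L2_inner \<Omega> (\<lambda>x. f n x - g x) (\<lambda>x. f n x - g x)) \<longlonglongrightarrow> 0"
    proof (rule LIMSEQ_I)
      fix e :: real assume "0 < e"
      then obtain N where N: "\<And>m n. m \<ge> N \<Longrightarrow> n \<ge> N \<Longrightarrow> L2_inner \<Omega> (d m n) (d m n) < e / 2"
        using cauchy[of "e / 2"] unfolding d_def by auto
      show "\<exists>N. \<forall>n\<ge>N. norm (L2_inner \<Omega> (\<lambda>x. f n x - g x) (\<lambda>x. f n x - g x) - 0) < e"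
      proof (intro exI allI impI)
        fix n assume "n \<ge> N"
        then have "L2_inner \<Omega> (\<lambda>x. f n x - g x) (\<lambda>x. f n x - g x) \<le> e / 2"
          using fg(2)[of N n "e / 2"] N by blast
        then show "norm (L2_inner \<Omega> (\<lambda>x. f n x - g x) (\<lambda>x. f n x - g x) - 0) < e"
          using \<open>0 < e\<close> L2_inner_self_nonneg[of \<Omega> "\<lambda>x. f n x - g x"] by simp
      qed
    qed
  qed
qed

lemma L2_inner_tendsto:
  fixes f :: "nat \<Rightarrow> real^3 \<Rightarrow> 'b::euclidean_space"
  assumes f: "\<And>n. f n \<in> L2 \<Omega>" and g: "g \<in> L2 \<Omega>" and h: "h \<in> L2 \<Omega>"
    and lim: "(\<lambda>n. L2_inner \<Omega> (\<lambda>x. f n x - g x) (\<lambda>x. f n x - g x)) \<longlonglongrightarrow> 0"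
  shows "(\<lambda>n. L2_inner \<Omega> (f n) h) \<longlonglongrightarrow> L2_inner \<Omega> g h"
proof -
  have "(\<lambda>n. L2_inner \<Omega> (f n) h - L2_inner \<Omega> g h) \<longlonglongrightarrow> 0"
  proof (rule tendsto_0_le[where K = 1])
    show "(\<lambda>n. sqrt (L2_inner \<Omega> (\<lambda>x. f n x - g x) (\<lambda>x. f n x - g x) * L2_inner \<Omega> h h)) \<longlonglongrightarrow> 0"
      using tendsto_real_sqrt[OF tendsto_mult_left_zero[OF lim, of "L2_inner \<Omega> h h"]] by simp
    show "\<forall>\<^sub>F n in sequentially. norm (L2_inner \<Omega> (f n) h - L2_inner \<Omega> g h)
      \<le> norm (sqrt (L2_inner \<Omega> (\<lambda>x. f n x - g x) (\<lambda>x. f n x - g x) * L2_inner \<Omega> h h)) * 1"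
    proof (rule always_eventually, rule allI)
      fix n
      have "(L2_inner \<Omega> (f n) h - L2_inner \<Omega> g h)\<^sup>2
          \<le> L2_inner \<Omega> (\<lambda>x. f n x - g x) (\<lambda>x. f n x - g x) * L2_inner \<Omega> h h"
        using L2_Cauchy_Schwarz[OF L2_diff[OF f g] h, of n] L2_inner_diff[OF f g h, of n] by simp
      then have "\<bar>L2_inner \<Omega> (f n) h - L2_inner \<Omega> g h\<bar>
          \<le> sqrt (L2_inner \<Omega> (\<lambda>x. f n x - g x) (\<lambda>x. f n x - g x) * L2_inner \<Omega> h h)"
        using real_le_rsqrt real_sqrt_abs real_sqrt_le_iff by metis
      then show "norm (L2_inner \<Omega> (f n) h - L2_inner \<Omega> g h)
        \<le> norm (sqrt (L2_inner \<Omega> (\<lambda>x. f n x - g x) (\<lambda>x. f n x - g x) * L2_inner \<Omega> h h)) * 1"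
        by simp
    qed
  qed
  then show ?thesis by (rule LIM_zero_cancel)
qed

text \<open>
  Take \<open>s = - b / (a + 1)\<close>.
\<close>

lemma linear_term_zero_of_nonneg:
  fixes a b :: real
  assumes a: "0 \<le> a" and q: "\<And>s. 0 \<le> s\<^sup>2 * a + 2 * s * b"
  shows "b = 0"
proof -
  have "0 \<le> ((- b / (a + 1))\<^sup>2 * a + 2 * (- b / (a + 1)) * b) * (a + 1)\<^sup>2"
    by (rule mult_nonneg_nonneg[OF q]) simp
  also have "\<dots> = - (b\<^sup>2 * (a + 2))"
    using a by (simp add: power2_eq_square divide_simps) (simp add: algebra_simps)
  finally have "b\<^sup>2 * (a + 2) \<le> 0" by simp
  then show ?thesis using a by (simp add: mult_le_0_iff)
qed

text \<open>
  The Riesz representation of the functional \<open>g \<mapsto> c\<close>, given by its graph \<open>W\<close>, on the closure of its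
  domain. It is found by minimising \<open>\<parallel>g\<parallel>\<^sup>2 - 2 c\<close> over \<open>W\<close>: the bound makes this bounded below, the
  parallelogram law makes minimising sequences Cauchy, and the first variation at the limit \<open>r\<close>
  vanishes.
\<close>

lemma L2_representation:
  fixes W :: "((real^3 \<Rightarrow> 'b::euclidean_space) \<times> real) set"
  assumes \<Omega>: "bounded \<Omega>" "open \<Omega>"
    and W0: "((\<lambda>x. 0), 0) \<in> W"
    and WL: "\<And>g c. (g, c) \<in> W \<Longrightarrow> g \<in> L2 \<Omega>"
    and Wlin: "\<And>g c h d s. (g, c) \<in> W \<Longrightarrow> (h, d) \<in> W \<Longrightarrow> ((\<lambda>x. g x + s *\<^sub>R h x), c + s * d) \<in> W"
    and bound: "\<And>g c. (g, c) \<in> W \<Longrightarrow> c\<^sup>2 \<le> K * L2_inner \<Omega> g g"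
    and K: "0 \<le> K"
  shows "\<exists>r\<in>L2 \<Omega>. (\<forall>g c. (g, c) \<in> W \<longrightarrow> L2_inner \<Omega> r g = c) \<and> L2_inner \<Omega> r r \<le> K"
proof -
  define J :: "(real^3 \<Rightarrow> 'b) \<times> real \<Rightarrow> real" where "J = (\<lambda>(g, c). L2_inner \<Omega> g g - 2 * c)"
  have Jlow: "- K \<le> J p" if "p \<in> W" for p
  proof -
    obtain g c where p: "p = (g, c)" by (cases p)
    let ?N = "L2_inner \<Omega> g g"
    have N: "0 \<le> ?N" by (rule L2_inner_self_nonneg)
    have "(2 * c)\<^sup>2 \<le> 4 * K * ?N" using bound[of g c] that p by (simp add: power2_eq_square)
    also have "\<dots> \<le> (K + ?N)\<^sup>2"
      using zero_le_power2[of "K - ?N"] by (simp add: power2_eq_square algebra_simps)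
    finally have "2 * c \<le> K + ?N" by (rule power2_le_imp_le) (use K N in simp)
    then show ?thesis by (simp add: p J_def)
  qed
  define m where "m = Inf (J ` W)"
  have bdd: "bdd_below (J ` W)" using Jlow by (intro bdd_belowI[of _ "- K"]) auto
  have mle: "m \<le> J p" if "p \<in> W" for p
    unfolding m_def using that bdd by (intro cInf_lower) auto
  have ex: "\<exists>q. q \<in> W \<and> J q < m + 1 / real (Suc n)" for n
  proof -
    have "J ` W \<noteq> {}" using W0 by auto
    moreover have "Inf (J ` W) < m + 1 / real (Suc n)" unfolding m_def[symmetric] by simp
    ultimately obtain y where "y \<in> J ` W" "y < m + 1 / real (Suc n)" by (rule cInf_lessD[THEN bexE])
    then show ?thesis by auto
  qed
  define p where "p n = (SOME q. q \<in> W \<and> J q < m + 1 / real (Suc n))" for n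
  have p: "p n \<in> W" "J (p n) < m + 1 / real (Suc n)" for n
    using someI_ex[OF ex[of n]] by (simp_all only: p_def)
  define g c where "g n = fst (p n)" and "c n = snd (p n)" for n
  have gc: "(g n, c n) \<in> W" "L2_inner \<Omega> (g n) (g n) - 2 * c n < m + 1 / real (Suc n)" for n
    using p[of n] by (simp_all add: g_def c_def J_def split_beta)
  have gL: "g n \<in> L2 \<Omega>" for n using WL gc by blast
  have par: "L2_inner \<Omega> (\<lambda>x. g i x - g j x) (\<lambda>x. g i x - g j x) \<le> 2 / real (Suc i) + 2 / real (Suc j)" for i j
  proof -
    have "((\<lambda>x. 0 + (1/2) *\<^sub>R (g i x + 1 *\<^sub>R g j x)), 0 + (1/2) * (c i + 1 * c j)) \<in> W"
      by (rule Wlin[OF W0 Wlin[OF gc(1) gc(1)]])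
    from mle[OF this] have 1: "m \<le> L2_inner \<Omega> (\<lambda>x. (1/2) *\<^sub>R (g i x + 1 *\<^sub>R g j x)) 
        (\<lambda>x. (1/2) *\<^sub>R (g i x + 1 *\<^sub>R g j x)) - (c i + c j)"
      unfolding J_def by (simp add: field_simps)
    have 2: "L2_inner \<Omega> (\<lambda>x. (1/2) *\<^sub>R (g i x + 1 *\<^sub>R g j x)) (\<lambda>x. (1/2) *\<^sub>R (g i x + 1 *\<^sub>R g j x))
      = (1/2)\<^sup>2 * (L2_inner \<Omega> (g i) (g i) + 2 * 1 * L2_inner \<Omega> (g i) (g j) + 1\<^sup>2 * L2_inner \<Omega> (g j) (g j))"
      unfolding L2_inner_scale L2_inner_expand[OF gL gL] ..
    have 3: "L2_inner \<Omega> (\<lambda>x. g i x - g j x) (\<lambda>x. g i x - g j x)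
      = L2_inner \<Omega> (g i) (g i) - 2 * L2_inner \<Omega> (g i) (g j) + L2_inner \<Omega> (g j) (g j)"
      using L2_inner_expand[OF gL gL, of i "-1" j] by simp
    have "L2_inner \<Omega> (g i) (g i) - 2 * c i < m + 1 / real (Suc i)" "L2_inner \<Omega> (g j) (g j) - 2 * c j < m + 1 / real (Suc j)"
      by (rule gc(2))+
    moreover have "4 * m \<le> L2_inner \<Omega> (g i) (g i) + 2 * L2_inner \<Omega> (g i) (g j) + L2_inner \<Omega> (g j) (g j)
        - 4 * c i - 4 * c j"
      using 1 unfolding 2 by (simp add: power2_eq_square field_simps)
    ultimately have "L2_inner \<Omega> (\<lambda>x. g i x - g j x) (\<lambda>x. g i x - g j x)
        \<le> 2 * (1 / real (Suc i)) + 2 * (1 / real (Suc j))"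
      unfolding 3 by argo
    then show ?thesis by simp
  qed
  obtain r where r: "r \<in> L2 \<Omega>" "(\<lambda>n. L2_inner \<Omega> (\<lambda>x. g n x - r x) (\<lambda>x. g n x - r x)) \<longlonglongrightarrow> 0"
  proof (rule L2_complete[OF \<Omega>, of g])
    fix e :: real assume e: "0 < e"
    obtain N where N: "1 / real (Suc N) < e / 4" using nat_approx_posE[of "e / 4"] e by auto
    have "L2_inner \<Omega> (\<lambda>x. g i x - g j x) (\<lambda>x. g i x - g j x) < e" if "i \<ge> N" "j \<ge> N" for i j
    proof -
      have "1 / real (Suc i) \<le> 1 / real (Suc N)" "1 / real (Suc j) \<le> 1 / real (Suc N)"
        using that by (simp_all add: frac_le)
      moreover have "2 / real (Suc n) = 2 * (1 / real (Suc n))" for n by simp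
      ultimately show ?thesis using par[of i j] N by linarith
    qed
    then show "\<exists>N. \<forall>m\<ge>N. \<forall>n\<ge>N. L2_inner \<Omega> (\<lambda>x. g m x - g n x) (\<lambda>x. g m x - g n x) < e" by blast
  qed (use gL in auto)
  have rep: "L2_inner \<Omega> r h = d" if hd: "(h, d) \<in> W" for h d
  proof -
    define b where "b n = L2_inner \<Omega> (g n) h - d" for n
    have b: "b \<longlonglongrightarrow> L2_inner \<Omega> r h - d"
      unfolding b_def by (intro tendsto_diff tendsto_const L2_inner_tendsto[OF gL r(1) WL[OF hd] r(2)])
    let ?b = "L2_inner \<Omega> r h - d"
    let ?a = "L2_inner \<Omega> h h"
    have q: "0 \<le> s\<^sup>2 * ?a + 2 * s * ?b" for s
    proof (rule LIMSEQ_le_const)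
      show "(\<lambda>n. s\<^sup>2 * ?a + 2 * s * b n + 1 / real (Suc n)) \<longlonglongrightarrow> s\<^sup>2 * ?a + 2 * s * ?b"
        using tendsto_add[OF tendsto_add[OF tendsto_const[of "s\<^sup>2 * ?a"] tendsto_mult_left[OF b, of "2 * s"]]
            LIMSEQ_inverse_real_of_nat]
        by (simp add: inverse_eq_divide)
      have "0 \<le> s\<^sup>2 * ?a + 2 * s * b n + 1 / real (Suc n)" for n
        using mle[OF Wlin[OF gc(1)[of n] hd, of s]] gc(2)[of n] L2_inner_expand[OF gL WL[OF hd], of n s]
        by (simp add: J_def b_def algebra_simps)
      then show "\<exists>N. \<forall>n\<ge>N. 0 \<le> s\<^sup>2 * ?a + 2 * s * b n + 1 / real (Suc n)" by blast
    qed
    have "?b = 0"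
      by (rule linear_term_zero_of_nonneg[OF L2_inner_self_nonneg q])
    then show ?thesis by simp
  qed
  have "L2_inner \<Omega> r r \<le> K"
  proof -
    let ?R = "L2_inner \<Omega> r r"
    have lim: "(\<lambda>n. L2_inner \<Omega> (g n) r) \<longlonglongrightarrow> ?R"
      by (rule L2_inner_tendsto[OF gL r(1) r(1) r(2)])
    define e where "e n = L2_inner \<Omega> (\<lambda>x. g n x - r x) (\<lambda>x. g n x - r x)" for n
    have e: "e \<longlonglongrightarrow> 0" using r(2) unfolding e_def .
    have le: "(L2_inner \<Omega> (g n) r)\<^sup>2 \<le> K * (e n + 2 * L2_inner \<Omega> (g n) r - ?R)" for n
    proof -
      have "e n = L2_inner \<Omega> (g n) (g n) - 2 * L2_inner \<Omega> (g n) r + ?R"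
        unfolding e_def using L2_inner_expand[OF gL r(1), of n "-1"] by simp
      moreover have "(L2_inner \<Omega> (g n) r)\<^sup>2 \<le> K * L2_inner \<Omega> (g n) (g n)"
        using bound[OF gc(1)[of n]] rep[OF gc(1)[of n]] L2_inner_commute[of \<Omega> r "g n"] by simp
      ultimately show ?thesis by simp
    qed
    have 1: "(\<lambda>n. (L2_inner \<Omega> (g n) r)\<^sup>2) \<longlonglongrightarrow> ?R\<^sup>2" by (rule tendsto_power[OF lim])
    have 2: "(\<lambda>n. K * (e n + 2 * L2_inner \<Omega> (g n) r - ?R)) \<longlonglongrightarrow> K * (0 + 2 * ?R - ?R)"
      by (intro tendsto_mult tendsto_diff tendsto_add tendsto_const lim e)
    have "?R\<^sup>2 \<le> K * (0 + 2 * ?R - ?R)" by (rule LIMSEQ_le[OF 1 2]) (use le in blast)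
    then have "?R * ?R \<le> K * ?R" by (simp add: power2_eq_square)
    then have "?R \<le> K \<or> ?R \<le> 0" by (auto simp: mult_le_cancel_right)
    then show ?thesis using K by linarith
  qed
  then show ?thesis using r(1) rep by auto
qed

section \<open>Test functions and the fundamental lemma of the calculus of variations\<close>

text \<open>
  The derivatives of \<open>exp (- 1 / t)\<close>, extended by zero to \<open>t \<le> 0\<close>, are polynomials in \<open>1 / t\<close> times
  the function itself, so this family is closed under differentiation.
\<close>

definition flat_exp :: "real poly \<Rightarrow> real \<Rightarrow> real" where
  "flat_exp p t = (if 0 < t then poly p (1 / t) * exp (- (1 / t)) else 0)"

lemma poly_times_exp_minus_tendsto_0:
  fixes p :: "real poly"
  shows "((\<lambda>u. poly p u * exp (- u)) \<longlongrightarrow> 0) at_top"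
proof -
  have "((\<lambda>u. \<Sum>i\<le>degree p. coeff p i * (u ^ i / exp u)) \<longlongrightarrow> (\<Sum>i\<le>degree p. coeff p i * 0)) at_top"
    by (intro tendsto_sum tendsto_mult tendsto_const tendsto_power_div_exp_0)
  moreover have "(\<lambda>u. poly p u * exp (- u)) = (\<lambda>u. \<Sum>i\<le>degree p. coeff p i * (u ^ i / exp u))"
    by (simp add: poly_altdef sum_distrib_right exp_minus divide_inverse mult.assoc)
  ultimately show ?thesis by simp
qed

lemma flat_exp_derivative:
  "(flat_exp p has_real_derivative flat_exp ([:0, 0, 1:] * (p - pderiv p)) t) (at t)"
proof (cases "t = 0")
  case False
  show ?thesis
  proof (cases "0 < t")
    case True
    let ?d = "poly (pderiv p) (1 / t) * (- (1 / t\<^sup>2)) * exp (- (1 / t)) + poly p (1 / t) * (exp (- (1 / t)) * (1 / t\<^sup>2))"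
    have d: "((\<lambda>t. 1 / t) has_real_derivative - (1 / t\<^sup>2)) (at t)"
      using True by (auto intro!: derivative_eq_intros simp: power2_eq_square field_simps)
    have "((\<lambda>t. poly p (1 / t)) has_real_derivative poly (pderiv p) (1 / t) * (- (1 / t\<^sup>2))) (at t)"
      and "((\<lambda>t. exp (- (1 / t))) has_real_derivative exp (- (1 / t)) * (1 / t\<^sup>2)) (at t)"
      using DERIV_chain2[OF poly_DERIV[of p] d] DERIV_chain2[OF DERIV_exp DERIV_minus[OF d]] by simp_all
    from DERIV_mult[OF this]
    have "((\<lambda>t. poly p (1 / t) * exp (- (1 / t))) has_real_derivative ?d) (at t)"
      by (simp add: algebra_simps)
    then have "(flat_exp p has_real_derivative ?d) (at t)"
      by (rule has_field_derivative_transform_within_open[of _ _ _ "{0<..}"])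
        (use True in \<open>auto simp: flat_exp_def\<close>)
    moreover have "?d = flat_exp ([:0, 0, 1:] * (p - pderiv p)) t"
      using True by (simp add: flat_exp_def power2_eq_square field_simps)
    ultimately show ?thesis by simp
  next
    case False
    then have "t < 0" using \<open>t \<noteq> 0\<close> by simp
    have "((\<lambda>_. 0) has_real_derivative 0) (at t)" by simp
    then have "(flat_exp p has_real_derivative 0) (at t)"
      by (rule has_field_derivative_transform_within_open[of _ _ _ "{..<0}"])
        (use \<open>t < 0\<close> in \<open>auto simp: flat_exp_def\<close>)
    then show ?thesis using \<open>t < 0\<close> by (simp add: flat_exp_def)
  qed
next
  case True
  have "((\<lambda>h. flat_exp p h / h) \<longlongrightarrow> 0) (at_right 0)"
  proof -
    have "((\<lambda>h. poly ([:0, 1:] * p) (inverse h) * exp (- inverse h)) \<longlongrightarrow> 0) (at_right 0)"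
      by (rule filterlim_compose[OF poly_times_exp_minus_tendsto_0 filterlim_inverse_at_top_right])
    moreover have "\<forall>\<^sub>F h in at_right 0. poly ([:0, 1:] * p) (inverse h) * exp (- inverse h) = flat_exp p h / h"
      by (rule eventually_mono[OF eventually_at_right_less]) (simp add: flat_exp_def field_simps)
    ultimately show ?thesis by (rule Lim_transform_eventually)
  qed
  moreover have "((\<lambda>h. flat_exp p h / h) \<longlongrightarrow> 0) (at_left 0)"
    by (rule Lim_transform_eventually[OF tendsto_const eventually_mono[OF eventually_at_left_real[of "-1" 0]]])
      (auto simp: flat_exp_def)
  ultimately have "((\<lambda>h. flat_exp p h / h) \<longlongrightarrow> 0) (at 0)"
    by (simp add: filterlim_at_split)
  then show ?thesis using True by (simp add: DERIV_def flat_exp_def)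
qed

lemma Ck_flat_exp: "Ck k (\<lambda>x. flat_exp p (c * x $ i + d))"
proof (induction k arbitrary: p)
  case 0
  have "continuous_on UNIV (flat_exp p)"
    by (simp add: continuous_on_eq_continuous_at DERIV_isCont[OF flat_exp_derivative])
  then show ?case
    by (auto intro!: continuous_on_compose2[of UNIV "flat_exp p"] continuous_intros)
next
  case (Suc k)
  let ?q = "[:0, 0, 1:] * (p - pderiv p)"
  have D: "((\<lambda>x::real^3. flat_exp p (c * x $ i + d)) has_derivative (\<lambda>h. flat_exp ?q (c * x $ i + d) * (c * h $ i))) (at x)" for x
  proof -
    have "((\<lambda>x::real^3. c * x $ i + d) has_derivative (\<lambda>h. c * h $ i)) (at x)"
      by (auto intro!: derivative_eq_intros bounded_linear_imp_has_derivative[OF bounded_linear_vec_nth])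
    from has_derivative_compose[OF this flat_exp_derivative[of p, unfolded has_field_derivative_def]]
    show ?thesis .
  qed
  have "pd j (\<lambda>x::real^3. flat_exp p (c * x $ i + d)) = (\<lambda>x. (c * axis j 1 $ i) *\<^sub>R flat_exp ?q (c * x $ i + d))" for j
    by (rule ext) (simp add: pd_eq[OF D] mult.commute)
  moreover have "Ck k (\<lambda>x::real^3. (c * axis j 1 $ i) *\<^sub>R flat_exp ?q (c * x $ i + d))" for j
    by (rule Ck_linear[OF bounded_linear_scaleR_right Suc.IH])
  ultimately show ?case using D by (auto simp: differentiable_def)
qed

lemma Ck_prod:
  fixes f :: "'i \<Rightarrow> real^3 \<Rightarrow> real"
  assumes "finite I" "\<And>i. i \<in> I \<Longrightarrow> Ck k (f i)"
  shows "Ck k (\<lambda>x. \<Prod>i\<in>I. f i x)"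
  using assms
proof (induction I rule: finite_induct)
  case empty
  then show ?case by (simp add: Ck_const)
next
  case (insert i I)
  then show ?case using Ck_scaleR[of k "f i" "\<lambda>x. \<Prod>i\<in>I. f i x"] by simp
qed

text \<open>
  Scaling the arguments of the flat functions by \<open>n + 1\<close> makes these bumps converge to the indicator of the
  open box.
\<close>

definition box_bump :: "real^3 \<Rightarrow> real^3 \<Rightarrow> nat \<Rightarrow> real^3 \<Rightarrow> real" where
  "box_bump a b n x = (\<Prod>i\<in>UNIV. flat_exp 1 (real (Suc n) * x $ i + - (real (Suc n) * a $ i))
     * flat_exp 1 (- real (Suc n) * x $ i + real (Suc n) * b $ i))"

lemma flat_exp_1_bounds: "0 \<le> flat_exp 1 t" "flat_exp 1 t \<le> 1"
  by (simp_all add: flat_exp_def)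

lemma box_bump_bounds: "0 \<le> box_bump a b n x" "box_bump a b n x \<le> 1"
  unfolding box_bump_def
  by (auto intro!: prod_nonneg prod_le_1 mult_nonneg_nonneg mult_le_one flat_exp_1_bounds)

lemma box_bump_outside:
  assumes "x \<notin> box a b"
  shows "box_bump a b n x = 0"
proof -
  obtain i where "x $ i \<le> a $ i \<or> b $ i \<le> x $ i"
    using assms by (auto simp: mem_box_cart not_less)
  then have "real (Suc n) * x $ i + - (real (Suc n) * a $ i) \<le> 0 \<or> - real (Suc n) * x $ i + real (Suc n) * b $ i \<le> 0"
  proof
    assume "x $ i \<le> a $ i"
    then have "real (Suc n) * x $ i \<le> real (Suc n) * a $ i" by (rule mult_left_mono) simp
    then show ?thesis by linarith
  next
    assume "b $ i \<le> x $ i"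
    then have "real (Suc n) * b $ i \<le> real (Suc n) * x $ i" by (rule mult_left_mono) simp
    then show ?thesis by linarith
  qed
  then have "flat_exp 1 (real (Suc n) * x $ i + - (real (Suc n) * a $ i))
     * flat_exp 1 (- real (Suc n) * x $ i + real (Suc n) * b $ i) = 0"
    unfolding flat_exp_def by auto
  then show ?thesis unfolding box_bump_def by (simp only: prod_zero_iff finite_code bex_UNIV) blast
qed

lemma box_bump_tendsto: "(\<lambda>n. box_bump a b n x) \<longlonglongrightarrow> indicator (box a b) x"
proof (cases "x \<in> box a b")
  case False
  then show ?thesis by (simp add: box_bump_outside)
next
  case True
  have lim: "(\<lambda>n. flat_exp 1 (real (Suc n) * s)) \<longlonglongrightarrow> 1" if "0 < s" for s
  proof -
    have "(\<lambda>n. exp (- (inverse (real (Suc n)) * (1 / s)))) \<longlonglongrightarrow> exp (- (0 * (1 / s)))"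
      by (intro tendsto_intros LIMSEQ_inverse_real_of_nat)
    moreover have "flat_exp 1 (real (Suc n) * s) = exp (- (inverse (real (Suc n)) * (1 / s)))" for n
      using that by (simp add: flat_exp_def field_simps del: of_nat_Suc)
    ultimately show ?thesis by simp
  qed
  have "(\<lambda>n. \<Prod>i\<in>(UNIV :: 3 set). flat_exp 1 (real (Suc n) * (x $ i - a $ i)) * flat_exp 1 (real (Suc n) * (b $ i - x $ i)))
      \<longlonglongrightarrow> (\<Prod>i\<in>(UNIV :: 3 set). 1 * 1)"
    using True by (intro tendsto_prod tendsto_mult lim) (auto simp: mem_box_cart)
  then show ?thesis using True unfolding box_bump_def by (simp add: algebra_simps del: of_nat_Suc)
qed

lemma box_bump_test_function:
  assumes "cbox a b \<subseteq> \<Omega>"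
  shows "box_bump a b n \<in> test_functions \<Omega>"
proof -
  have s: "{x. box_bump a b n x \<noteq> 0} \<subseteq> cbox a b"
    using box_bump_outside box_subset_cbox by blast
  then have c: "closure {x. box_bump a b n x \<noteq> 0} \<subseteq> cbox a b"
    by (rule closure_minimal) (rule closed_cbox)
  have "Ck k (box_bump a b n)" for k
    unfolding box_bump_def
    by (intro Ck_prod finite Ck_scaleR[of _ "\<lambda>x. flat_exp 1 (_ x)" "\<lambda>x. flat_exp 1 (_ x)", unfolded real_scaleR_def] Ck_flat_exp)
  moreover have "compact (closure {x. box_bump a b n x \<noteq> 0})"
    using bounded_subset[OF bounded_cbox s] by (simp add: compact_closure)
  ultimately show ?thesis using c assms unfolding test_functions_def by auto
qed

text \<open>
  The boxes form a generator of the Borel sets that is stable under intersection.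
\<close>

lemma integral_zero_on_boxes_imp_AE_zero:
  fixes k :: "'a::euclidean_space \<Rightarrow> real"
  assumes k: "integrable lborel k" and box: "\<And>a b. (LINT x|lborel. indicator (box a b) x * k x) = 0"
    and total: "(LINT x|lborel. k x) = 0"
  shows "AE x in lborel. k x = 0"
proof -
  have int: "integrable lborel (\<lambda>x. indicator A x * k x)" if "A \<in> sets borel" for A
    using integrable_mult_indicator[OF _ k, of A] that by simp
  have zero: "(LINT x|lborel. indicator A x * k x) = 0" if A: "A \<in> sets borel" for A
  proof -
    let ?E = "range (\<lambda>(a, b). box a b :: 'a set)"
    have sb: "sets (borel :: 'a measure) = sigma_sets UNIV ?E"
      by (simp add: borel_eq_box)
    show ?thesis
    proof (rule sigma_sets_induct_disjoint[of ?E UNIV])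
      show "Int_stable ?E" by (auto simp: Int_stable_def box_Int_box)
      show "A \<in> sigma_sets UNIV ?E" using A sb by simp
    next
      fix B assume "B \<in> ?E"
      then show "(LINT x|lborel. indicator B x * k x) = 0" using box by auto
    next
      fix B assume B: "B \<in> sigma_sets UNIV ?E" "(LINT x|lborel. indicator B x * k x) = 0"
      have "(LINT x|lborel. indicator (UNIV - B) x * k x) = (LINT x|lborel. k x - indicator B x * k x)"
        by (rule Bochner_Integration.integral_cong) (auto simp: indicator_def)
      also have "\<dots> = 0" using B int[of B] k total sb by simp
      finally show "(LINT x|lborel. indicator (UNIV - B) x * k x) = 0" .
    next
      fix B :: "nat \<Rightarrow> 'a set"
      assume B: "disjoint_family B" "range B \<subseteq> sigma_sets UNIV ?E" "\<And>i. (LINT x|lborel. indicator (B i) x * k x) = 0"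
      then have m: "B i \<in> sets borel" for i using sb by auto
      have "(LINT x:(\<Union>i. B i)|lborel. k x) = (\<Sum>i. (LINT x:(B i)|lborel. k x))"
      proof (rule lebesgue_integral_countable_add)
        show "B i \<in> sets lborel" for i using m by simp
        show "B i \<inter> B j = {}" if "i \<noteq> j" for i j using B(1) that by (auto simp: disjoint_family_on_def)
        show "set_integrable lborel (\<Union>i. B i) k"
          using int[of "\<Union>i. B i"] m by (simp add: set_integrable_def)
      qed
      then show "(LINT x|lborel. indicator (\<Union>i. B i) x * k x) = 0"
        using B(3) by (simp add: set_lebesgue_integral_def)
    qed (auto simp: box)
  qed
  show ?thesis
    by (rule density_unique_real[OF k, of "\<lambda>_. 0"]) (use zero in \<open>auto simp: set_lebesgue_integral_def\<close>)
qed

text \<open>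
  Test with smooth bumps that approximate the indicators of boxes; countably many boxes cover the open
  set.
\<close>

lemma fundamental_lemma_real:
  fixes h :: "real^3 \<Rightarrow> real"
  assumes \<Omega>: "open \<Omega>" and h: "integrable (lebesgue_on \<Omega>) h"
    and test: "\<And>\<phi>. \<phi> \<in> test_functions \<Omega> \<Longrightarrow> (LINT x|lebesgue_on \<Omega>. \<phi> x * h x) = 0"
  shows "AE x in lebesgue_on \<Omega>. h x = 0"
proof -
  have m\<Omega>: "\<Omega> \<in> sets lebesgue" using \<Omega> by (simp add: borel_open)
  define H where "H x = indicator \<Omega> x * h x" for x
  have H: "integrable lebesgue H"
    using h m\<Omega> by (simp add: integrable_restrict_space H_def[abs_def])
  then have "H \<in> borel_measurable (completion lborel)" by simp
  then obtain H' where H': "H' \<in> borel_measurable lborel" "AE x in lborel. H x = H' x"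
    using completion_ex_borel_measurable_real by blast
  have ae: "AE x in lebesgue. H x = H' x" using H'(2) by (rule AE_completion)
  have mult: "(\<lambda>x. g x * H x) \<in> borel_measurable lebesgue" if "g \<in> borel_measurable borel" for g
    using H that by (intro borel_measurable_times) (auto simp: measurable_completion)
  have iH': "integrable lborel H'"
  proof -
    have "integrable lebesgue H'"
      using H ae H' by (subst integrable_cong_AE[of H' _ H]) (auto simp: measurable_completion)
    then show ?thesis using H'(1) by (simp add: integrable_completion)
  qed
  have box0: "(LINT x|lborel. indicator (box a b) x * H' x) = 0" if sub: "cbox a b \<subseteq> \<Omega> \<or> box a b = {}" for a b
  proof (cases "box a b = {}")
    case False
    then have sub: "cbox a b \<subseteq> \<Omega>" using sub by simp
    have "(\<lambda>n. LINT x|lebesgue. box_bump a b n x * H x) \<longlonglongrightarrow> (LINT x|lebesgue. indicator (box a b) x * H x)"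
    proof (rule integral_dominated_convergence)
      show "integrable lebesgue (\<lambda>x. norm (H x))" using H by (rule integrable_norm)
      show "(\<lambda>x. box_bump a b n x * H x) \<in> borel_measurable lebesgue" for n
      proof (rule mult)
        have "continuous_on UNIV (box_bump a b n)"
          using box_bump_test_function[of a b UNIV n] smooth_continuous unfolding test_functions_def by blast
        then show "box_bump a b n \<in> borel_measurable borel" by (rule borel_measurable_continuous_onI)
      qed
      show "(\<lambda>x. indicator (box a b) x * H x) \<in> borel_measurable lebesgue"
        by (rule mult) simp
      show "AE x in lebesgue. (\<lambda>n. box_bump a b n x * H x) \<longlonglongrightarrow> indicator (box a b) x * H x"
        by (intro AE_I2 tendsto_mult box_bump_tendsto tendsto_const)
      show "AE x in lebesgue. norm (box_bump a b n x * H x) \<le> norm (H x)" for n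
        using box_bump_bounds by (intro AE_I2) (simp add: abs_mult mult_left_le_one_le)
    qed
    moreover have "(LINT x|lebesgue. box_bump a b n x * H x) = 0" for n
      using test[OF box_bump_test_function[OF sub, of n]] m\<Omega>
      by (simp add: integral_restrict_space H_def mult.left_commute)
    ultimately have "(LINT x|lebesgue. indicator (box a b) x * H x) = 0"
      by (simp add: LIMSEQ_const_iff)
    also have "(LINT x|lebesgue. indicator (box a b) x * H x) = (LINT x|lebesgue. indicator (box a b) x * H' x)"
      using ae H'(1) by (intro integral_cong_AE mult borel_measurable_times) (auto simp: measurable_completion)
    also have "\<dots> = (LINT x|lborel. indicator (box a b) x * H' x)"
      using H'(1) by (intro integral_completion) simp
    finally show ?thesis .
  qed simp
  let ?F = "{box a b | a b. cbox a b \<subseteq> \<Omega>}"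
  have zero_on: "AE x in lborel. x \<in> B \<longrightarrow> H' x = 0" if BF: "B \<in> ?F" for B
  proof -
    obtain a b where B: "B = box a b" "cbox a b \<subseteq> \<Omega>" using BF by blast
    have "AE x in lborel. indicator (box a b) x * H' x = 0"
    proof (rule integral_zero_on_boxes_imp_AE_zero)
      show "integrable lborel (\<lambda>x. indicator (box a b) x * H' x)"
        using integrable_mult_indicator[OF _ iH', of "box a b"] by simp
      show "(LINT x|lborel. indicator (box a b) x * H' x) = 0" using box0 B by simp
      fix c d :: "real^3"
      obtain e f where ef: "box c d \<inter> box a b = box e f" using box_Int_box by blast
      have "cbox e f \<subseteq> \<Omega> \<or> box e f = {}"
      proof (cases "box e f = {}")
        case False
        then have "cbox e f = closure (box c d \<inter> box a b)" by (simp add: ef)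
        also have "\<dots> \<subseteq> cbox a b"
          by (rule closure_minimal) (use box_subset_cbox in auto)
        finally show ?thesis using B(2) by blast
      qed simp
      then have "(LINT x|lborel. indicator (box e f) x * H' x) = 0" by (rule box0)
      then show "(LINT x|lborel. indicator (box c d) x * (indicator (box a b) x * H' x)) = 0"
        unfolding ef[symmetric] by (simp add: indicator_inter_arith mult.assoc)
    qed
    then show ?thesis by eventually_elim (auto simp: B indicator_def)
  qed
  obtain F' where F': "F' \<subseteq> ?F" "countable F'" "\<Union>F' = \<Union>?F"
    by (rule Lindelof[of ?F]) auto
  have "\<Omega> \<subseteq> \<Union>?F"
  proof
    fix x assume "x \<in> \<Omega>"
    with \<Omega> obtain a b where "cbox a b \<subseteq> \<Omega>" "x \<in> box a b"
      by (rule open_contains_cbox)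
    then show "x \<in> \<Union>?F" by blast
  qed
  moreover have "AE x in lborel. \<forall>B\<in>F'. x \<in> B \<longrightarrow> H' x = 0"
    unfolding AE_ball_countable[OF F'(2)] by (intro ballI zero_on subsetD[OF F'(1)])
  ultimately have "AE x in lborel. x \<in> \<Omega> \<longrightarrow> H' x = 0"
    using F'(3) by (auto elim!: eventually_mono)
  then have "AE x in lebesgue. x \<in> \<Omega> \<longrightarrow> H' x = 0" by (rule AE_completion)
  with ae have "AE x in lebesgue. x \<in> \<Omega> \<longrightarrow> h x = 0"
    by eventually_elim (auto simp: H_def)
  then show ?thesis using m\<Omega> by (simp add: AE_restrict_space_iff)
qed

lemma fundamental_lemma:
  fixes h :: "real^3 \<Rightarrow> 'b::euclidean_space"
  assumes \<Omega>: "open \<Omega>" and h: "integrable (lebesgue_on \<Omega>) h"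
    and test: "\<And>\<phi>. \<phi> \<in> test_functions \<Omega> \<Longrightarrow> (LINT x|lebesgue_on \<Omega>. \<phi> x *\<^sub>R h x) = 0"
  shows "AE x in lebesgue_on \<Omega>. h x = 0"
proof -
  have "AE x in lebesgue_on \<Omega>. h x \<bullet> b = 0" if "b \<in> Basis" for b
  proof (rule fundamental_lemma_real[OF \<Omega>])
    show "integrable (lebesgue_on \<Omega>) (\<lambda>x. h x \<bullet> b)" using h by simp
    fix \<phi> :: "real^3 \<Rightarrow> real" assume \<phi>: "\<phi> \<in> test_functions \<Omega>"
    obtain R where R: "\<And>x. \<bar>\<phi> x\<bar> \<le> R"
    proof -
      have c: "compact (closure {x. \<phi> x \<noteq> 0})" and s: "smooth \<phi>"
        using \<phi> by (auto simp: test_functions_def)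
      have "compact (\<phi> ` closure {x. \<phi> x \<noteq> 0})"
        by (rule compact_continuous_image[OF smooth_continuous[OF s] c])
      then obtain R where R: "\<forall>y\<in>\<phi> ` closure {x. \<phi> x \<noteq> 0}. norm y \<le> R"
        using compact_imp_bounded bounded_iff by blast
      have "\<bar>\<phi> x\<bar> \<le> max R 0" for x
      proof (cases "\<phi> x = 0")
        case False
        then have "x \<in> closure {x. \<phi> x \<noteq> 0}" by (intro subsetD[OF closure_subset]) simp
        then show ?thesis using R by fastforce
      qed simp
      then show ?thesis by (rule that)
    qed
    have "integrable (lebesgue_on \<Omega>) (\<lambda>x. \<phi> x *\<^sub>R h x)"
    proof (rule Bochner_Integration.integrable_bound)
      show "integrable (lebesgue_on \<Omega>) (\<lambda>x. R * norm (h x))" using h by simp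
      have "smooth \<phi>" using \<phi> by (simp add: test_functions_def)
      then have "continuous_on UNIV \<phi>" by (rule smooth_continuous)
      then have "\<phi> \<in> borel_measurable (lebesgue_on \<Omega>)"
        by (intro measurable_restrict_space1 measurable_completion) (simp add: borel_measurable_continuous_onI)
      then show "(\<lambda>x. \<phi> x *\<^sub>R h x) \<in> borel_measurable (lebesgue_on \<Omega>)"
        using h by (intro borel_measurable_scaleR) auto
      have "0 \<le> R" using R[of 0] by linarith
      then show "AE x in lebesgue_on \<Omega>. norm (\<phi> x *\<^sub>R h x) \<le> norm (R * norm (h x))"
        using R by (intro AE_I2) (simp add: mult_right_mono)
    qed
    then have "(LINT x|lebesgue_on \<Omega>. (\<phi> x *\<^sub>R h x) \<bullet> b) = (LINT x|lebesgue_on \<Omega>. \<phi> x *\<^sub>R h x) \<bullet> b"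
      by (rule integral_inner_left)
    then show "(LINT x|lebesgue_on \<Omega>. \<phi> x * (h x \<bullet> b)) = 0"
      using test[OF \<phi>] by simp
  qed
  then have "AE x in lebesgue_on \<Omega>. \<forall>b\<in>Basis. h x \<bullet> b = 0"
    by (subst AE_finite_all) auto
  then show ?thesis by eventually_elim (simp add: euclidean_all_zero_iff)
qed

section \<open>Algebra of the Pauli and Dirac matrices\<close>

text \<open>
  Vectors in \<open>\<real>\<^sup>3\<close> are embedded into \<open>\<complex>\<^sup>3\<close>, because the matrices \<open>\<sigma> \<cdot> a\<close> and \<open>P\<^sub>0(a)\<close> are hermitian for real
  \<open>a\<close> only.
\<close>

definition cvec :: "real^3 \<Rightarrow> complex^3" where
  "cvec a = (\<chi> j. complex_of_real (a $ j))"

definition sigma_vec :: "real^3 \<Rightarrow> complex^2 \<Rightarrow> complex^2" where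
  "sigma_vec a w = sigma_dot (cvec a) *v w"

definition alpha :: "real^3 \<Rightarrow> complex^(2+2) \<Rightarrow> complex^(2+2)" where
  "alpha a u = P0 (cvec a) *v u"

definition join :: "complex^2 \<Rightarrow> complex^2 \<Rightarrow> complex^(2+2)" where
  "join v w = (\<chi> a. case a of Inl i \<Rightarrow> v $ i | Inr i \<Rightarrow> w $ i)"

lemma cvec_axis: "cvec (axis j 1) = axis j 1"
  by (simp add: cvec_def axis_def vec_eq_iff)

lemma upper_join [simp]: "upper (join v w) = v" and lower_join [simp]: "lower (join v w) = w"
  by (simp_all add: upper_def lower_def join_def vec_eq_iff)

lemma spinor_eqI:
  assumes "upper u = upper v" "lower u = lower v"
  shows "u = v"
proof (unfold vec_eq_iff, rule allI)
  fix i :: "2 + 2"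
  have "upper u $ a = upper v $ a" "lower u $ a = lower v $ a" for a using assms by simp_all
  then show "u $ i = v $ i" by (cases i) (simp_all add: upper_def lower_def)
qed

lemma sum_UNIV_Plus:
  "(\<Sum>i\<in>UNIV. f i) = (\<Sum>i\<in>UNIV. f (Inl i)) + (\<Sum>i\<in>UNIV. f (Inr i))"
  for f :: "'a::finite + 'b::finite \<Rightarrow> 'c::comm_monoid_add"
  by (simp add: UNIV_Plus_UNIV[symmetric] sum.Plus del: UNIV_Plus_UNIV)

lemma inner_spinor: "u \<bullet> v = upper u \<bullet> upper v + lower u \<bullet> lower v"
  by (simp add: inner_vec_def sum_UNIV_Plus upper_def lower_def)

lemma upper_linear: "bounded_linear upper" and lower_linear: "bounded_linear lower"
  by (simp_all add: linear_conv_bounded_linear[symmetric] linear_iff upper_def lower_def vec_eq_iff)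

lemma upper_simps [simp]: "upper (u + v) = upper u + upper v" "upper (r *\<^sub>R u) = r *\<^sub>R upper u"
    "upper (u - v) = upper u - upper v" "upper 0 = 0" "upper (c *s u) = c *s upper u" "upper (- u) = - upper u"
  and lower_simps [simp]: "lower (u + v) = lower u + lower v" "lower (r *\<^sub>R u) = r *\<^sub>R lower u"
    "lower (u - v) = lower u - lower v" "lower 0 = 0" "lower (c *s u) = c *s lower u" "lower (- u) = - lower u"
  by (simp_all add: upper_def lower_def vec_eq_iff)

lemma join_linear: "bounded_linear (\<lambda>v. join v 0)" "bounded_linear (\<lambda>w. join 0 w)"
  unfolding linear_conv_bounded_linear[symmetric]
  by (auto intro!: linearI spinor_eqI)

lemma join_sum: "join v w = join v 0 + join 0 w"
  by (rule spinor_eqI) simp_all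

lemma upper_block: "upper (block M N K L *v u) = M *v upper u + N *v lower u"
  and lower_block: "lower (block M N K L *v u) = K *v upper u + L *v lower u"
  by (simp_all add: vec_eq_iff matrix_vector_mult_def sum_UNIV_Plus upper_def lower_def block_def)

lemma upper_alpha [simp]: "upper (alpha a u) = sigma_vec a (lower u)"
  and lower_alpha [simp]: "lower (alpha a u) = sigma_vec a (upper u)"
  by (simp_all add: alpha_def sigma_vec_def P0_def upper_block lower_block matrix_vector_mult_0)

lemma sigma_1: "sigma_vec a w $ 1 = complex_of_real (a $ 3) * w $ 1
    + (complex_of_real (a $ 1) - \<i> * complex_of_real (a $ 2)) * w $ 2"
  and sigma_2: "sigma_vec a w $ 2 = (complex_of_real (a $ 1) + \<i> * complex_of_real (a $ 2)) * w $ 1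
    - complex_of_real (a $ 3) * w $ 2"
  by (simp_all add: sigma_vec_def sigma_dot_def cvec_def pauli_def matrix_vector_mult_def sum_2 sum_3 algebra_simps)

lemma sigma_linear_vector: "sigma_vec (a + b) w = sigma_vec a w + sigma_vec b w" "sigma_vec (r *\<^sub>R a) w = r *\<^sub>R sigma_vec a w"
    "sigma_vec 0 w = 0"
  by (simp_all add: vec_eq_iff forall_2 sigma_1 sigma_2 complex_eq_iff algebra_simps)

lemma sigma_linear: "bounded_linear (sigma_vec a)"
  unfolding linear_conv_bounded_linear[symmetric]
  by (rule linearI) (simp_all add: vec_eq_iff forall_2 sigma_1 sigma_2 complex_eq_iff algebra_simps)

lemma sigma_symmetric: "sigma_vec a v \<bullet> w = v \<bullet> sigma_vec a w"
  by (simp add: inner_vec_def sum_2 sigma_1 sigma_2 inner_complex_def algebra_simps)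

lemma sigma_anticommute: "sigma_vec a (sigma_vec b w) + sigma_vec b (sigma_vec a w) = (2 * (a \<bullet> b)) *\<^sub>R w"
  by (simp add: vec_eq_iff forall_2 sigma_1 sigma_2 inner_vec_def sum_3 complex_eq_iff algebra_simps)

lemma sigma_scale: "sigma_vec a (c *s w) = c *s sigma_vec a w"
  by (simp add: vec_eq_iff forall_2 sigma_1 sigma_2 algebra_simps)

lemma sigma_square: "sigma_vec a (sigma_vec a w) = (a \<bullet> a) *\<^sub>R w"
proof -
  have "2 *\<^sub>R sigma_vec a (sigma_vec a w) = 2 *\<^sub>R ((a \<bullet> a) *\<^sub>R w)"
    using sigma_anticommute[of a a w] by (simp add: scaleR_2)
  then show ?thesis by (simp del: scaleR_scaleR)
qed

lemma norm_sigma: "norm (sigma_vec a w) = norm a * norm w"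
proof -
  have "(norm (sigma_vec a w))\<^sup>2 = (norm a * norm w)\<^sup>2"
    unfolding power_mult_distrib power2_norm_eq_inner
    by (simp add: sigma_symmetric sigma_square)
  then show ?thesis by (simp add: power2_eq_iff_nonneg)
qed

text \<open>
  Conjugation with \<open>\<sigma> \<cdot> z\<close> is, up to the factor \<open>- \<bar>z\<bar>\<^sup>2\<close>, the reflection of \<open>a\<close> in the plane orthogonal to \<open>z\<close>.
\<close>

lemma sigma_conjugate: "sigma_vec z (sigma_vec a (sigma_vec z w)) = (2 * (z \<bullet> a)) *\<^sub>R sigma_vec z w - (z \<bullet> z) *\<^sub>R sigma_vec a w"
proof -
  have "sigma_vec z (sigma_vec a (sigma_vec z w)) + sigma_vec a (sigma_vec z (sigma_vec z w)) = (2 * (z \<bullet> a)) *\<^sub>R sigma_vec z w"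
    by (rule sigma_anticommute)
  then show ?thesis
    by (simp add: sigma_square linear_scale[OF bounded_linear.linear[OF sigma_linear]] eq_diff_eq)
qed

lemma inner_sigma_sigma: "sigma_vec a w \<bullet> sigma_vec b w = (a \<bullet> b) * (w \<bullet> w)"
proof -
  have "sigma_vec a w \<bullet> sigma_vec b w = w \<bullet> sigma_vec a (sigma_vec b w)" "sigma_vec a w \<bullet> sigma_vec b w = w \<bullet> sigma_vec b (sigma_vec a w)"
    using sigma_symmetric[of a w "sigma_vec b w"] sigma_symmetric[of b w "sigma_vec a w"]
    by (simp_all add: inner_commute[of "sigma_vec a w"])
  then have "2 * (sigma_vec a w \<bullet> sigma_vec b w) = w \<bullet> (sigma_vec a (sigma_vec b w) + sigma_vec b (sigma_vec a w))"
    by (simp add: inner_add_right)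
  then show ?thesis by (simp add: sigma_anticommute)
qed

lemma alpha_linear: "bounded_linear (alpha a)"
  unfolding linear_conv_bounded_linear[symmetric]
  by (rule linearI; rule spinor_eqI)
    (simp_all add: linear_add[OF bounded_linear.linear[OF sigma_linear]] linear_scale[OF bounded_linear.linear[OF sigma_linear]])

lemma alpha_symmetric: "alpha a u \<bullet> v = u \<bullet> alpha a v"
  by (simp add: inner_spinor sigma_symmetric)

lemma alpha_anticommute: "alpha a (alpha b u) + alpha b (alpha a u) = (2 * (a \<bullet> b)) *\<^sub>R u"
  by (rule spinor_eqI) (simp_all add: sigma_anticommute)

lemma alpha_square: "alpha a (alpha a u) = (a \<bullet> a) *\<^sub>R u"
  by (rule spinor_eqI) (simp_all add: sigma_square)

lemma alpha_scale: "alpha a (c *s u) = c *s alpha a u"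
  by (rule spinor_eqI) (simp_all add: sigma_scale)

lemma norm_alpha: "norm (alpha a u) = norm a * norm u"
proof -
  have "(norm (alpha a u))\<^sup>2 = (norm a * norm u)\<^sup>2"
    unfolding power_mult_distrib power2_norm_eq_inner by (simp add: alpha_symmetric alpha_square)
  then show ?thesis by (simp add: power2_eq_iff_nonneg)
qed

lemma i_linear: "bounded_linear (\<lambda>u :: complex^'m. \<i> *s u)"
  unfolding linear_conv_bounded_linear[symmetric]
  by (rule linearI) (simp_all add: vec_eq_iff complex_eq_iff algebra_simps)

lemma i_skew: "(\<i> *s u) \<bullet> v = - (u \<bullet> (\<i> *s v))" for u v :: "complex^'m"
  by (simp add: inner_vec_def inner_complex_def sum_negf[symmetric] del: sum_negf) 

lemma i_i: "\<i> *s (\<i> *s u) = - u" for u :: "complex^'m"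
  by (simp add: vec_eq_iff mult.assoc[symmetric])

lemma norm_i: "norm (\<i> *s u) = norm u" for u :: "complex^'m"
proof -
  have "(norm (\<i> *s u))\<^sup>2 = (norm u)\<^sup>2"
    unfolding power2_norm_eq_inner i_skew i_i by simp
  then show ?thesis by (simp add: power2_eq_iff_nonneg)
qed

lemma mat_mult_vec: "mat c *v w = c *s w" for w :: "complex^2"
  by (simp add: vec_eq_iff forall_2 matrix_vector_mult_def mat_def sum_2)

lemma upper_potential: "upper (potential A qp qm x *v u) = sigma_vec (A x) (lower u) + qp x *\<^sub>R upper u"
  and lower_potential: "lower (potential A qp qm x *v u) = sigma_vec (A x) (upper u) + qm x *\<^sub>R lower u"
proof -
  have *: "potential A qp qm x *v u = alpha (A x) u
    + block (mat (complex_of_real (qp x))) 0 0 (mat (complex_of_real (qm x))) *v u"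
    by (simp add: potential_def alpha_def cvec_def matrix_vector_mult_add_rdistrib)
  have r: "complex_of_real r *s w = r *\<^sub>R w" for r and w :: "complex^2"
    by (simp add: vec_eq_iff complex_eq_iff)
  show "upper (potential A qp qm x *v u) = sigma_vec (A x) (lower u) + qp x *\<^sub>R upper u"
    "lower (potential A qp qm x *v u) = sigma_vec (A x) (upper u) + qm x *\<^sub>R lower u"
    unfolding * by (simp_all add: upper_block lower_block mat_mult_vec r matrix_vector_mult_0)
qed

lemma potential_symmetric: "(potential A qp qm x *v u) \<bullet> v = u \<bullet> (potential A qp qm x *v v)"
  by (simp add: inner_spinor upper_potential lower_potential inner_simps sigma_symmetric)

lemma norm_spinor_le: "norm (upper u) \<le> norm u" "norm (lower u) \<le> norm u" "norm u \<le> norm (upper u) + norm (lower u)"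
proof -
  have e: "(norm u)\<^sup>2 = (norm (upper u))\<^sup>2 + (norm (lower u))\<^sup>2"
    unfolding power2_norm_eq_inner by (rule inner_spinor)
  show "norm (upper u) \<le> norm u" "norm (lower u) \<le> norm u"
    by (rule power2_le_imp_le; simp add: e)+
  have "(norm u)\<^sup>2 \<le> (norm (upper u) + norm (lower u))\<^sup>2"
    unfolding e by (simp add: power2_eq_square algebra_simps)
  then show "norm u \<le> norm (upper u) + norm (lower u)"
    by (rule power2_le_imp_le) simp
qed

lemma norm_potential_le:
  assumes "norm (A x) \<le> M" "\<bar>qp x\<bar> \<le> M" "\<bar>qm x\<bar> \<le> M"
  shows "norm (potential A qp qm x *v u) \<le> 4 * M * norm u"
proof -
  have M: "0 \<le> M" using order_trans[OF norm_ge_zero assms(1)] .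
  note le = mult_mono[OF assms(1) norm_spinor_le(1)[of u] M norm_ge_zero] mult_mono[OF assms(1) norm_spinor_le(2)[of u] M norm_ge_zero]
    mult_mono[OF assms(2) norm_spinor_le(1)[of u] M norm_ge_zero] mult_mono[OF assms(3) norm_spinor_le(2)[of u] M norm_ge_zero]
  have "norm (potential A qp qm x *v u) \<le> norm (sigma_vec (A x) (lower u) + qp x *\<^sub>R upper u)
      + norm (sigma_vec (A x) (upper u) + qm x *\<^sub>R lower u)"
    using norm_spinor_le(3)[of "potential A qp qm x *v u"] by (simp add: upper_potential lower_potential)
  also have "\<dots> \<le> (norm (A x) * norm (lower u) + \<bar>qp x\<bar> * norm (upper u))
      + (norm (A x) * norm (upper u) + \<bar>qm x\<bar> * norm (lower u))"
    by (intro add_mono norm_triangle_le) (simp_all add: norm_sigma)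
  also have "\<dots> \<le> 4 * M * norm u" using le by simp
  finally show ?thesis .
qed

section \<open>Weak solutions of the Dirac equation\<close>

lemma measurable_lebesgue_on_of_borel:
  "f \<in> borel_measurable borel \<Longrightarrow> f \<in> borel_measurable (lebesgue_on \<Omega>)"
  by (intro measurable_restrict_space1 measurable_completion) simp

lemma L2_bounded:
  fixes f :: "real^3 \<Rightarrow> 'b::euclidean_space"
  assumes \<Omega>: "bounded \<Omega>" "open \<Omega>" and f: "f \<in> borel_measurable (lebesgue_on \<Omega>)"
    and B: "\<And>x. x \<in> \<Omega> \<Longrightarrow> norm (f x) \<le> B"
  shows "f \<in> L2 \<Omega>"
proof (rule L2_dominated[OF _ f, where C = B])
  have lm: "\<Omega> \<in> lmeasurable" using \<Omega> lmeasurable_open by blast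
  have "integrable lebesgue (indicat_real \<Omega>)"
    by (rule integrable_real_indicator) (use lm in \<open>simp_all add: fmeasurable_def del: emeasure_completion\<close>)
  then show "(\<lambda>x. 1::real) \<in> L2 \<Omega>"
    unfolding L2_def by (simp add: lm fmeasurableD integrable_restrict_space)
qed (use B in auto)

lemma L2_continuous:
  fixes f :: "real^3 \<Rightarrow> 'b::euclidean_space"
  assumes \<Omega>: "bounded \<Omega>" "open \<Omega>" and f: "continuous_on UNIV f"
  shows "f \<in> L2 \<Omega>"
proof -
  have "compact (f ` closure \<Omega>)"
    using \<Omega>(1) by (intro compact_continuous_image continuous_on_subset[OF f]) (auto simp: compact_closure)
  then obtain B where B: "\<forall>y\<in>f ` closure \<Omega>. norm y \<le> B"
    using compact_imp_bounded bounded_iff by metis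
  have "norm (f x) \<le> B" if "x \<in> \<Omega>" for x
    using that closure_subset[of \<Omega>] B by auto
  then show ?thesis
    by (rule L2_bounded[OF \<Omega> measurable_lebesgue_on_of_borel[OF borel_measurable_continuous_onI[OF f]]])
qed

lemma L2_integrable:
  fixes f :: "real^3 \<Rightarrow> 'b::euclidean_space"
  assumes \<Omega>: "bounded \<Omega>" "open \<Omega>" and f: "f \<in> L2 \<Omega>"
  shows "integrable (lebesgue_on \<Omega>) f"
proof -
  have n: "(\<lambda>x. norm (f x)) \<in> L2 \<Omega>"
    by (rule L2_dominated[OF f, where C = 1]) (use L2_D(1)[OF f] in auto)
  have one: "(\<lambda>x. 1::real) \<in> L2 \<Omega>" by (rule L2_continuous[OF \<Omega>]) simp
  from L2_inner_integrable[OF n one] L2_D(1)[OF f] show ?thesis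
    by (simp add: integrable_norm_iff)
qed

lemma L2_scaleR_continuous:
  fixes f :: "real^3 \<Rightarrow> 'b::euclidean_space" and \<phi> :: "real^3 \<Rightarrow> real"
  assumes \<Omega>: "bounded \<Omega>" and \<phi>: "continuous_on UNIV \<phi>" and f: "f \<in> L2 \<Omega>"
  shows "(\<lambda>x. \<phi> x *\<^sub>R f x) \<in> L2 \<Omega>"
proof -
  have "compact (\<phi> ` closure \<Omega>)"
    using \<Omega>(1) by (intro compact_continuous_image continuous_on_subset[OF \<phi>]) (auto simp: compact_closure)
  then obtain B where B: "\<forall>y\<in>\<phi> ` closure \<Omega>. norm y \<le> B"
    using compact_imp_bounded bounded_iff by metis
  show ?thesis
  proof (rule L2_dominated[OF f])
    show "(\<lambda>x. \<phi> x *\<^sub>R f x) \<in> borel_measurable (lebesgue_on \<Omega>)"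
      by (intro borel_measurable_scaleR measurable_lebesgue_on_of_borel borel_measurable_continuous_onI \<phi> L2_D(1)[OF f])
    show "norm (\<phi> x *\<^sub>R f x) \<le> B * norm (f x)" if "x \<in> \<Omega>" for x
      using that closure_subset[of \<Omega>] B by (auto intro!: mult_right_mono)
  qed
qed

lemma test_smooth: "\<phi> \<in> test_functions \<Omega> \<Longrightarrow> smooth \<phi>"
  by (simp add: test_functions_def)

lemma test_continuous: "\<phi> \<in> test_functions \<Omega> \<Longrightarrow> continuous_on S \<phi>"
  by (rule smooth_continuous[OF test_smooth])

lemma test_differentiable: "\<phi> \<in> test_functions \<Omega> \<Longrightarrow> \<phi> differentiable (at x)"
  by (rule smooth_differentiable[OF test_smooth])

lemma test_functionsI:
  assumes s: "smooth f" and K: "compact K" "K \<subseteq> \<Omega>" "\<And>x. x \<notin> K \<Longrightarrow> f x = 0"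
  shows "f \<in> test_functions \<Omega>"
proof -
  have sub: "{x. f x \<noteq> 0} \<subseteq> K" using K(3) by blast
  then have c: "closure {x. f x \<noteq> 0} \<subseteq> K"
    by (rule closure_minimal) (rule compact_imp_closed[OF K(1)])
  have "bounded {x. f x \<noteq> 0}" by (rule bounded_subset[OF compact_imp_bounded[OF K(1)] sub])
  then show ?thesis using s c K(2) by (auto simp: test_functions_def compact_closure)
qed

lemma test_support:
  assumes "f \<in> test_functions \<Omega>"
  shows "\<exists>K. compact K \<and> K \<subseteq> \<Omega> \<and> (\<forall>x. x \<notin> K \<longrightarrow> f x = 0)"
proof (intro exI[of _ "closure {x. f x \<noteq> 0}"] conjI allI impI)
  show "f x = 0" if "x \<notin> closure {x. f x \<noteq> 0}" for x
    using that subsetD[OF closure_subset, of x "{x. f x \<noteq> 0}"] by auto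
qed (use assms in \<open>auto simp: test_functions_def\<close>)

lemma test_pd:
  assumes "f \<in> test_functions \<Omega>"
  shows "pd j f \<in> test_functions \<Omega>"
proof -
  obtain K where K: "compact K" "K \<subseteq> \<Omega>" "\<And>x. x \<notin> K \<Longrightarrow> f x = 0"
    using test_support[OF assms] by blast
  show ?thesis
    by (rule test_functionsI[OF smooth_pd[OF test_smooth[OF assms]] K(1,2)])
      (rule pd_zero_outside_closed[OF compact_imp_closed[OF K(1)] K(3)])
qed

lemma test_linear:
  assumes L: "bounded_linear L" and f: "f \<in> test_functions \<Omega>"
  shows "(\<lambda>x. L (f x)) \<in> test_functions \<Omega>"
proof -
  obtain K where K: "compact K" "K \<subseteq> \<Omega>" "\<And>x. x \<notin> K \<Longrightarrow> f x = 0"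
    using test_support[OF f] by blast
  show ?thesis
    by (rule test_functionsI[OF _ K(1,2)])
      (use Ck_linear[OF L] test_smooth[OF f] K(3) linear_0[OF bounded_linear.linear[OF L]] in auto)
qed

lemma test_add:
  assumes f: "f \<in> test_functions \<Omega>" and g: "g \<in> test_functions \<Omega>"
  shows "(\<lambda>x. f x + g x) \<in> test_functions \<Omega>"
proof -
  obtain K where K: "compact K" "K \<subseteq> \<Omega>" "\<And>x. x \<notin> K \<Longrightarrow> f x = 0"
    using test_support[OF f] by blast
  obtain J where J: "compact J" "J \<subseteq> \<Omega>" "\<And>x. x \<notin> J \<Longrightarrow> g x = 0"
    using test_support[OF g] by blast
  have "smooth (\<lambda>x. f x + g x)"
    using Ck_add test_smooth[OF f] test_smooth[OF g] by blast
  then show ?thesis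
    by (rule test_functionsI[OF _ compact_Un[OF K(1) J(1)]]) (use K J in auto)
qed

lemma test_zero: "(\<lambda>x. 0) \<in> test_functions \<Omega>"
  by (rule test_functionsI[of _ "{}"]) (auto simp: Ck_const)

lemma test_L2:
  fixes f :: "real^3 \<Rightarrow> 'b::euclidean_space"
  assumes "bounded \<Omega>" "open \<Omega>" "f \<in> test_functions \<Omega>'"
  shows "f \<in> L2 \<Omega>"
  by (rule L2_continuous[OF assms(1,2) test_continuous[OF assms(3)]])

definition dirac :: "(real^3 \<Rightarrow> complex^(2+2)) \<Rightarrow> real^3 \<Rightarrow> complex^(2+2)" where
  "dirac \<psi> x = (\<Sum>j\<in>UNIV. - (\<i> *s alpha (axis j 1) (pd j \<psi> x)))"

text \<open>
  What is needed of a potential on \<open>\<Omega>\<close>: a bound \<open>M\<close> for the operator norms, symmetry for the real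
  inner product (that is, the matrices are hermitian), and measurability.
\<close>

definition admissible :: "(real^3) set \<Rightarrow> real \<Rightarrow> (real^3 \<Rightarrow> complex^(2+2)^(2+2)) \<Rightarrow> bool" where
  "admissible \<Omega> M V \<longleftrightarrow> 0 \<le> M \<and> (\<forall>x\<in>\<Omega>. \<forall>u. norm (V x *v u) \<le> M * norm u) \<and>
     (\<forall>x u v. (V x *v u) \<bullet> v = u \<bullet> (V x *v v)) \<and>
     (\<forall>u\<in>borel_measurable (lebesgue_on \<Omega>). (\<lambda>x. V x *v u x) \<in> borel_measurable (lebesgue_on \<Omega>))"

definition dirac_op ::
  "(real^3 \<Rightarrow> complex^(2+2)^(2+2)) \<Rightarrow> (real^3 \<Rightarrow> complex^(2+2)) \<Rightarrow> real^3 \<Rightarrow> complex^(2+2)"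
where
  "dirac_op V \<psi> x = dirac \<psi> x + V x *v \<psi> x"

lemma admissible_L2:
  assumes "admissible \<Omega> M V" "u \<in> L2 \<Omega>"
  shows "(\<lambda>x. V x *v u x) \<in> L2 \<Omega>"
  by (rule L2_dominated[OF assms(2), where C = M])
    (use assms L2_D(1)[OF assms(2)] in \<open>auto simp: admissible_def\<close>)

lemma admissible_inner:
  "admissible \<Omega> M V \<Longrightarrow> L2_inner \<Omega> (\<lambda>x. V x *v u x) v = L2_inner \<Omega> u (\<lambda>x. V x *v v x)"
  by (simp add: L2_inner_def admissible_def)

lemma i_alpha_linear: "bounded_linear (\<lambda>u. - (\<i> *s alpha a u))"
  by (intro bounded_linear_minus bounded_linear_compose[OF i_linear alpha_linear])

lemma i_alpha_symmetric: "- (\<i> *s alpha a u) \<bullet> v = u \<bullet> (\<i> *s alpha a v)"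
  by (simp add: i_skew alpha_symmetric alpha_scale)

lemma dirac_L2:
  assumes "bounded \<Omega>" "open \<Omega>" "\<psi> \<in> test_functions \<Omega>"
  shows "dirac \<psi> \<in> L2 \<Omega>"
  unfolding dirac_def[abs_def]
  by (intro L2_sum L2_bounded_linear[OF i_alpha_linear] test_L2[OF assms(1,2) test_pd[OF assms(3)]]) simp

lemma dirac_op_L2:
  assumes "bounded \<Omega>" "open \<Omega>" "\<psi> \<in> test_functions \<Omega>" "admissible \<Omega> M V"
  shows "dirac_op V \<psi> \<in> L2 \<Omega>"
  unfolding dirac_op_def[abs_def]
  by (intro L2_add dirac_L2[OF assms(1-3)] admissible_L2[OF assms(4)] test_L2[OF assms(1-3)])

lemma dirac_add:
  assumes "f \<in> test_functions \<Omega>" "g \<in> test_functions \<Omega>"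
  shows "dirac (\<lambda>x. f x + g x) x = dirac f x + dirac g x"
  unfolding dirac_def pd_add[OF test_differentiable[OF assms(1)] test_differentiable[OF assms(2)]]
    linear_add[OF bounded_linear.linear[OF i_alpha_linear]] by (rule sum.distrib)

lemma dirac_scaleR:
  assumes "f \<in> test_functions \<Omega>"
  shows "dirac (\<lambda>x. s *\<^sub>R f x) x = s *\<^sub>R dirac f x"
  unfolding dirac_def pd_linear[OF bounded_linear_scaleR_right test_differentiable[OF assms]]
    linear_scale[OF bounded_linear.linear[OF i_alpha_linear]] by (rule scaleR_sum_right[symmetric])

lemma pd_scaleR_vector:
  fixes \<phi> :: "real^3 \<Rightarrow> real" and b :: "'b::real_normed_vector"
  assumes "\<phi> differentiable (at x)"
  shows "pd j (\<lambda>x. \<phi> x *\<^sub>R b) x = pd j \<phi> x *\<^sub>R b"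
  by (rule pd_linear[OF bounded_linear_scaleR_left assms])

text \<open>
  The operator moves onto the test function without a change of sign because \<open>- \<i> \<alpha>\<close> is skew for the real
  inner product, which compensates for the sign from the derivative.
\<close>

lemma inner_dist_L:
  assumes \<Omega>: "bounded \<Omega>" "open \<Omega>" and V: "admissible \<Omega> M V" and u: "u \<in> L2 \<Omega>"
    and \<phi>: "\<phi> \<in> test_functions \<Omega>"
  shows "b \<bullet> dist_L \<Omega> V u \<phi> = L2_inner \<Omega> (dirac_op V (\<lambda>x. \<phi> x *\<^sub>R b)) u"
proof -
  have i1: "integrable (lebesgue_on \<Omega>) (\<lambda>x. pd j \<phi> x *\<^sub>R u x)" for j
    by (intro L2_integrable[OF \<Omega>] L2_scaleR_continuous[OF \<Omega>(1)] test_continuous[OF test_pd[OF \<phi>]] u)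
  have i2: "integrable (lebesgue_on \<Omega>) (\<lambda>x. \<phi> x *\<^sub>R (V x *v u x))"
    by (intro L2_integrable[OF \<Omega>] L2_scaleR_continuous[OF \<Omega>(1)] test_continuous[OF \<phi>] admissible_L2[OF V u])
  have 1: "b \<bullet> (P0 (axis j 1) *v dist_D \<Omega> j u \<phi>) = (LINT x|lebesgue_on \<Omega>. (- (\<i> *s alpha (axis j 1) (pd j \<phi> x *\<^sub>R b))) \<bullet> u x)" for j
  proof -
    let ?I = "LINT x|lebesgue_on \<Omega>. pd j \<phi> x *\<^sub>R u x"
    have "b \<bullet> (P0 (axis j 1) *v dist_D \<Omega> j u \<phi>) = b \<bullet> (\<i> *s alpha (axis j 1) ?I)"
      using alpha_scale[of "axis j 1" \<i> ?I] by (simp add: alpha_def cvec_axis dist_D_def)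
    also have "\<dots> = (- (\<i> *s alpha (axis j 1) b)) \<bullet> ?I"
      by (rule i_alpha_symmetric[symmetric])
    also have "\<dots> = (LINT x|lebesgue_on \<Omega>. (- (\<i> *s alpha (axis j 1) b)) \<bullet> (pd j \<phi> x *\<^sub>R u x))"
      by (rule integral_inner_right[symmetric]) (rule i1)
    also have "\<dots> = (LINT x|lebesgue_on \<Omega>. (- (\<i> *s alpha (axis j 1) (pd j \<phi> x *\<^sub>R b))) \<bullet> u x)"
      unfolding linear_scale[OF bounded_linear.linear[OF i_alpha_linear]] by simp
    finally show ?thesis .
  qed
  have i3: "integrable (lebesgue_on \<Omega>) (\<lambda>x. (- (\<i> *s alpha (axis j 1) (pd j \<phi> x *\<^sub>R b))) \<bullet> u x)" for j
    by (intro L2_inner_integrable L2_bounded_linear[OF i_alpha_linear] u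
        L2_bounded_linear[OF bounded_linear_scaleR_left] test_L2[OF \<Omega> test_pd[OF \<phi>]])
  have i4: "integrable (lebesgue_on \<Omega>) (\<lambda>x. (V x *v (\<phi> x *\<^sub>R b)) \<bullet> u x)"
    by (intro L2_inner_integrable admissible_L2[OF V] u
        L2_bounded_linear[OF bounded_linear_scaleR_left] test_L2[OF \<Omega> \<phi>])
  have 2: "b \<bullet> (LINT x|lebesgue_on \<Omega>. \<phi> x *\<^sub>R (V x *v u x)) = (LINT x|lebesgue_on \<Omega>. (V x *v (\<phi> x *\<^sub>R b)) \<bullet> u x)"
  proof -
    have "b \<bullet> (LINT x|lebesgue_on \<Omega>. \<phi> x *\<^sub>R (V x *v u x)) = (LINT x|lebesgue_on \<Omega>. b \<bullet> (\<phi> x *\<^sub>R (V x *v u x)))"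
      by (rule integral_inner_right[symmetric]) (rule i2)
    also have "\<dots> = (LINT x|lebesgue_on \<Omega>. (V x *v (\<phi> x *\<^sub>R b)) \<bullet> u x)"
      using V by (simp add: admissible_def)
    finally show ?thesis .
  qed
  show ?thesis
    unfolding dist_L_def dist_P0_D_def inner_add_right inner_sum_right 1 2 L2_inner_def dirac_op_def dirac_def
      pd_scaleR_vector[OF test_differentiable[OF \<phi>]] inner_add_left inner_sum_left
    using i3 i4 by (simp add: Bochner_Integration.integral_add Bochner_Integration.integral_sum)
qed

text \<open>
  A spinor valued test function is a sum of scalar ones times the vectors of a real basis, and the real
  inner products with all constant vectors determine a complex vector.
\<close>

lemma weak_equation_iff:
  assumes \<Omega>: "bounded \<Omega>" "open \<Omega>" and V: "admissible \<Omega> M V" and u: "u \<in> L2 \<Omega>" and g: "g \<in> L2 \<Omega>"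
  shows "(\<forall>\<phi>\<in>test_functions \<Omega>. dist_L \<Omega> V u \<phi> = (LINT x|lebesgue_on \<Omega>. \<phi> x *\<^sub>R g x)) \<longleftrightarrow>
    (\<forall>\<psi>\<in>test_functions \<Omega>. L2_inner \<Omega> (dirac_op V \<psi>) u = L2_inner \<Omega> \<psi> g)"
proof -
  have b: "b \<bullet> (LINT x|lebesgue_on \<Omega>. \<phi> x *\<^sub>R g x) = L2_inner \<Omega> (\<lambda>x. \<phi> x *\<^sub>R b) g"
    if "\<phi> \<in> test_functions \<Omega>" for b \<phi>
  proof -
    have "integrable (lebesgue_on \<Omega>) (\<lambda>x. \<phi> x *\<^sub>R g x)"
      by (intro L2_integrable[OF \<Omega>] L2_scaleR_continuous[OF \<Omega>(1)] test_continuous[OF that] g)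
    then show ?thesis by (simp add: L2_inner_def integral_inner_right[symmetric])
  qed
  show ?thesis
  proof (intro iffI ballI)
    fix \<phi> :: "real^3 \<Rightarrow> real"
    assume *: "\<forall>\<psi>\<in>test_functions \<Omega>. L2_inner \<Omega> (dirac_op V \<psi>) u = L2_inner \<Omega> \<psi> g"
      and \<phi>: "\<phi> \<in> test_functions \<Omega>"
    have "b \<bullet> dist_L \<Omega> V u \<phi> = b \<bullet> (LINT x|lebesgue_on \<Omega>. \<phi> x *\<^sub>R g x)" for b
      using * test_linear[OF bounded_linear_scaleR_left \<phi>, of b]
      by (simp add: inner_dist_L[OF \<Omega> V u \<phi>] b[OF \<phi>])
    then show "dist_L \<Omega> V u \<phi> = (LINT x|lebesgue_on \<Omega>. \<phi> x *\<^sub>R g x)"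
      using vector_eq_ldot by blast
  next
    fix \<psi> :: "real^3 \<Rightarrow> complex^(2+2)"
    assume *: "\<forall>\<phi>\<in>test_functions \<Omega>. dist_L \<Omega> V u \<phi> = (LINT x|lebesgue_on \<Omega>. \<phi> x *\<^sub>R g x)"
      and \<psi>: "\<psi> \<in> test_functions \<Omega>"
    let ?\<psi> = "\<lambda>b x. (\<psi> x \<bullet> b) *\<^sub>R b"
    have t: "(\<lambda>x. \<psi> x \<bullet> b) \<in> test_functions \<Omega>" for b
      by (rule test_linear[OF bounded_linear_inner_left \<psi>])
    have t': "?\<psi> b \<in> test_functions \<Omega>" for b
      by (rule test_linear[OF bounded_linear_scaleR_left t])
    have eq: "L2_inner \<Omega> (dirac_op V (?\<psi> b)) u = L2_inner \<Omega> (?\<psi> b) g" for b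
      using * t by (simp add: inner_dist_L[OF \<Omega> V u t, symmetric] b[OF t, symmetric])
    have sum: "L2_inner \<Omega> (dirac_op V (\<lambda>x. \<Sum>b\<in>B. ?\<psi> b x)) u = L2_inner \<Omega> (\<lambda>x. \<Sum>b\<in>B. ?\<psi> b x) g
        \<and> (\<lambda>x. \<Sum>b\<in>B. ?\<psi> b x) \<in> test_functions \<Omega>"
      if "finite B" for B
      using that
    proof (induction B rule: finite_induct)
      case empty
      have "dirac_op V (\<lambda>x. 0) = (\<lambda>x. 0 *\<^sub>R dirac_op V (\<lambda>x. 0) x)"
        using dirac_scaleR[OF test_zero, of 0] by (simp add: dirac_op_def matrix_vector_mult_0_right fun_eq_iff)
      then show ?case by (simp add: test_zero L2_inner_def)
    next
      case (insert c B)
      let ?S = "\<lambda>x. \<Sum>b\<in>B. ?\<psi> b x"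
      have S: "?S \<in> test_functions \<Omega>" "L2_inner \<Omega> (dirac_op V ?S) u = L2_inner \<Omega> ?S g"
        using insert by auto
      have d: "dirac_op V (\<lambda>x. ?\<psi> c x + ?S x) = (\<lambda>x. dirac_op V (?\<psi> c) x + 1 *\<^sub>R dirac_op V ?S x)"
        by (rule ext) (simp add: dirac_op_def dirac_add[OF t' S(1)] matrix_vector_right_distrib)
      have "L2_inner \<Omega> (dirac_op V (\<lambda>x. ?\<psi> c x + ?S x)) u = L2_inner \<Omega> (\<lambda>x. ?\<psi> c x + 1 *\<^sub>R ?S x) g"
        unfolding d
        by (simp only: L2_inner_linear_combination[OF dirac_op_L2[OF \<Omega> t' V] dirac_op_L2[OF \<Omega> S(1) V] u]
            L2_inner_linear_combination[OF test_L2[OF \<Omega> t'] test_L2[OF \<Omega> S(1)] g] eq S(2))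
      then show ?case using insert test_add[OF t' S(1)] by simp
    qed
    have "(\<lambda>x. \<Sum>b\<in>Basis. ?\<psi> b x) = \<psi>" by (simp add: euclidean_representation fun_eq_iff)
    then show "L2_inner \<Omega> (dirac_op V \<psi>) u = L2_inner \<Omega> \<psi> g"
      using sum[OF finite_Basis] by simp
  qed
qed

section \<open>Solvability with a concentrated right hand side\<close>

lemma integral_lebesgue_on_eq_lborel:
  fixes f :: "real^3 \<Rightarrow> real"
  assumes "open \<Omega>" "continuous_on UNIV f" "\<And>x. x \<notin> \<Omega> \<Longrightarrow> f x = 0"
  shows "(LINT x|lebesgue_on \<Omega>. f x) = (LINT x|lborel. f x)"
proof -
  have "(LINT x|lebesgue_on \<Omega>. f x) = (LINT x|lebesgue. indicator \<Omega> x *\<^sub>R f x)"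
    by (rule integral_restrict_space) (simp add: borel_open assms(1))
  also have "(\<lambda>x. indicator \<Omega> x *\<^sub>R f x) = f"
    using assms(3) by (auto simp: indicator_def fun_eq_iff)
  also have "(LINT x|lebesgue. f x) = (LINT x|lborel. f x)"
    by (rule integral_completion) (simp add: borel_measurable_continuous_onI assms(2))
  finally show ?thesis .
qed

text \<open>
  Multiplication by the isometry \<open>\<i> \<alpha>\<^sub>1\<close> turns \<open>P\<^sub>0(D)\<close> into \<open>\<partial>\<^sub>1 + \<alpha>\<^sub>1 \<alpha>\<^sub>2 \<partial>\<^sub>2 + \<alpha>\<^sub>1 \<alpha>\<^sub>3 \<partial>\<^sub>3\<close>, and the products
  \<open>\<alpha>\<^sub>1 \<alpha>\<^sub>k\<close> of anticommuting symmetric matrices are skew.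
\<close>

lemma dirac_carleman:
  assumes \<Omega>: "open \<Omega>" and \<psi>: "\<psi> \<in> test_functions \<Omega>"
    and w: "\<And>s. (w has_real_derivative w' s) (at s)" "\<And>s. (w' has_real_derivative w'' s) (at s)"
      "continuous_on UNIV w''"
  shows "(LINT x|lebesgue_on \<Omega>. exp (2 * w (x $ 1)) * (w'' (x $ 1) * (norm (\<psi> x))\<^sup>2)) \<le>
    (LINT x|lebesgue_on \<Omega>. exp (2 * w (x $ 1)) * (norm (dirac \<psi> x))\<^sup>2)"
proof -
  let ?e = "\<lambda>j. axis j 1 :: real^3"
  define B where "B k u = alpha (?e 1) (alpha (?e k) u)" for k u
  have orth: "?e 1 \<bullet> ?e 2 = 0" "?e 1 \<bullet> ?e 3 = 0" "?e 1 \<bullet> ?e 1 = 1"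
    by (simp_all add: inner_axis_axis)
  have lin: "bounded_linear (B k)" for k
    unfolding B_def by (rule bounded_linear_compose[OF alpha_linear alpha_linear])
  have skew: "u \<bullet> B k v = - (B k u \<bullet> v)" if "?e 1 \<bullet> ?e k = 0" for k u v
  proof -
    have "alpha (?e k) (alpha (?e 1) u) = - B k u"
      using alpha_anticommute[of "?e 1" "?e k" u] that by (simp add: B_def eq_neg_iff_add_eq_0 add.commute)
    then show ?thesis by (simp add: B_def alpha_symmetric[symmetric])
  qed
  have norm_eq: "norm (pd 1 \<psi> x + B 2 (pd 2 \<psi> x) + B 3 (pd 3 \<psi> x)) = norm (dirac \<psi> x)" for x
  proof -
    let ?s = "alpha (?e 1) (pd 1 \<psi> x) + alpha (?e 2) (pd 2 \<psi> x) + alpha (?e 3) (pd 3 \<psi> x)"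
    have "dirac \<psi> x = - (\<i> *s ?s)"
      unfolding dirac_def sum_3 by (simp add: vector_add_ldistrib add_ac)
    then have "norm (dirac \<psi> x) = norm (\<i> *s ?s)" by (simp only: norm_minus_cancel)
    also have "\<dots> = norm ?s" by (rule norm_i)
    also have "\<dots> = norm (alpha (?e 1) ?s)" by (simp add: norm_alpha)
    also have "alpha (?e 1) ?s = pd 1 \<psi> x + B 2 (pd 2 \<psi> x) + B 3 (pd 3 \<psi> x)"
      by (simp add: linear_add[OF bounded_linear.linear[OF alpha_linear]] alpha_square orth B_def)
    finally show ?thesis by simp
  qed
  obtain K where K: "compact K" "K \<subseteq> \<Omega>" "\<And>x. x \<notin> K \<Longrightarrow> \<psi> x = 0"
    using test_support[OF \<psi>] by blast
  have z: "pd j \<psi> x = 0" if "x \<notin> K" for x j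
    by (rule pd_zero_outside_closed[OF compact_imp_closed[OF K(1)] K(3) that])
  have cx: "continuous_on UNIV (\<lambda>x::real^3. x $ 1)" by (intro continuous_intros)
  have "continuous_on UNIV w" by (simp add: continuous_on_eq_continuous_at DERIV_isCont[OF w(1)])
  then have cE: "continuous_on UNIV (\<lambda>x::real^3. exp (2 * w (x $ 1)))"
    by (intro continuous_intros continuous_on_compose2[of UNIV w, OF _ cx]) auto
  have cw: "continuous_on UNIV (\<lambda>x::real^3. w'' (x $ 1))"
    by (rule continuous_on_compose2[OF w(3) cx]) simp
  have cd: "continuous_on UNIV (dirac \<psi>)"
    unfolding dirac_def[abs_def]
    by (intro continuous_on_sum bounded_linear.continuous_on[OF i_alpha_linear] test_continuous[OF test_pd[OF \<psi>]])
  have "dirac \<psi> x = 0" if "x \<notin> K" for x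
    unfolding dirac_def z[OF that] linear_0[OF bounded_linear.linear[OF i_alpha_linear]] by simp
  then have zd: "dirac \<psi> x = 0" if "x \<notin> \<Omega>" for x using that K(2) by blast
  have zp: "\<psi> x = 0" if "x \<notin> \<Omega>" for x using that K(2,3) by blast
  have 1: "(LINT x|lebesgue_on \<Omega>. exp (2 * w (x $ 1)) * (w'' (x $ 1) * (norm (\<psi> x))\<^sup>2))
      = (LINT x|lborel. exp (2 * w (x $ 1)) * (w'' (x $ 1) * (norm (\<psi> x))\<^sup>2))"
    by (rule integral_lebesgue_on_eq_lborel[OF \<Omega>])
      (auto simp: zp intro!: continuous_on_mult cE cw continuous_on_power continuous_on_norm test_continuous[OF \<psi>])
  have 2: "(LINT x|lebesgue_on \<Omega>. exp (2 * w (x $ 1)) * (norm (dirac \<psi> x))\<^sup>2)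
      = (LINT x|lborel. exp (2 * w (x $ 1)) * (norm (dirac \<psi> x))\<^sup>2)"
    by (rule integral_lebesgue_on_eq_lborel[OF \<Omega>])
      (auto simp: zd intro!: continuous_on_mult cE continuous_on_power continuous_on_norm cd)
  show ?thesis
    unfolding 1 2 unfolding norm_eq[symmetric]
    by (rule carleman_estimate[OF test_smooth[OF \<psi>] K(1,3) lin skew[OF orth(1)] lin skew[OF orth(2)] w])
qed

text \<open>
  The second derivative of the weight \<open>\<tau> s\<^sup>2 / 2 + sqrt (s\<^sup>2 + \<eta>\<^sup>2)\<close>. It is large near \<open>s = 0\<close>, although
  the weight stays bounded on bounded sets as \<open>\<eta> \<rightarrow> 0\<close>: it approximates a weight with a corner, whose
  second derivative has a point mass.
\<close>

definition weight'' :: "real \<Rightarrow> real \<Rightarrow> real \<Rightarrow> real" where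
  "weight'' \<tau> \<eta> s = \<tau> + \<eta>\<^sup>2 / (sqrt (s\<^sup>2 + \<eta>\<^sup>2)) ^ 3"

lemma weight''_ge: "\<tau> \<le> weight'' \<tau> \<eta> s"
  by (simp add: weight''_def)

lemma weight''_0: "0 < \<eta> \<Longrightarrow> weight'' \<tau> \<eta> 0 = \<tau> + 1 / \<eta>"
  by (simp add: weight''_def power2_eq_square power3_eq_cube)

lemma weight''_continuous: "0 < \<eta> \<Longrightarrow> continuous_on S (weight'' \<tau> \<eta>)"
  unfolding weight''_def[abs_def]
  by (intro continuous_intros) (simp_all add: add_nonneg_pos less_imp_neq[symmetric] real_sqrt_eq_zero_cancel_iff sum_power2_eq_zero_iff)

lemma weight_derivatives:
  assumes \<eta>: "0 < \<eta>"
  shows "((\<lambda>s. \<tau> * s\<^sup>2 / 2 + sqrt (s\<^sup>2 + \<eta>\<^sup>2)) has_real_derivative \<tau> * s + s / sqrt (s\<^sup>2 + \<eta>\<^sup>2)) (at s)"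
    and "((\<lambda>s. \<tau> * s + s / sqrt (s\<^sup>2 + \<eta>\<^sup>2)) has_real_derivative weight'' \<tau> \<eta> s) (at s)"
proof -
  define r where "r = sqrt (s\<^sup>2 + \<eta>\<^sup>2)"
  have pos: "0 < s\<^sup>2 + \<eta>\<^sup>2" using \<eta> by (simp add: add_nonneg_pos)
  have r: "0 < r" "r\<^sup>2 = s\<^sup>2 + \<eta>\<^sup>2" using pos by (simp_all add: r_def)
  have d: "((\<lambda>s. sqrt (s\<^sup>2 + \<eta>\<^sup>2)) has_real_derivative s / r) (at s)"
    using pos by (auto intro!: derivative_eq_intros simp: r_def field_simps)
  have q: "((\<lambda>s. \<tau> * s\<^sup>2 / 2) has_real_derivative \<tau> * s) (at s)"
    and q2: "((\<lambda>s. \<tau> * s) has_real_derivative \<tau>) (at s)"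
    by (auto intro!: derivative_eq_intros)
  show "((\<lambda>s. \<tau> * s\<^sup>2 / 2 + sqrt (s\<^sup>2 + \<eta>\<^sup>2)) has_real_derivative \<tau> * s + s / sqrt (s\<^sup>2 + \<eta>\<^sup>2)) (at s)"
    using DERIV_add[OF q d] unfolding r_def by simp
  have "r \<noteq> 0" using r(1) by simp
  have "((\<lambda>s. s / sqrt (s\<^sup>2 + \<eta>\<^sup>2)) has_real_derivative (1 * r - s * (s / r)) / (r * r)) (at s)"
    by (rule DERIV_divide[OF DERIV_ident d, folded r_def, OF \<open>r \<noteq> 0\<close>])
  moreover have "(1 * r - s * (s / r)) / (r * r) = \<eta>\<^sup>2 / r ^ 3"
  proof -
    have "(1 * r - s * (s / r)) / (r * r) = (r\<^sup>2 - s\<^sup>2) / r ^ 3"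
      using r(1) by (simp add: field_simps power2_eq_square power3_eq_cube)
    then show ?thesis using r(2) by simp
  qed
  ultimately show "((\<lambda>s. \<tau> * s + s / sqrt (s\<^sup>2 + \<eta>\<^sup>2)) has_real_derivative weight'' \<tau> \<eta> s) (at s)"
    using DERIV_add[OF q2] unfolding weight''_def r_def[symmetric] by simp
qed

text \<open>
  The contribution of the potential to \<open>P\<^sub>0(D) \<psi>\<close> is at most half of the left-hand side, since
  \<open>w'' \<ge> 4 M\<^sup>2\<close>. The exponential weight lies between \<open>1\<close> and a constant that does not depend on \<open>\<eta>\<close>, so it can
  be removed at the cost of a constant that is uniform in \<open>\<eta>\<close>.
\<close>

lemma dirac_op_a_priori_estimate:
  assumes \<Omega>: "bounded \<Omega>" "open \<Omega>" and V: "admissible \<Omega> M V"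
  shows "\<exists>C>0. \<forall>\<eta> \<psi>. 0 < \<eta> \<longrightarrow> \<eta> \<le> 1 \<longrightarrow> \<psi> \<in> test_functions \<Omega> \<longrightarrow>
      (LINT x|lebesgue_on \<Omega>. weight'' (4 * M\<^sup>2 + 1) \<eta> (x $ 1 - a) * (norm (\<psi> x))\<^sup>2)
        \<le> C * L2_inner \<Omega> (dirac_op V \<psi>) (dirac_op V \<psi>)"
proof -
  define \<tau> where "\<tau> = 4 * M\<^sup>2 + 1"
  have \<tau>: "0 < \<tau>" "4 * M\<^sup>2 \<le> \<tau>" unfolding \<tau>_def by (simp_all add: add_nonneg_pos)
  obtain R0 where R0: "\<And>x. x \<in> \<Omega> \<Longrightarrow> norm x \<le> R0" using \<Omega>(1) bounded_iff by blast
  define R where "R = \<bar>R0\<bar> + \<bar>a\<bar>"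
  have R: "\<bar>x $ 1 - a\<bar> \<le> R" if "x \<in> \<Omega>" for x
    using R0[OF that] component_le_norm_cart[of x 1] unfolding R_def by linarith
  define W where "W = \<tau> * R\<^sup>2 / 2 + (R + 1)"
  define w where "w \<eta> s = \<tau> * s\<^sup>2 / 2 + sqrt (s\<^sup>2 + \<eta>\<^sup>2)" for \<eta> s
  have wb: "0 \<le> w \<eta> (x $ 1 - a)" "w \<eta> (x $ 1 - a) \<le> W" if "x \<in> \<Omega>" "0 < \<eta>" "\<eta> \<le> 1" for x \<eta>
  proof -
    let ?s = "x $ 1 - a"
    show "0 \<le> w \<eta> ?s" unfolding w_def using \<tau> by simp
    have "?s\<^sup>2 \<le> R\<^sup>2" using R[OF that(1)] by (simp add: abs_le_square_iff[symmetric])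
    then have "\<tau> * ?s\<^sup>2 / 2 \<le> \<tau> * R\<^sup>2 / 2" using \<tau> by simp
    moreover have "sqrt (?s\<^sup>2 + \<eta>\<^sup>2) \<le> \<bar>?s\<bar> + \<bar>\<eta>\<bar>" by (rule sqrt_sum_squares_le_sum_abs)
    ultimately show "w \<eta> ?s \<le> W" unfolding w_def W_def using R[OF that(1)] that by linarith
  qed
  have est: "(LINT x|lebesgue_on \<Omega>. weight'' (4 * M\<^sup>2 + 1) \<eta> (x $ 1 - a) * (norm (\<psi> x))\<^sup>2)
        \<le> (4 * exp (2 * W)) * L2_inner \<Omega> (dirac_op V \<psi>) (dirac_op V \<psi>)"
    if \<eta>: "0 < \<eta>" "\<eta> \<le> 1" and \<psi>: "\<psi> \<in> test_functions \<Omega>" for \<eta> \<psi>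
  proof -
    let ?M = "lebesgue_on \<Omega>"
    define k where "k x = weight'' \<tau> \<eta> (x $ 1 - a)" for x :: "real^3"
    define e where "e x = exp (w \<eta> (x $ 1 - a))" for x :: "real^3"
    have wd: "((\<lambda>s. w \<eta> (s - a)) has_real_derivative \<tau> * (s - a) + (s - a) / sqrt ((s - a)\<^sup>2 + \<eta>\<^sup>2)) (at s)"
      "((\<lambda>s. \<tau> * (s - a) + (s - a) / sqrt ((s - a)\<^sup>2 + \<eta>\<^sup>2)) has_real_derivative weight'' \<tau> \<eta> (s - a)) (at s)" for s
      unfolding w_def
      using DERIV_chain2[OF weight_derivatives(1)[OF \<eta>(1), of \<tau> "s - a"] DERIV_diff[OF DERIV_ident DERIV_const]]
        DERIV_chain2[OF weight_derivatives(2)[OF \<eta>(1), of \<tau> "s - a"] DERIV_diff[OF DERIV_ident DERIV_const]]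
      by simp_all
    have cw: "continuous_on UNIV (\<lambda>s. weight'' \<tau> \<eta> (s - a))"
      by (intro continuous_on_compose2[OF weight''_continuous[OF \<eta>(1), of UNIV]] continuous_intros) auto
    have ck: "continuous_on UNIV k"
      unfolding k_def by (intro continuous_on_compose2[OF cw] continuous_intros) auto
    have "continuous_on UNIV (\<lambda>s. w \<eta> (s - a))"
      by (simp add: continuous_on_eq_continuous_at DERIV_isCont[OF wd(1)])
    then have "continuous_on UNIV (\<lambda>x::real^3. w \<eta> (x $ 1 - a))"
      by (rule continuous_on_compose2) (auto intro!: continuous_intros)
    then have ce: "continuous_on UNIV e"
      unfolding e_def by (rule continuous_on_exp)
    have e2: "(e x)\<^sup>2 = exp (2 * w \<eta> (x $ 1 - a))" for x
      by (simp add: e_def exp_double)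
    have carl: "(LINT x|?M. (e x)\<^sup>2 * (k x * (norm (\<psi> x))\<^sup>2)) \<le> (LINT x|?M. (e x)\<^sup>2 * (norm (dirac \<psi> x))\<^sup>2)"
      unfolding e2 k_def by (rule dirac_carleman[OF \<Omega>(2) \<psi> wd cw])
    note \<psi>L = test_L2[OF \<Omega> \<psi>] and LL = dirac_op_L2[OF \<Omega> \<psi> V] and DL = dirac_L2[OF \<Omega> \<psi>]
    have ep: "(\<lambda>x. e x *\<^sub>R \<psi> x) \<in> L2 \<Omega>" and eL: "(\<lambda>x. e x *\<^sub>R dirac_op V \<psi> x) \<in> L2 \<Omega>"
      and ed: "(\<lambda>x. e x *\<^sub>R dirac \<psi> x) \<in> L2 \<Omega>"
      by (intro L2_scaleR_continuous[OF \<Omega>(1) ce] \<psi>L LL DL)+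
    have iep: "integrable ?M (\<lambda>x. (e x)\<^sup>2 * (norm (\<psi> x))\<^sup>2)"
      and ieL: "integrable ?M (\<lambda>x. (e x)\<^sup>2 * (norm (dirac_op V \<psi> x))\<^sup>2)"
      and ied: "integrable ?M (\<lambda>x. (e x)\<^sup>2 * (norm (dirac \<psi> x))\<^sup>2)"
      using L2_D(2)[OF ep] L2_D(2)[OF eL] L2_D(2)[OF ed] by (simp_all add: power_mult_distrib)
    have ik: "integrable ?M (\<lambda>x. k x * (norm (\<psi> x))\<^sup>2)"
      using L2_inner_integrable[OF L2_scaleR_continuous[OF \<Omega>(1) ck \<psi>L] \<psi>L]
      by (simp add: power2_norm_eq_inner)
    have iek: "integrable ?M (\<lambda>x. (e x)\<^sup>2 * (k x * (norm (\<psi> x))\<^sup>2))"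
    proof -
      have "(e x)\<^sup>2 * (k x * (norm (\<psi> x))\<^sup>2) = (k x *\<^sub>R (e x *\<^sub>R \<psi> x)) \<bullet> (e x *\<^sub>R \<psi> x)" for x
        unfolding power2_norm_eq_inner by (simp add: power2_eq_square)
      then show ?thesis
        using L2_inner_integrable[OF L2_scaleR_continuous[OF \<Omega>(1) ck ep] ep] by (simp only:)
    qed
    let ?I = "LINT x|?M. (e x)\<^sup>2 * (k x * (norm (\<psi> x))\<^sup>2)"
    let ?J = "LINT x|?M. (e x)\<^sup>2 * (norm (dirac_op V \<psi> x))\<^sup>2"
    have pt: "(norm (dirac \<psi> x))\<^sup>2 \<le> 2 * (norm (dirac_op V \<psi> x))\<^sup>2 + 1/2 * (k x * (norm (\<psi> x))\<^sup>2)" if "x \<in> \<Omega>" for x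
    proof -
      have "norm (dirac \<psi> x) \<le> norm (dirac_op V \<psi> x) + norm (V x *v \<psi> x)"
        unfolding dirac_op_def using norm_triangle_ineq4[of "dirac \<psi> x + V x *v \<psi> x" "V x *v \<psi> x"] by simp
      moreover have "norm (V x *v \<psi> x) \<le> M * norm (\<psi> x)" using V that by (simp add: admissible_def)
      ultimately have "norm (dirac \<psi> x) \<le> norm (dirac_op V \<psi> x) + M * norm (\<psi> x)" by linarith
      then have "(norm (dirac \<psi> x))\<^sup>2 \<le> (norm (dirac_op V \<psi> x) + M * norm (\<psi> x))\<^sup>2"
        by (rule power_mono) simp
      also have "\<dots> \<le> 2 * (norm (dirac_op V \<psi> x))\<^sup>2 + 2 * M\<^sup>2 * (norm (\<psi> x))\<^sup>2"
        using zero_le_power2[of "norm (dirac_op V \<psi> x) - M * norm (\<psi> x)"]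
        by (simp add: power2_eq_square algebra_simps)
      also have "2 * M\<^sup>2 * (norm (\<psi> x))\<^sup>2 \<le> 1/2 * (k x * (norm (\<psi> x))\<^sup>2)"
        using mult_right_mono[OF order_trans[OF \<tau>(2) weight''_ge[of \<tau> \<eta> "x $ 1 - a"]], of "(norm (\<psi> x))\<^sup>2"]
        by (simp add: k_def)
      finally show ?thesis by simp
    qed
    have "?I \<le> (LINT x|?M. (e x)\<^sup>2 * (norm (dirac \<psi> x))\<^sup>2)" by (rule carl)
    also have "\<dots> \<le> (LINT x|?M. 2 * ((e x)\<^sup>2 * (norm (dirac_op V \<psi> x))\<^sup>2) + 1/2 * ((e x)\<^sup>2 * (k x * (norm (\<psi> x))\<^sup>2)))"
    proof (rule integral_mono[OF ied])
      show "integrable ?M (\<lambda>x. 2 * ((e x)\<^sup>2 * (norm (dirac_op V \<psi> x))\<^sup>2) + 1/2 * ((e x)\<^sup>2 * (k x * (norm (\<psi> x))\<^sup>2)))"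
        by (intro Bochner_Integration.integrable_add integrable_mult_right ieL iek)
      fix x assume "x \<in> space ?M"
      then have "x \<in> \<Omega>" by (simp add: space_restrict_space)
      from mult_left_mono[OF pt[OF this] zero_le_power2[of "e x"]]
      show "(e x)\<^sup>2 * (norm (dirac \<psi> x))\<^sup>2
        \<le> 2 * ((e x)\<^sup>2 * (norm (dirac_op V \<psi> x))\<^sup>2) + 1/2 * ((e x)\<^sup>2 * (k x * (norm (\<psi> x))\<^sup>2))"
        by (simp add: algebra_simps)
    qed
    also have "\<dots> = 2 * ?J + 1/2 * ?I" using ieL iek by simp
    finally have IJ: "?I \<le> 4 * ?J" by linarith
    have "?J \<le> (LINT x|?M. exp (2 * W) * (norm (dirac_op V \<psi> x))\<^sup>2)"
    proof (rule integral_mono[OF ieL])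
      show "integrable ?M (\<lambda>x. exp (2 * W) * (norm (dirac_op V \<psi> x))\<^sup>2)" using L2_D(2)[OF LL] by simp
      fix x assume "x \<in> space ?M"
      then have "x \<in> \<Omega>" by (simp add: space_restrict_space)
      then show "(e x)\<^sup>2 * (norm (dirac_op V \<psi> x))\<^sup>2 \<le> exp (2 * W) * (norm (dirac_op V \<psi> x))\<^sup>2"
        unfolding e2 using wb(2)[OF _ \<eta>] by (intro mult_right_mono) auto
    qed
    also have "\<dots> = exp (2 * W) * L2_inner \<Omega> (dirac_op V \<psi>) (dirac_op V \<psi>)" by (simp add: L2_inner_self)
    finally have J: "?J \<le> exp (2 * W) * L2_inner \<Omega> (dirac_op V \<psi>) (dirac_op V \<psi>)" .
    have "(LINT x|?M. k x * (norm (\<psi> x))\<^sup>2) \<le> ?I"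
    proof (rule integral_mono[OF ik iek])
      fix x assume "x \<in> space ?M"
      then have "x \<in> \<Omega>" by (simp add: space_restrict_space)
      then have "1 \<le> (e x)\<^sup>2" unfolding e2 using wb(1)[OF _ \<eta>] by simp
      moreover have "0 \<le> k x * (norm (\<psi> x))\<^sup>2"
        unfolding k_def using weight''_ge[of \<tau> \<eta> "x $ 1 - a"] \<tau>(1) by simp
      ultimately show "k x * (norm (\<psi> x))\<^sup>2 \<le> (e x)\<^sup>2 * (k x * (norm (\<psi> x))\<^sup>2)"
        using mult_right_mono by fastforce
    qed
    then have "(LINT x|?M. k x * (norm (\<psi> x))\<^sup>2) \<le> 4 * (exp (2 * W) * L2_inner \<Omega> (dirac_op V \<psi>) (dirac_op V \<psi>))"
      using IJ J by linarith
    then show ?thesis unfolding k_def \<tau>_def by simp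
  qed
  then show ?thesis by (intro exI[of _ "4 * exp (2 * W)"]) auto
qed

lemma matrix_vector_mult_scaleR_right: "A *v (s *\<^sub>R u) = s *\<^sub>R (A *v u)" for A :: "complex^'n^'m"
  by (simp add: vec_eq_iff matrix_vector_mult_def scaleR_sum_right)

lemma dirac_op_linear_combination:
  assumes "f \<in> test_functions \<Omega>" "g \<in> test_functions \<Omega>"
  shows "dirac_op V (\<lambda>x. f x + s *\<^sub>R g x) = (\<lambda>x. dirac_op V f x + s *\<^sub>R dirac_op V g x)"
proof
  fix x
  have g: "(\<lambda>x. s *\<^sub>R g x) \<in> test_functions \<Omega>" by (rule test_linear[OF bounded_linear_scaleR_right assms(2)])
  show "dirac_op V (\<lambda>x. f x + s *\<^sub>R g x) x = dirac_op V f x + s *\<^sub>R dirac_op V g x"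
    unfolding dirac_op_def dirac_add[OF assms(1) g] dirac_scaleR[OF assms(2)]
    by (simp add: matrix_vector_right_distrib matrix_vector_mult_scaleR_right scaleR_add_right)
qed

text \<open>
  The correction \<open>r\<close> has to satisfy \<open>L\<^sub>V r = - V u\<close>, that is, it has to represent the functional
  \<open>L\<^sub>V \<psi> \<mapsto> - \<langle>\<psi>, V u\<rangle>\<close>. Splitting off \<open>sqrt (w'')\<close> in the Cauchy-Schwarz inequality and applying the a priori
  estimate to \<open>\<psi>\<close> bounds this functional by \<open>\<integral> \<bar>u\<bar>\<^sup>2 / w''\<close>, which is small for a \<open>u\<close> that is concentrated
  on the plane \<open>x\<^sub>1 = a\<close>.
\<close>

lemma dirac_solution_near_free_solution:
  assumes \<Omega>: "bounded \<Omega>" "open \<Omega>" and V: "admissible \<Omega> M V"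
  shows "\<exists>C>0. \<forall>\<eta> u. 0 < \<eta> \<longrightarrow> \<eta> \<le> 1 \<longrightarrow> u \<in> L2 \<Omega> \<longrightarrow> (\<forall>\<psi>\<in>test_functions \<Omega>. L2_inner \<Omega> (dirac \<psi>) u = 0) \<longrightarrow>
      (\<exists>r\<in>L2 \<Omega>. (\<forall>\<phi>\<in>test_functions \<Omega>. dist_L \<Omega> V (\<lambda>x. u x + r x) \<phi> = 0) \<and>
        L2_inner \<Omega> r r \<le> C * (LINT x|lebesgue_on \<Omega>. (norm (u x))\<^sup>2 / weight'' (4 * M\<^sup>2 + 1) \<eta> (x $ 1 - a)))"
proof -
  obtain C where C: "0 < C"
    "\<And>\<eta> \<psi>. 0 < \<eta> \<Longrightarrow> \<eta> \<le> 1 \<Longrightarrow> \<psi> \<in> test_functions \<Omega> \<Longrightarrow>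
      (LINT x|lebesgue_on \<Omega>. weight'' (4 * M\<^sup>2 + 1) \<eta> (x $ 1 - a) * (norm (\<psi> x))\<^sup>2)
        \<le> C * L2_inner \<Omega> (dirac_op V \<psi>) (dirac_op V \<psi>)"
    using dirac_op_a_priori_estimate[OF \<Omega> V, of a] by blast
  have M: "0 \<le> M" using V by (simp add: admissible_def)
  have ex: "\<exists>r\<in>L2 \<Omega>. (\<forall>\<phi>\<in>test_functions \<Omega>. dist_L \<Omega> V (\<lambda>x. u x + r x) \<phi> = 0) \<and>
        L2_inner \<Omega> r r \<le> (C * M\<^sup>2 + 1) * (LINT x|lebesgue_on \<Omega>. (norm (u x))\<^sup>2 / weight'' (4 * M\<^sup>2 + 1) \<eta> (x $ 1 - a))"
    if \<eta>: "0 < \<eta>" "\<eta> \<le> 1" and u: "u \<in> L2 \<Omega>" 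
      and free: "\<And>\<psi>. \<psi> \<in> test_functions \<Omega> \<Longrightarrow> L2_inner \<Omega> (dirac \<psi>) u = 0" for \<eta> u
  proof -
    define k where "k x = weight'' (4 * M\<^sup>2 + 1) \<eta> (x $ 1 - a)" for x :: "real^3"
    have k1: "1 \<le> k x" for x
      using weight''_ge[of "4 * M\<^sup>2 + 1" \<eta> "x $ 1 - a"] unfolding k_def by (simp add: order_trans[rotated])
    have kp: "0 < k x" for x using k1[of x] by linarith
    have ck: "continuous_on UNIV k"
      unfolding k_def
      by (intro continuous_on_compose2[OF weight''_continuous[OF \<eta>(1), of UNIV]] continuous_intros) auto
    have cs: "continuous_on UNIV (\<lambda>x. sqrt (k x))" "continuous_on UNIV (\<lambda>x. 1 / sqrt (k x))"
      using kp by (auto intro!: continuous_intros ck simp: less_imp_neq[symmetric])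
    define I where "I = (LINT x|lebesgue_on \<Omega>. (norm (u x))\<^sup>2 / k x)"
    let ?Vu = "\<lambda>x. V x *v u x"
    have VuL: "?Vu \<in> L2 \<Omega>" by (rule admissible_L2[OF V u])
    have sq: "sqrt (k x) * sqrt (k x) = k x" "sqrt (k x) \<noteq> 0" for x using kp[of x] by simp_all
    let ?f = "\<lambda>x. (1 / sqrt (k x)) *\<^sub>R ?Vu x" and ?u = "\<lambda>x. (1 / sqrt (k x)) *\<^sub>R u x"
    have fL: "?f \<in> L2 \<Omega>" and uL: "?u \<in> L2 \<Omega>"
      by (intro L2_scaleR_continuous[OF \<Omega>(1) cs(2)] VuL u)+
    have uI: "L2_inner \<Omega> ?u ?u = I"
      unfolding L2_inner_self I_def by (simp add: power_divide power2_eq_square[of "sqrt _"] sq(1) less_imp_le[OF kp])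
    have I0: "0 \<le> I" using uI L2_inner_self_nonneg[of \<Omega> ?u] by simp
    have fI: "L2_inner \<Omega> ?f ?f \<le> M\<^sup>2 * I"
    proof -
      have "L2_inner \<Omega> ?f ?f \<le> (LINT x|lebesgue_on \<Omega>. M\<^sup>2 * (norm (?u x))\<^sup>2)"
        unfolding L2_inner_self
      proof (rule integral_mono[OF L2_D(2)[OF fL]])
        show "integrable (lebesgue_on \<Omega>) (\<lambda>x. M\<^sup>2 * (norm (?u x))\<^sup>2)" using L2_D(2)[OF uL] by simp
        fix x assume "x \<in> space (lebesgue_on \<Omega>)"
        then have "norm (?Vu x) \<le> M * norm (u x)" using V by (simp add: admissible_def space_restrict_space)
        then have "norm (?f x) \<le> M * norm (?u x)" 
          using kp[of x] by (simp add: divide_right_mono)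
        then have "(norm (?f x))\<^sup>2 \<le> (M * norm (?u x))\<^sup>2" by (rule power_mono) simp
        then show "(norm (?f x))\<^sup>2 \<le> M\<^sup>2 * (norm (?u x))\<^sup>2" by (simp only: power_mult_distrib)
      qed
      then show ?thesis using uI by (simp add: L2_inner_self)
    qed
    \<comment> \<open>The graph of the functional; that it is single valued follows from the bound below.\<close>
    let ?W = "{(dirac_op V \<psi>, - L2_inner \<Omega> \<psi> ?Vu) | \<psi>. \<psi> \<in> test_functions \<Omega>}"
    have "\<exists>r\<in>L2 \<Omega>. (\<forall>g c. (g, c) \<in> ?W \<longrightarrow> L2_inner \<Omega> r g = c) \<and> L2_inner \<Omega> r r \<le> C * M\<^sup>2 * I"
    proof (rule L2_representation[OF \<Omega>, of ?W "C * M\<^sup>2 * I"])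
      have "dirac_op V (\<lambda>x. 0) = (\<lambda>x. 0)"
        using dirac_scaleR[OF test_zero, of 0] by (simp add: dirac_op_def matrix_vector_mult_0_right fun_eq_iff)
      moreover have "L2_inner \<Omega> (\<lambda>x. 0) ?Vu = 0" by (simp add: L2_inner_def)
      ultimately show "((\<lambda>x. 0), 0) \<in> ?W" using test_zero by force
      show "g \<in> L2 \<Omega>" if "(g, c) \<in> ?W" for g c using that dirac_op_L2[OF \<Omega> _ V] by auto
      show "((\<lambda>x. g x + s *\<^sub>R h x), c + s * d) \<in> ?W" if gc: "(g, c) \<in> ?W" and hd: "(h, d) \<in> ?W" for g c h d s
      proof -
        obtain \<psi> \<zeta> where p: "\<psi> \<in> test_functions \<Omega>" "g = dirac_op V \<psi>" "c = - L2_inner \<Omega> \<psi> ?Vu"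
          and q: "\<zeta> \<in> test_functions \<Omega>" "h = dirac_op V \<zeta>" "d = - L2_inner \<Omega> \<zeta> ?Vu"
          using gc hd by auto
        have "(\<lambda>x. \<psi> x + s *\<^sub>R \<zeta> x) \<in> test_functions \<Omega>"
          by (intro test_add p(1) test_linear[OF bounded_linear_scaleR_right q(1)])
        moreover have "(\<lambda>x. g x + s *\<^sub>R h x) = dirac_op V (\<lambda>x. \<psi> x + s *\<^sub>R \<zeta> x)"
          unfolding p(2) q(2) dirac_op_linear_combination[OF p(1) q(1)] ..
        moreover have "c + s * d = - L2_inner \<Omega> (\<lambda>x. \<psi> x + s *\<^sub>R \<zeta> x) ?Vu"
          unfolding p(3) q(3) L2_inner_linear_combination[OF test_L2[OF \<Omega> p(1)] test_L2[OF \<Omega> q(1)] VuL] by simp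
        ultimately show ?thesis by blast
      qed
      show "c\<^sup>2 \<le> C * M\<^sup>2 * I * L2_inner \<Omega> g g" if gc: "(g, c) \<in> ?W" for g c
      proof -
        obtain \<psi> where p: "\<psi> \<in> test_functions \<Omega>" "g = dirac_op V \<psi>" "c = - L2_inner \<Omega> \<psi> ?Vu"
          using gc by auto
        let ?p = "\<lambda>x. sqrt (k x) *\<^sub>R \<psi> x"
        have pL: "?p \<in> L2 \<Omega>" by (rule L2_scaleR_continuous[OF \<Omega>(1) cs(1) test_L2[OF \<Omega> p(1)]])
        have "c\<^sup>2 = (L2_inner \<Omega> ?p ?f)\<^sup>2"
          unfolding p(3) L2_inner_def using sq by simp
        also have "\<dots> \<le> L2_inner \<Omega> ?p ?p * L2_inner \<Omega> ?f ?f" by (rule L2_Cauchy_Schwarz[OF pL fL])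
        also have "L2_inner \<Omega> ?p ?p = (LINT x|lebesgue_on \<Omega>. k x * (norm (\<psi> x))\<^sup>2)"
          unfolding L2_inner_self by (simp add: power_mult_distrib less_imp_le[OF kp])
        also have "(LINT x|lebesgue_on \<Omega>. k x * (norm (\<psi> x))\<^sup>2) * L2_inner \<Omega> ?f ?f
            \<le> (C * L2_inner \<Omega> g g) * (M\<^sup>2 * I)"
          unfolding p(2) k_def
          by (rule mult_mono[OF C(2)[OF \<eta> p(1)] fI[unfolded k_def] _ L2_inner_self_nonneg])
            (use C(1) L2_inner_self_nonneg[of \<Omega> "dirac_op V \<psi>"] in simp)
        finally show ?thesis by (simp add: mult_ac)
      qed
      show "0 \<le> C * M\<^sup>2 * I" using C(1) I0 by simp
    qed
    then obtain r where r: "r \<in> L2 \<Omega>" "\<And>g c. (g, c) \<in> ?W \<Longrightarrow> L2_inner \<Omega> r g = c" "L2_inner \<Omega> r r \<le> C * M\<^sup>2 * I"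
      by auto
    let ?v = "\<lambda>x. u x + r x"
    have vL: "?v \<in> L2 \<Omega>" by (rule L2_add[OF u r(1)])
    have "L2_inner \<Omega> (dirac_op V \<psi>) ?v = L2_inner \<Omega> \<psi> (\<lambda>x. 0)" if \<psi>: "\<psi> \<in> test_functions \<Omega>" for \<psi>
    proof -
      note DL = dirac_op_L2[OF \<Omega> \<psi> V]
      have "L2_inner \<Omega> (dirac_op V \<psi>) ?v = L2_inner \<Omega> u (dirac_op V \<psi>) + L2_inner \<Omega> r (dirac_op V \<psi>)"
        using L2_inner_linear_combination[OF u r(1) DL, of 1] by (simp add: L2_inner_commute[of \<Omega> "dirac_op V \<psi>"])
      also have "L2_inner \<Omega> r (dirac_op V \<psi>) = - L2_inner \<Omega> \<psi> ?Vu" by (rule r(2)) (use \<psi> in blast)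
      also have "L2_inner \<Omega> u (dirac_op V \<psi>) = L2_inner \<Omega> (dirac \<psi>) u + 1 * L2_inner \<Omega> (\<lambda>x. V x *v \<psi> x) u"
        using L2_inner_linear_combination[OF dirac_L2[OF \<Omega> \<psi>] admissible_L2[OF V test_L2[OF \<Omega> \<psi>]] u, of 1]
        by (simp add: L2_inner_commute[of \<Omega> u] dirac_op_def[abs_def])
      also have "\<dots> = L2_inner \<Omega> \<psi> ?Vu" using free[OF \<psi>] admissible_inner[OF V] by simp
      finally show ?thesis by (simp add: L2_inner_def)
    qed
    then have "\<forall>\<phi>\<in>test_functions \<Omega>. dist_L \<Omega> V ?v \<phi> = 0"
      using weak_equation_iff[OF \<Omega> V vL L2_zero] by simp
    moreover have "L2_inner \<Omega> r r \<le> (C * M\<^sup>2 + 1) * I" using r(3) I0 by (simp add: distrib_right)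
    ultimately show ?thesis using r(1) unfolding I_def k_def by blast
  qed
  have "0 < C * M\<^sup>2 + 1" using C(1) by (simp add: add_nonneg_pos)
  then show ?thesis using ex by (intro exI[of _ "C * M\<^sup>2 + 1"]) blast
qed

section \<open>Cauchy data and the integral identity\<close>

lemma L2_upper: "u \<in> L2 \<Omega> \<Longrightarrow> upper \<circ> u \<in> L2 \<Omega>"
  and L2_lower: "u \<in> L2 \<Omega> \<Longrightarrow> lower \<circ> u \<in> L2 \<Omega>"
  unfolding o_def by (rule L2_bounded_linear[OF upper_linear] L2_bounded_linear[OF lower_linear]; assumption)+

lemma L2_join:
  assumes "v \<in> L2 \<Omega>" "w \<in> L2 \<Omega>"
  shows "(\<lambda>x. join (v x) (w x)) \<in> L2 \<Omega>"
  using L2_add[OF L2_bounded_linear[OF join_linear(1) assms(1)] L2_bounded_linear[OF join_linear(2) assms(2)]]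
  by (simp add: join_sum[symmetric])

lemma dist_sigma_D_lower:
  assumes \<Omega>: "bounded \<Omega>" "open \<Omega>" and u: "u \<in> L2 \<Omega>" and \<phi>: "\<phi> \<in> test_functions \<Omega>"
  shows "dist_sigma_D \<Omega> (lower \<circ> u) \<phi> = upper (dist_P0_D \<Omega> u \<phi>)"
    and "dist_sigma_D \<Omega> (upper \<circ> u) \<phi> = lower (dist_P0_D \<Omega> u \<phi>)"
proof -
  have i: "integrable (lebesgue_on \<Omega>) (\<lambda>x. pd j \<phi> x *\<^sub>R u x)" for j
    by (intro L2_integrable[OF \<Omega>] L2_scaleR_continuous[OF \<Omega>(1)] test_continuous[OF test_pd[OF \<phi>]] u)
  have l: "(LINT x|lebesgue_on \<Omega>. pd j \<phi> x *\<^sub>R lower (u x)) = lower (LINT x|lebesgue_on \<Omega>. pd j \<phi> x *\<^sub>R u x)"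
    and up: "(LINT x|lebesgue_on \<Omega>. pd j \<phi> x *\<^sub>R upper (u x)) = upper (LINT x|lebesgue_on \<Omega>. pd j \<phi> x *\<^sub>R u x)" for j
    using integral_bounded_linear[OF lower_linear i[of j]] integral_bounded_linear[OF upper_linear i[of j]] by simp_all
  have P: "upper (P0 \<xi> *v v) = sigma_dot \<xi> *v lower v" "lower (P0 \<xi> *v v) = sigma_dot \<xi> *v upper v" for \<xi> v
    by (simp_all add: P0_def upper_block lower_block matrix_vector_mult_0)
  show "dist_sigma_D \<Omega> (lower \<circ> u) \<phi> = upper (dist_P0_D \<Omega> u \<phi>)"
    "dist_sigma_D \<Omega> (upper \<circ> u) \<phi> = lower (dist_P0_D \<Omega> u \<phi>)"
    unfolding dist_sigma_D_def dist_P0_D_def dist_D_def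
      linear_sum[OF bounded_linear.linear[OF upper_linear]] linear_sum[OF bounded_linear.linear[OF lower_linear]]
    by (simp_all add: P l up)
qed

text \<open>
  In each block the equation expresses \<open>\<sigma> \<cdot> D\<close> of the one component by the square integrable function
  \<open>- V u\<close>.
\<close>

lemma solution_in_H_space:
  assumes \<Omega>: "bounded \<Omega>" "open \<Omega>" and V: "admissible \<Omega> M V" and u: "u \<in> L2 \<Omega>"
    and sol: "\<And>\<phi>. \<phi> \<in> test_functions \<Omega> \<Longrightarrow> dist_L \<Omega> V u \<phi> = 0"
  shows "upper \<circ> u \<in> H_space \<Omega>" "lower \<circ> u \<in> H_space \<Omega>"
proof -
  let ?g = "\<lambda>x. - (V x *v u x)"
  have VL: "(\<lambda>x. V x *v u x) \<in> L2 \<Omega>" by (rule admissible_L2[OF V u])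
  then have gL: "?g \<in> L2 \<Omega>" using L2_linear_combination[OF L2_zero VL, of "-1"] by simp
  have eq: "dist_P0_D \<Omega> u \<phi> = (LINT x|lebesgue_on \<Omega>. \<phi> x *\<^sub>R ?g x)"
    and ig: "integrable (lebesgue_on \<Omega>) (\<lambda>x. \<phi> x *\<^sub>R ?g x)" if "\<phi> \<in> test_functions \<Omega>" for \<phi>
  proof -
    show "integrable (lebesgue_on \<Omega>) (\<lambda>x. \<phi> x *\<^sub>R ?g x)"
      by (intro L2_integrable[OF \<Omega>] L2_scaleR_continuous[OF \<Omega>(1)] test_continuous[OF that] gL)
    show "dist_P0_D \<Omega> u \<phi> = (LINT x|lebesgue_on \<Omega>. \<phi> x *\<^sub>R ?g x)"
      using sol[OF that] by (simp add: dist_L_def add_eq_0_iff2)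
  qed
  have "\<forall>\<phi>\<in>test_functions \<Omega>. dist_sigma_D \<Omega> (upper \<circ> u) \<phi> = (LINT x|lebesgue_on \<Omega>. \<phi> x *\<^sub>R (lower \<circ> ?g) x)"
    using integral_bounded_linear[OF lower_linear ig] dist_sigma_D_lower(2)[OF \<Omega> u] eq by (simp add: o_def)
  then show "upper \<circ> u \<in> H_space \<Omega>"
    unfolding H_space_def using L2_upper[OF u] L2_lower[OF gL] by blast
  have "\<forall>\<phi>\<in>test_functions \<Omega>. dist_sigma_D \<Omega> (lower \<circ> u) \<phi> = (LINT x|lebesgue_on \<Omega>. \<phi> x *\<^sub>R (upper \<circ> ?g) x)"
    using integral_bounded_linear[OF upper_linear ig] dist_sigma_D_lower(1)[OF \<Omega> u] eq by (simp add: o_def)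
  then show "lower \<circ> u \<in> H_space \<Omega>"
    unfolding H_space_def using L2_lower[OF u] L2_upper[OF gL] by blast
qed

lemma zero_in_H10: "(\<lambda>x. 0) \<in> H10 \<Omega>"
proof -
  have p: "pd j (\<lambda>x. 0) x = (0 :: 'b::euclidean_space)" for j and x :: "real^3"
    by (rule pd_eq) (rule has_derivative_const)
  show ?thesis
    unfolding H10_def
    by (auto simp: L2_zero weak_pd_def L2_norm_def p test_zero
        intro!: exI[of _ "\<lambda>_ _. 0"])
qed

lemma trace_eq_imp_H10:
  assumes "w \<in> H_space \<Omega>" "trace \<Omega> w = trace \<Omega> w'"
  shows "(\<lambda>x. w x - w' x) \<in> H10 \<Omega>"
proof -
  have "(w, w) \<in> trace_rel \<Omega>" using assms(1) zero_in_H10 by (simp add: trace_rel_def)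
  then have "w \<in> trace \<Omega> w'" using assms(2) unfolding trace_def by blast
  then show ?thesis by (simp add: trace_def trace_rel_def)
qed

text \<open>
  Weak convergence of the approximants and their gradients is all that the integration by parts uses;
  the approximations of the two blocks are joined to spinor valued test functions.
\<close>

lemma H10_spinor_approximation:
  assumes \<Omega>: "bounded \<Omega>" "open \<Omega>" and dp: "(\<lambda>x. upper (d x)) \<in> H10 \<Omega>" and dm: "(\<lambda>x. lower (d x)) \<in> H10 \<Omega>"
  shows "\<exists>G \<psi>. d \<in> L2 \<Omega> \<and> (\<forall>j. G j \<in> L2 \<Omega>) \<and> (\<forall>n. \<psi> n \<in> test_functions \<Omega>) \<and>
    (\<forall>j. \<forall>\<phi>\<in>test_functions \<Omega>. (LINT x|lebesgue_on \<Omega>. pd j \<phi> x *\<^sub>R d x) = - (LINT x|lebesgue_on \<Omega>. \<phi> x *\<^sub>R G j x)) \<and>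
    (\<forall>h\<in>L2 \<Omega>. (\<lambda>n. L2_inner \<Omega> (\<psi> n) h) \<longlonglongrightarrow> L2_inner \<Omega> d h) \<and>
    (\<forall>j. \<forall>h\<in>L2 \<Omega>. (\<lambda>n. L2_inner \<Omega> (pd j (\<psi> n)) h) \<longlonglongrightarrow> L2_inner \<Omega> (G j) h)"
proof -
  obtain gp \<phi>p where p: "(\<lambda>x. upper (d x)) \<in> L2 \<Omega>" "\<And>j. gp j \<in> L2 \<Omega>" "\<And>j. weak_pd \<Omega> j (\<lambda>x. upper (d x)) (gp j)"
    "\<And>n. \<phi>p n \<in> test_functions \<Omega>" "(\<lambda>n. L2_norm \<Omega> (\<lambda>x. \<phi>p n x - upper (d x))) \<longlonglongrightarrow> 0"
    "\<And>j. (\<lambda>n. L2_norm \<Omega> (\<lambda>x. pd j (\<phi>p n) x - gp j x)) \<longlonglongrightarrow> 0"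
    using dp unfolding H10_def by auto
  obtain gm \<phi>m where m: "(\<lambda>x. lower (d x)) \<in> L2 \<Omega>" "\<And>j. gm j \<in> L2 \<Omega>" "\<And>j. weak_pd \<Omega> j (\<lambda>x. lower (d x)) (gm j)"
    "\<And>n. \<phi>m n \<in> test_functions \<Omega>" "(\<lambda>n. L2_norm \<Omega> (\<lambda>x. \<phi>m n x - lower (d x))) \<longlonglongrightarrow> 0"
    "\<And>j. (\<lambda>n. L2_norm \<Omega> (\<lambda>x. pd j (\<phi>m n) x - gm j x)) \<longlonglongrightarrow> 0"
    using dm unfolding H10_def by auto
  have conv: "(\<lambda>n. L2_inner \<Omega> (f n) h) \<longlonglongrightarrow> L2_inner \<Omega> g h"
    if "\<And>n. f n \<in> L2 \<Omega>" "g \<in> L2 \<Omega>" "h \<in> L2 \<Omega>" "(\<lambda>n. L2_norm \<Omega> (\<lambda>x. f n x - g x)) \<longlonglongrightarrow> 0"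
    for f :: "nat \<Rightarrow> real^3 \<Rightarrow> complex^2" and g h
  proof (rule L2_inner_tendsto[OF that(1-3)])
    have "(L2_norm \<Omega> (\<lambda>x. f n x - g x))\<^sup>2 = L2_inner \<Omega> (\<lambda>x. f n x - g x) (\<lambda>x. f n x - g x)" for n
      unfolding L2_norm_def L2_inner_self by simp
    then show "(\<lambda>n. L2_inner \<Omega> (\<lambda>x. f n x - g x) (\<lambda>x. f n x - g x)) \<longlonglongrightarrow> 0"
      using tendsto_power[OF that(4), of 2] by simp
  qed
  define G where "G j x = join (gp j x) (gm j x)" for j x
  define \<psi> where "\<psi> n x = join (\<phi>p n x) (\<phi>m n x)" for n x
  have dj: "d x = join (upper (d x)) (lower (d x))" for x by (rule spinor_eqI) simp_all
  have inner_join: "L2_inner \<Omega> (\<lambda>x. join (a x) (b x)) h = L2_inner \<Omega> a (upper \<circ> h) + L2_inner \<Omega> b (lower \<circ> h)"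
    if "a \<in> L2 \<Omega>" "b \<in> L2 \<Omega>" "h \<in> L2 \<Omega>" for a b h
    unfolding L2_inner_def
    using L2_inner_integrable[OF that(1) L2_upper[OF that(3)]] L2_inner_integrable[OF that(2) L2_lower[OF that(3)]]
    by (simp add: inner_spinor)
  have \<psi>: "\<psi> n \<in> test_functions \<Omega>" for n
    using test_add[OF test_linear[OF join_linear(1) p(4)[of n]] test_linear[OF join_linear(2) m(4)[of n]]]
    by (simp add: \<psi>_def[abs_def] join_sum[symmetric])
  have pd\<psi>: "pd j (\<psi> n) = (\<lambda>x. join (pd j (\<phi>p n) x) (pd j (\<phi>m n) x))" for j n
  proof
    fix x
    have "\<psi> n = (\<lambda>x. join (\<phi>p n x) 0 + join 0 (\<phi>m n x))" by (simp add: \<psi>_def[abs_def] join_sum[symmetric])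
    then have "pd j (\<psi> n) x = join (pd j (\<phi>p n) x) 0 + join 0 (pd j (\<phi>m n) x)"
      using pd_add[OF test_differentiable[OF test_linear[OF join_linear(1) p(4)[of n]]] test_differentiable[OF test_linear[OF join_linear(2) m(4)[of n]]]]
        pd_linear[OF join_linear(1) test_differentiable[OF p(4)[of n]]] pd_linear[OF join_linear(2) test_differentiable[OF m(4)[of n]]]
      by simp
    then show "pd j (\<psi> n) x = join (pd j (\<phi>p n) x) (pd j (\<phi>m n) x)" by (simp add: join_sum[symmetric])
  qed
  have dL: "d \<in> L2 \<Omega>" using L2_join[OF p(1) m(1)] by (simp add: dj[symmetric])
  have GL: "G j \<in> L2 \<Omega>" for j unfolding G_def[abs_def] by (rule L2_join[OF p(2) m(2)])
  show ?thesis
  proof (intro exI[of _ G] exI[of _ \<psi>] conjI allI ballI dL GL \<psi>)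
    fix j :: 3 and \<phi> :: "real^3 \<Rightarrow> real" assume \<phi>: "\<phi> \<in> test_functions \<Omega>"
    have i1: "integrable (lebesgue_on \<Omega>) (\<lambda>x. pd j \<phi> x *\<^sub>R d x)"
      and i2: "integrable (lebesgue_on \<Omega>) (\<lambda>x. \<phi> x *\<^sub>R G j x)"
      by (intro L2_integrable[OF \<Omega>] L2_scaleR_continuous[OF \<Omega>(1)] test_continuous[OF test_pd[OF \<phi>]] test_continuous[OF \<phi>] dL GL)+
    show "(LINT x|lebesgue_on \<Omega>. pd j \<phi> x *\<^sub>R d x) = - (LINT x|lebesgue_on \<Omega>. \<phi> x *\<^sub>R G j x)"
      using p(3)[of j] m(3)[of j] \<phi> 
        integral_bounded_linear[OF upper_linear i1] integral_bounded_linear[OF lower_linear i1]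
        integral_bounded_linear[OF upper_linear i2] integral_bounded_linear[OF lower_linear i2]
      by (intro spinor_eqI) (simp_all add: weak_pd_def G_def)
  next
    fix h :: "real^3 \<Rightarrow> complex^(2+2)" assume h: "h \<in> L2 \<Omega>"
    have "(\<lambda>n. L2_inner \<Omega> (\<phi>p n) (upper \<circ> h) + L2_inner \<Omega> (\<phi>m n) (lower \<circ> h)) \<longlonglongrightarrow>
        L2_inner \<Omega> (\<lambda>x. upper (d x)) (upper \<circ> h) + L2_inner \<Omega> (\<lambda>x. lower (d x)) (lower \<circ> h)"
      by (intro tendsto_add conv test_L2[OF \<Omega> p(4)] test_L2[OF \<Omega> m(4)] p(1,5) m(1,5) L2_upper[OF h] L2_lower[OF h])
    then show "(\<lambda>n. L2_inner \<Omega> (\<psi> n) h) \<longlonglongrightarrow> L2_inner \<Omega> d h"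
      using inner_join[OF test_L2[OF \<Omega> p(4)] test_L2[OF \<Omega> m(4)] h] inner_join[OF p(1) m(1) h]
      by (simp add: \<psi>_def[abs_def] dj[symmetric])
  next
    fix j and h :: "real^3 \<Rightarrow> complex^(2+2)" assume h: "h \<in> L2 \<Omega>"
    have "(\<lambda>n. L2_inner \<Omega> (pd j (\<phi>p n)) (upper \<circ> h) + L2_inner \<Omega> (pd j (\<phi>m n)) (lower \<circ> h)) \<longlonglongrightarrow>
        L2_inner \<Omega> (gp j) (upper \<circ> h) + L2_inner \<Omega> (gm j) (lower \<circ> h)"
      by (intro tendsto_add conv test_L2[OF \<Omega> test_pd[OF p(4)]] test_L2[OF \<Omega> test_pd[OF m(4)]] p(2,6) m(2,6) L2_upper[OF h] L2_lower[OF h])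
    then show "(\<lambda>n. L2_inner \<Omega> (pd j (\<psi> n)) h) \<longlonglongrightarrow> L2_inner \<Omega> (G j) h"
      using inner_join[OF test_L2[OF \<Omega> test_pd[OF p(4)]] test_L2[OF \<Omega> test_pd[OF m(4)]] h] inner_join[OF p(2) m(2) h]
      by (simp add: pd\<psi> G_def[abs_def])
  qed
qed

lemma L2_inner_i_alpha:
  "L2_inner \<Omega> (\<lambda>x. - (\<i> *s alpha a (f x))) h = L2_inner \<Omega> f (\<lambda>x. \<i> *s alpha a (h x))"
  unfolding L2_inner_def i_alpha_symmetric ..

lemma L2_inner_sum_left:
  assumes "finite I" "\<And>i. i \<in> I \<Longrightarrow> f i \<in> L2 \<Omega>" "h \<in> L2 \<Omega>"
  shows "L2_inner \<Omega> (\<lambda>x. \<Sum>i\<in>I. f i x) h = (\<Sum>i\<in>I. L2_inner \<Omega> (f i) h)"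
  unfolding L2_inner_def inner_sum_left
  by (rule Bochner_Integration.integral_sum) (rule L2_inner_integrable[OF assms(2,3)])

lemma L2_inner_add_left:
  assumes "f \<in> L2 \<Omega>" "g \<in> L2 \<Omega>" "h \<in> L2 \<Omega>"
  shows "L2_inner \<Omega> (\<lambda>x. f x + g x) h = L2_inner \<Omega> f h + L2_inner \<Omega> g h"
  using L2_inner_linear_combination[OF assms, of 1] by simp

lemma L2_inner_AE_zero:
  assumes "AE x in lebesgue_on \<Omega>. f x = 0" "f \<in> L2 \<Omega>" "h \<in> L2 \<Omega>"
  shows "L2_inner \<Omega> f h = 0"
proof -
  have "L2_inner \<Omega> f h = (LINT x|lebesgue_on \<Omega>. 0)"
    unfolding L2_inner_def
  proof (rule integral_cong_AE)
    show "(\<lambda>x. f x \<bullet> h x) \<in> borel_measurable (lebesgue_on \<Omega>)"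
      using L2_inner_integrable[OF assms(2,3)] by simp
    show "AE x in lebesgue_on \<Omega>. f x \<bullet> h x = 0"
      using assms(1) by eventually_elim simp
  qed simp
  then show ?thesis by simp
qed

text \<open>
  The difference of two solutions with the same Cauchy data is a limit of test functions in \<open>H\<^sup>1\<close>, so
  \<open>P\<^sub>0(D)\<close> may be moved from it onto any solution \<open>v\<close> without boundary terms.
\<close>

lemma integral_identity:
  assumes \<Omega>: "bounded \<Omega>" "open \<Omega>" and V1: "admissible \<Omega> M V\<^sub>1" and V2: "admissible \<Omega> M V\<^sub>2"
    and C: "cauchy_data \<Omega> V\<^sub>1 = cauchy_data \<Omega> V\<^sub>2"
    and u: "u \<in> L2 \<Omega>" and u_sol: "\<And>\<phi>. \<phi> \<in> test_functions \<Omega> \<Longrightarrow> dist_L \<Omega> V\<^sub>1 u \<phi> = 0"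
    and v: "v \<in> L2 \<Omega>" and v_sol: "\<And>\<phi>. \<phi> \<in> test_functions \<Omega> \<Longrightarrow> dist_L \<Omega> V\<^sub>2 v \<phi> = 0"
  shows "L2_inner \<Omega> (\<lambda>x. V\<^sub>1 x *v u x - V\<^sub>2 x *v u x) v = 0"
proof -
  have H: "upper \<circ> u \<in> H_space \<Omega>" "lower \<circ> u \<in> H_space \<Omega>"
    by (rule solution_in_H_space[OF \<Omega> V1 u u_sol]; assumption)+
  have "(trace \<Omega> (upper \<circ> u), trace \<Omega> (lower \<circ> u)) \<in> cauchy_data \<Omega> V\<^sub>1"
    unfolding cauchy_data_def using H u_sol by blast
  then obtain u2 where u2: "upper \<circ> u2 \<in> H_space \<Omega>" "lower \<circ> u2 \<in> H_space \<Omega>"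
    "\<And>\<phi>. \<phi> \<in> test_functions \<Omega> \<Longrightarrow> dist_L \<Omega> V\<^sub>2 u2 \<phi> = 0"
    "trace \<Omega> (upper \<circ> u) = trace \<Omega> (upper \<circ> u2)" "trace \<Omega> (lower \<circ> u) = trace \<Omega> (lower \<circ> u2)"
    unfolding C unfolding cauchy_data_def by blast
  have u2L: "u2 \<in> L2 \<Omega>"
  proof -
    have "(\<lambda>x. join (upper (u2 x)) (lower (u2 x))) \<in> L2 \<Omega>"
      by (rule L2_join) (use u2(1,2) in \<open>auto simp: H_space_def o_def\<close>)
    moreover have "(\<lambda>x. join (upper (u2 x)) (lower (u2 x))) = u2"
      by (rule ext, rule spinor_eqI) simp_all
    ultimately show ?thesis by simp
  qed
  define d where "d x = u x - u2 x" for x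
  have dH: "(\<lambda>x. upper (d x)) \<in> H10 \<Omega>" "(\<lambda>x. lower (d x)) \<in> H10 \<Omega>"
    using trace_eq_imp_H10[OF H(1) u2(4)] trace_eq_imp_H10[OF H(2) u2(5)] by (simp_all add: d_def)
  obtain G \<psi> where "d \<in> L2 \<Omega>" "\<forall>j. G j \<in> L2 \<Omega>" "\<forall>n. \<psi> n \<in> test_functions \<Omega>"
    "\<forall>j. \<forall>\<phi>\<in>test_functions \<Omega>. (LINT x|lebesgue_on \<Omega>. pd j \<phi> x *\<^sub>R d x) = - (LINT x|lebesgue_on \<Omega>. \<phi> x *\<^sub>R G j x)"
    "\<forall>h\<in>L2 \<Omega>. (\<lambda>n. L2_inner \<Omega> (\<psi> n) h) \<longlonglongrightarrow> L2_inner \<Omega> d h"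
    "\<forall>j. \<forall>h\<in>L2 \<Omega>. (\<lambda>n. L2_inner \<Omega> (pd j (\<psi> n)) h) \<longlonglongrightarrow> L2_inner \<Omega> (G j) h"
    using H10_spinor_approximation[OF \<Omega> dH] by (elim exE conjE)
  note G = this[rule_format]
  define P where "P x = (\<Sum>j\<in>UNIV. - (\<i> *s alpha (axis j 1) (G j x)))" for x
  have aL: "(\<lambda>x. - (\<i> *s alpha a (f x))) \<in> L2 \<Omega>" "(\<lambda>x. \<i> *s alpha a (f x)) \<in> L2 \<Omega>" if "f \<in> L2 \<Omega>" for a f
    using L2_bounded_linear[OF i_alpha_linear that]
      L2_bounded_linear[OF bounded_linear_compose[OF i_linear alpha_linear] that] by simp_all
  have PL: "P \<in> L2 \<Omega>" unfolding P_def[abs_def] by (intro L2_sum aL(1) G(2)) simp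
  have Vd: "(\<lambda>x. V\<^sub>2 x *v d x) \<in> L2 \<Omega>" by (rule admissible_L2[OF V2 G(1)])
  have Vu: "(\<lambda>x. V\<^sub>1 x *v u x) \<in> L2 \<Omega>" "(\<lambda>x. V\<^sub>2 x *v u x) \<in> L2 \<Omega>" "(\<lambda>x. V\<^sub>2 x *v u2 x) \<in> L2 \<Omega>"
    by (rule admissible_L2[OF V1 u] admissible_L2[OF V2 u] admissible_L2[OF V2 u2L])+
  \<comment> \<open>Testing the equation for \<open>v\<close> with \<open>\<psi> n\<close> and passing to the limit.\<close>
  have lim: "L2_inner \<Omega> P v + L2_inner \<Omega> (\<lambda>x. V\<^sub>2 x *v d x) v = 0"
  proof -
    have "\<forall>\<psi>\<in>test_functions \<Omega>. L2_inner \<Omega> (dirac_op V\<^sub>2 \<psi>) v = L2_inner \<Omega> \<psi> (\<lambda>x. 0)"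
      using v_sol by (subst weak_equation_iff[OF \<Omega> V2 v L2_zero, symmetric]) simp
    then have zero: "L2_inner \<Omega> (dirac_op V\<^sub>2 (\<psi> n)) v = 0" for n
      using G(3) by (simp add: L2_inner_def)
    have expand: "L2_inner \<Omega> (dirac_op V\<^sub>2 (\<psi> n)) v
      = (\<Sum>j\<in>UNIV. L2_inner \<Omega> (pd j (\<psi> n)) (\<lambda>x. \<i> *s alpha (axis j 1) (v x))) + L2_inner \<Omega> (\<psi> n) (\<lambda>x. V\<^sub>2 x *v v x)" for n
    proof -
      note pL = test_L2[OF \<Omega> test_pd[OF G(3)[of n]]]
      have "L2_inner \<Omega> (dirac_op V\<^sub>2 (\<psi> n)) v = L2_inner \<Omega> (dirac (\<psi> n)) v + L2_inner \<Omega> (\<lambda>x. V\<^sub>2 x *v \<psi> n x) v"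
        unfolding dirac_op_def[abs_def]
        by (rule L2_inner_add_left[OF dirac_L2[OF \<Omega> G(3)] admissible_L2[OF V2 test_L2[OF \<Omega> G(3)]] v])
      also have "L2_inner \<Omega> (dirac (\<psi> n)) v = (\<Sum>j\<in>UNIV. L2_inner \<Omega> (\<lambda>x. - (\<i> *s alpha (axis j 1) (pd j (\<psi> n) x))) v)"
        unfolding dirac_def[abs_def] by (rule L2_inner_sum_left) (auto intro: aL(1) pL v)
      finally show ?thesis unfolding L2_inner_i_alpha admissible_inner[OF V2] .
    qed
    have "(\<lambda>n. L2_inner \<Omega> (dirac_op V\<^sub>2 (\<psi> n)) v) \<longlonglongrightarrow>
      (\<Sum>j\<in>UNIV. L2_inner \<Omega> (G j) (\<lambda>x. \<i> *s alpha (axis j 1) (v x))) + L2_inner \<Omega> d (\<lambda>x. V\<^sub>2 x *v v x)"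
      unfolding expand by (intro tendsto_add tendsto_sum G(5,6) aL(2) v admissible_L2[OF V2 v])
    then have "(\<Sum>j\<in>UNIV. L2_inner \<Omega> (G j) (\<lambda>x. \<i> *s alpha (axis j 1) (v x))) + L2_inner \<Omega> d (\<lambda>x. V\<^sub>2 x *v v x) = 0"
      unfolding zero by (simp add: LIMSEQ_const_iff)
    moreover have "L2_inner \<Omega> P v = (\<Sum>j\<in>UNIV. L2_inner \<Omega> (\<lambda>x. - (\<i> *s alpha (axis j 1) (G j x))) v)"
      unfolding P_def[abs_def] by (rule L2_inner_sum_left) (auto intro: aL(1) G(2) v)
    ultimately show ?thesis unfolding L2_inner_i_alpha admissible_inner[OF V2] by simp
  qed
  \<comment> \<open>The equations for \<open>u\<close> and \<open>u2\<close> identify the weak value of \<open>P\<^sub>0(D) d\<close>.\<close>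
  define h where "h x = P x + (V\<^sub>1 x *v u x - V\<^sub>2 x *v u2 x)" for x
  have hL: "h \<in> L2 \<Omega>" unfolding h_def[abs_def] by (intro L2_add PL L2_diff Vu)
  have "AE x in lebesgue_on \<Omega>. h x = 0"
  proof (rule fundamental_lemma[OF \<Omega>(2) L2_integrable[OF \<Omega> hL]])
    fix \<phi> :: "real^3 \<Rightarrow> real" assume \<phi>: "\<phi> \<in> test_functions \<Omega>"
    note sc = L2_integrable[OF \<Omega> L2_scaleR_continuous[OF \<Omega>(1)]]
    have id: "integrable (lebesgue_on \<Omega>) (\<lambda>x. pd j \<phi> x *\<^sub>R f x)" if "f \<in> L2 \<Omega>" for j and f :: "real^3 \<Rightarrow> complex^(2+2)"
      by (rule sc[OF test_continuous[OF test_pd[OF \<phi>]] that])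
    have if': "integrable (lebesgue_on \<Omega>) (\<lambda>x. \<phi> x *\<^sub>R f x)" if "f \<in> L2 \<Omega>" for f :: "real^3 \<Rightarrow> complex^(2+2)"
      by (rule sc[OF test_continuous[OF \<phi>] that])
    have "dist_P0_D \<Omega> d \<phi> = dist_P0_D \<Omega> u \<phi> - dist_P0_D \<Omega> u2 \<phi>"
      unfolding dist_P0_D_def dist_D_def d_def
      using id[OF u] id[OF u2L]
      by (simp add: scaleR_diff_right vector_ssub_ldistrib matrix_vector_mult_diff_distrib sum_subtractf)
    also have "\<dots> = (LINT x|lebesgue_on \<Omega>. \<phi> x *\<^sub>R (V\<^sub>2 x *v u2 x)) - (LINT x|lebesgue_on \<Omega>. \<phi> x *\<^sub>R (V\<^sub>1 x *v u x))"
      using u_sol[OF \<phi>] u2(3)[OF \<phi>] unfolding dist_L_def by (simp add: add_eq_0_iff2)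
    finally have 1: "dist_P0_D \<Omega> d \<phi> = (LINT x|lebesgue_on \<Omega>. \<phi> x *\<^sub>R (V\<^sub>2 x *v u2 x)) - (LINT x|lebesgue_on \<Omega>. \<phi> x *\<^sub>R (V\<^sub>1 x *v u x))" .
    have "dist_P0_D \<Omega> d \<phi> = (\<Sum>j\<in>UNIV. - (\<i> *s alpha (axis j 1) (LINT x|lebesgue_on \<Omega>. \<phi> x *\<^sub>R G j x)))"
    proof -
      have "P0 (axis j 1) *v dist_D \<Omega> j d \<phi> = - (\<i> *s alpha (axis j 1) (LINT x|lebesgue_on \<Omega>. \<phi> x *\<^sub>R G j x))" for j
      proof -
        have "P0 (axis j 1) *v dist_D \<Omega> j d \<phi> = alpha (axis j 1) (\<i> *s - (LINT x|lebesgue_on \<Omega>. \<phi> x *\<^sub>R G j x))"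
          unfolding dist_D_def G(4)[OF \<phi>] by (simp add: alpha_def cvec_axis)
        then show ?thesis
          by (simp add: alpha_scale linear_neg[OF bounded_linear.linear[OF alpha_linear]] linear_neg[OF bounded_linear.linear[OF i_linear]])
      qed
      then show ?thesis unfolding dist_P0_D_def by simp
    qed
    also have "\<dots> = (\<Sum>j\<in>UNIV. (LINT x|lebesgue_on \<Omega>. - (\<i> *s alpha (axis j 1) (\<phi> x *\<^sub>R G j x))))"
      using integral_bounded_linear[OF i_alpha_linear if'[OF G(2)]] by simp
    also have "\<dots> = (LINT x|lebesgue_on \<Omega>. (\<Sum>j\<in>UNIV. - (\<i> *s alpha (axis j 1) (\<phi> x *\<^sub>R G j x))))"
      by (rule Bochner_Integration.integral_sum[symmetric]) (rule integrable_bounded_linear[OF i_alpha_linear if'[OF G(2)]])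
    also have "\<dots> = (LINT x|lebesgue_on \<Omega>. \<phi> x *\<^sub>R P x)"
      unfolding P_def linear_scale[OF bounded_linear.linear[OF i_alpha_linear]] scaleR_sum_right ..
    finally have 2: "dist_P0_D \<Omega> d \<phi> = (LINT x|lebesgue_on \<Omega>. \<phi> x *\<^sub>R P x)" .
    show "(LINT x|lebesgue_on \<Omega>. \<phi> x *\<^sub>R h x) = 0"
      using 1 2 if'[OF PL] if'[OF Vu(1)] if'[OF Vu(3)] by (simp add: h_def scaleR_add_right scaleR_diff_right)
  qed
  from L2_inner_AE_zero[OF this hL v]
  have "L2_inner \<Omega> P v + (L2_inner \<Omega> (\<lambda>x. V\<^sub>1 x *v u x) v - L2_inner \<Omega> (\<lambda>x. V\<^sub>2 x *v u2 x) v) = 0"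
    unfolding h_def[abs_def] L2_inner_add_left[OF PL L2_diff[OF Vu(1,3)] v] L2_inner_diff[OF Vu(1,3) v] .
  moreover have "L2_inner \<Omega> (\<lambda>x. V\<^sub>2 x *v d x) v = L2_inner \<Omega> (\<lambda>x. V\<^sub>2 x *v u x) v - L2_inner \<Omega> (\<lambda>x. V\<^sub>2 x *v u2 x) v"
    unfolding d_def matrix_vector_mult_diff_distrib by (rule L2_inner_diff[OF Vu(2,3) v])
  ultimately show ?thesis using lim unfolding L2_inner_diff[OF Vu(1,2) v] by linarith
qed

section \<open>Concentration at a boundary point\<close>

text \<open>
  On the dyadic shell where \<open>\<bar>z\<bar>\<close> is about \<open>2\<^sup>n\<close> the integrand is of order \<open>16\<^sup>-\<^sup>n\<close> and the volume of order
  \<open>8\<^sup>n\<close>.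
\<close>

lemma inverse_fourth_power_integrable:
  "integrable lborel (\<lambda>z :: real^3. indicator {z. 1 / 2 \<le> norm z} z * (1 / norm z ^ 4) :: real)" (is "integrable lborel ?f")
proof (rule integrableI_bounded)
  show "?f \<in> borel_measurable lborel" by measurable
  define v where "v = unit_ball_vol 3"
  have v: "0 \<le> v" unfolding v_def by (simp add: less_imp_le)
  have single: "a n \<le> (\<Sum>n. a n)" for a :: "nat \<Rightarrow> ennreal" and n
    using sum_le_suminf[of a "{n}"] by simp
  let ?g = "\<lambda>n. \<lambda>z :: real^3. ennreal (16 / 16 ^ n) * indicator (ball 0 (2 ^ n)) z"
  have "(\<integral>\<^sup>+z. ennreal (norm (?f z)) \<partial>lborel) \<le> (\<integral>\<^sup>+z. (\<Sum>n. ?g n z) \<partial>lborel)"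
  proof (rule nn_integral_mono)
    fix z :: "real^3"
    show "ennreal (norm (?f z)) \<le> (\<Sum>n. ?g n z)"
    proof (cases "1 / 2 \<le> norm z")
      case True
      define n where "n = (LEAST n. norm z < 2 ^ n)"
      obtain m where "norm z < 2 ^ m" using real_arch_pow[of 2 "norm z"] by auto
      then have n: "norm z < 2 ^ n" unfolding n_def by (rule LeastI)
      have "2 ^ n / 2 \<le> norm z"
      proof (cases n)
        case 0
        then show ?thesis using True by simp
      next
        case (Suc k)
        then have "\<not> norm z < 2 ^ k" using not_less_Least[of k "\<lambda>n. norm z < 2 ^ n"] by (simp add: n_def)
        then show ?thesis using Suc by simp
      qed
      then have "(2 ^ n / 2) ^ 4 \<le> norm z ^ 4" by (rule power_mono) simp
      moreover have "(2 ^ n / 2 :: real) ^ 4 = 16 ^ n / 16"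
        by (simp add: power_divide power_mult[symmetric] mult.commute[of n]) (simp add: power_mult)
      ultimately have "16 ^ n / 16 \<le> norm z ^ 4" by simp
      moreover have "0 < norm z ^ 4" using True by (intro zero_less_power) linarith
      ultimately have "1 / norm z ^ 4 \<le> 16 / 16 ^ n" by (simp add: field_simps)
      then have "ennreal (norm (?f z)) \<le> ?g n z" using True n by (simp add: ennreal_leI)
      also have "\<dots> \<le> (\<Sum>n. ?g n z)" by (rule single)
      finally show ?thesis .
    qed simp
  qed
  also have "\<dots> = (\<Sum>n. \<integral>\<^sup>+z. ?g n z \<partial>lborel)" 
    by (intro nn_integral_suminf borel_measurable_times_ennreal borel_measurable_const borel_measurable_indicator) simp
  also have "\<dots> = (\<Sum>n. ennreal (16 * v * (1 / 2) ^ n))"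
  proof (rule suminf_cong)
    fix n
    have "(\<integral>\<^sup>+z. ?g n z \<partial>lborel) = ennreal (16 / 16 ^ n) * emeasure lborel (ball (0 :: real^3) (2 ^ n))"
      by (rule nn_integral_cmult_indicator) simp
    also have "\<dots> = ennreal (16 / 16 ^ n * (v * (2 ^ n) ^ 3))"
      by (simp add: emeasure_ball v_def ennreal_mult[symmetric])
    also have "16 / 16 ^ n * (v * (2 ^ n) ^ 3) = 16 * v * (1 / 2) ^ n"
    proof -
      have "(2 ^ n :: real) ^ 3 = 8 ^ n" by (simp add: power_mult[symmetric] mult.commute[of n]) (simp add: power_mult)
      moreover have "(16 :: real) ^ n = 8 ^ n * 2 ^ n" by (simp add: power_mult_distrib[symmetric])
      ultimately show ?thesis by (simp add: power_divide field_simps)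
    qed
    finally show "(\<integral>\<^sup>+z. ?g n z \<partial>lborel) = ennreal (16 * v * (1 / 2) ^ n)" .
  qed
  also have "\<dots> < \<infinity>"
  proof -
    have "summable (\<lambda>n. 16 * v * (1 / 2 :: real) ^ n)" by (intro summable_mult summable_geometric) simp
    then have "(\<Sum>n. ennreal (16 * v * (1 / 2) ^ n)) = ennreal (\<Sum>n. 16 * v * (1 / 2) ^ n)"
      using v by (intro suminf_ennreal2) auto
    then show ?thesis by simp
  qed
  finally show "(\<integral>\<^sup>+z. ennreal (norm (?f z)) \<partial>lborel) < \<infinity>" .
qed

lemma integral_lebesgue_affine:
  fixes f :: "real^3 \<Rightarrow> real"
  assumes f: "f \<in> borel_measurable lebesgue" and c: "0 < c"
  shows "(LINT x|lebesgue. f x) = c ^ 3 * (LINT z|lebesgue. f (t + c *\<^sub>R z))"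
    and "(\<lambda>z. f (t + c *\<^sub>R z)) \<in> borel_measurable lebesgue"
proof -
  have T: "(\<lambda>x :: real^3. t + (\<Sum>j\<in>Basis. (c * (x \<bullet> j)) *\<^sub>R j)) = (\<lambda>x. t + c *\<^sub>R x)"
    unfolding scaleR_scaleR[symmetric] scaleR_sum_right[symmetric] euclidean_representation ..
  have leb: "(lebesgue :: (real^3) measure) = density (distr lebesgue lebesgue (\<lambda>x. t + c *\<^sub>R x)) (\<lambda>_. ennreal (c ^ 3))"
    and m: "(\<lambda>x :: real^3. t + c *\<^sub>R x) \<in> lebesgue \<rightarrow>\<^sub>M lebesgue"
    using lebesgue_affine_euclidean[where c="\<lambda>_ :: real^3. c" and t=t] lebesgue_affine_measurable[where c="\<lambda>_ :: real^3. c" and t=t] c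
    unfolding T by (simp_all add: prod_constant ennreal_power)
  show "(\<lambda>z. f (t + c *\<^sub>R z)) \<in> borel_measurable lebesgue" by (rule measurable_compose[OF m f])
  have "(LINT x|lebesgue. f x) = (LINT x|density (distr lebesgue lebesgue (\<lambda>x. t + c *\<^sub>R x)) (\<lambda>_. ennreal (c ^ 3)). f x)"
    by (subst leb) simp
  also have "\<dots> = (LINT x|distr lebesgue lebesgue (\<lambda>x. t + c *\<^sub>R x). c ^ 3 *\<^sub>R f x)"
    by (rule integral_density) (use f c in auto)
  also have "\<dots> = (LINT z|lebesgue. c ^ 3 *\<^sub>R f (t + c *\<^sub>R z))"
    by (rule integral_distr[OF m]) (use f in auto)
  finally show "(LINT x|lebesgue. f x) = c ^ 3 * (LINT z|lebesgue. f (t + c *\<^sub>R z))" by simp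
qed

text \<open>
  Near \<open>p\<close> the domain is the set \<open>F < 0\<close> with \<open>F x = \<gamma> (horiz (T x)) - T x $ 3\<close>, whose gradient at \<open>p\<close> is
  a multiple \<open>s n\<close> with \<open>s \<ge> 1\<close>. A point \<open>x\<close> within \<open>\<delta> / 2\<close> of the pole has \<open>(x - p) \<bullet> n \<ge> \<delta> / 2\<close> and
  \<open>\<bar>x - p\<bar> \<le> 3 \<delta> / 2\<close>, so linearising with error at most \<open>\<bar>x - p\<bar> / 4\<close> gives \<open>F x \<ge> \<delta> / 2 - 3 \<delta> / 8 > 0\<close>.
\<close>

lemma exterior_cone:
  assumes chart: "C1_chart \<Omega> p T r \<gamma> G" and p: "p \<notin> \<Omega>" and n: "chart_normal p T G n"
    and norm_n: "norm n = 1"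
  shows "\<exists>d>0. \<forall>\<delta>. 0 < \<delta> \<longrightarrow> \<delta> < d \<longrightarrow> (\<forall>x\<in>\<Omega>. \<delta> / 2 \<le> norm (x - (p + \<delta> *\<^sub>R n)))"
proof -
  define g where "g = G (horiz (T p))"
  define s where "s = sqrt (1 + (norm g)\<^sup>2)"
  define F where "F x = \<gamma> (horiz (T x)) - T x $ 3" for x
  have T: "orthogonal_transformation T" and r: "0 < r"
    and \<gamma>: "\<And>y. (\<gamma> has_derivative (\<lambda>h. G y \<bullet> h)) (at y)"
    and \<Omega>: "\<Omega> \<inter> ball p r = {x \<in> ball p r. \<gamma> (horiz (T x)) < T x $ 3}"
    using chart unfolding C1_chart_def by auto
  have s: "1 \<le> s" unfolding s_def by simp
  have Tn: "T n = (1 / s) *\<^sub>R vector [g $ 1, g $ 2, - 1]"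
    using n unfolding chart_normal_def g_def s_def Let_def by simp
  have lin: "linear T" using T by (rule orthogonal_transformation_linear)
  have hl: "linear horiz" by (rule linearI) (simp_all add: horiz_def vec_eq_iff forall_2)
  have blT: "bounded_linear T" and blh: "bounded_linear (\<lambda>x. horiz (T x))"
    using lin linear_compose[OF lin hl] by (simp_all add: linear_conv_bounded_linear o_def)
  have in\<Omega>: "F x < 0" if "x \<in> \<Omega>" "x \<in> ball p r" for x
  proof -
    have "x \<in> {x \<in> ball p r. \<gamma> (horiz (T x)) < T x $ 3}" using that \<Omega> by blast
    then show ?thesis by (simp add: F_def)
  qed
  have Fp: "0 \<le> F p"
  proof (rule ccontr)
    assume "\<not> 0 \<le> F p"
    then have "p \<in> {x \<in> ball p r. \<gamma> (horiz (T x)) < T x $ 3}" using r by (simp add: F_def)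
    then show False using \<Omega> p by blast
  qed
  have eq: "g \<bullet> horiz (T v) - T v $ 3 = s * (v \<bullet> n)" for v
  proof -
    have "v \<bullet> n = T v \<bullet> T n" using T unfolding orthogonal_transformation_def by simp
    then have "s * (v \<bullet> n) = T v \<bullet> vector [g $ 1, g $ 2, - 1]" using s by (simp add: Tn)
    also have "\<dots> = g \<bullet> horiz (T v) - T v $ 3"
      by (simp add: inner_vec_def sum_2 sum_3 horiz_def algebra_simps)
    finally show ?thesis by simp
  qed
  have "((\<lambda>x. \<gamma> (horiz (T x))) has_derivative (\<lambda>v. g \<bullet> horiz (T v))) (at p)"
    unfolding g_def by (rule has_derivative_compose[OF bounded_linear_imp_has_derivative[OF blh] \<gamma>])
  moreover have "((\<lambda>x. T x $ 3) has_derivative (\<lambda>v. T v $ 3)) (at p)"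
    by (rule bounded_linear_imp_has_derivative[OF bounded_linear_compose[OF bounded_linear_vec_nth blT]])
  ultimately have D: "(F has_derivative (\<lambda>v. s * (v \<bullet> n))) (at p)"
    unfolding F_def[abs_def] eq[symmetric] by (rule has_derivative_diff)
  obtain d where d: "0 < d" "\<And>x. norm (x - p) < d \<Longrightarrow> norm (F x - F p - s * ((x - p) \<bullet> n)) \<le> (1 / 4) * norm (x - p)"
    using D[unfolded has_derivative_at_alt, THEN conjunct2, rule_format, of "1 / 4"] by auto
  show ?thesis
  proof (intro exI[of _ "min d r / 2"] conjI allI impI ballI)
    show "0 < min d r / 2" using d(1) r by simp
    fix \<delta> x assume \<delta>: "0 < \<delta>" "\<delta> < min d r / 2" and x: "x \<in> \<Omega>"
    show "\<delta> / 2 \<le> norm (x - (p + \<delta> *\<^sub>R n))"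
    proof (rule ccontr)
      assume c: "\<not> \<delta> / 2 \<le> norm (x - (p + \<delta> *\<^sub>R n))"
      define w where "w = x - (p + \<delta> *\<^sub>R n)"
      have w: "norm w < \<delta> / 2" "x - p = \<delta> *\<^sub>R n + w" using c by (simp_all add: w_def)
      have nn: "n \<bullet> n = 1" using norm_n by (simp add: norm_eq_1)
      have "\<bar>w \<bullet> n\<bar> \<le> norm w * norm n" by (rule Cauchy_Schwarz_ineq2)
      then have 1: "\<delta> / 2 \<le> (x - p) \<bullet> n"
        unfolding w(2) using w(1) nn norm_n by (simp add: inner_add_left)
      have 2: "norm (x - p) \<le> 3 / 2 * \<delta>"
        unfolding w(2) using norm_triangle_ineq[of "\<delta> *\<^sub>R n" w] w(1) norm_n \<delta>(1) by simp
      then have 3: "norm (x - p) < d" "x \<in> ball p r"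
        using \<delta> by (simp_all add: dist_norm norm_minus_commute)
      have 4: "(x - p) \<bullet> n \<le> s * ((x - p) \<bullet> n)"
        using mult_right_mono[OF s, of "(x - p) \<bullet> n"] 1 \<delta>(1) by simp
      have "F x < 0" by (rule in\<Omega>[OF x 3(2)])
      moreover have "\<bar>F x - F p - s * ((x - p) \<bullet> n)\<bar> \<le> (1 / 4) * norm (x - p)" using d(2)[OF 3(1)] by simp
      ultimately show False using Fp 1 2 4 \<delta>(1) by linarith
    qed
  qed
qed

lemma half_space_integrable:
  fixes h :: "real^3 \<Rightarrow> real"
  assumes n: "norm n = 1" and h: "h \<in> borel_measurable borel" "\<And>z. \<bar>h z\<bar> \<le> K / norm z ^ 4"
  shows "integrable lborel (\<lambda>z. indicator {z. z \<bullet> n < -1} z * h z)"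
proof (rule Bochner_Integration.integrable_bound[OF integrable_mult_right[OF inverse_fourth_power_integrable, of K]], goal_cases)
  case 1
  show ?case using h(1) by measurable
next
  case 2
  show ?case
  proof (rule AE_I2)
    fix z
    have "0 \<le> K"
      using order_trans[OF abs_ge_zero h(2)[of n]] n by simp
    moreover have "1 / 2 \<le> norm z" if "z \<bullet> n < -1"
      using Cauchy_Schwarz_ineq2[of z n] that n by simp
    ultimately show "norm (indicator {z. z \<bullet> n < -1} z * h z) \<le> norm (K * (indicator {z. 1 / 2 \<le> norm z} z * (1 / norm z ^ 4)))"
      using h(2)[of z] by (auto simp: indicator_def abs_mult)
  qed
qed

text \<open>
  Let \<open>h\<close> be homogeneous of degree \<open>-4\<close>. Rescaling by \<open>\<delta>\<close> around the pole \<open>p + \<delta> n\<close> turns the domain into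
  the half space \<open>z \<bullet> n < -1\<close> in the limit. The pole has distance at least \<open>\<delta> / 2\<close> from the domain, so the
  rescaled integrands live on \<open>1 / 2 \<le> \<bar>z\<bar>\<close>, where \<open>\<bar>z\<bar>\<^sup>-\<^sup>4\<close> is an integrable majorant.
\<close>

lemma concentration_limit:
  fixes h G :: "real^3 \<Rightarrow> real"
  assumes \<Omega>: "bounded \<Omega>" "open \<Omega>" and p: "p \<in> closure \<Omega>" and n: "norm n = 1"
    and inside: "\<And>v. v \<bullet> n < 0 \<Longrightarrow> \<exists>d>0. \<forall>t. 0 < t \<and> t < d \<longrightarrow> p + t *\<^sub>R v \<in> \<Omega>"
    and outside: "\<And>v. v \<bullet> n > 0 \<Longrightarrow> \<exists>d>0. \<forall>t. 0 < t \<and> t < d \<longrightarrow> p + t *\<^sub>R v \<notin> \<Omega>"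
    and h: "h \<in> borel_measurable borel" "\<And>z. \<bar>h z\<bar> \<le> K / norm z ^ 4"
      "\<And>c z. 0 < c \<Longrightarrow> h (c *\<^sub>R z) = h z / c ^ 4"
    and G: "continuous_on (closure \<Omega>) G"
    and \<delta>: "\<And>k. 0 < \<delta> k" "\<delta> \<longlonglongrightarrow> 0" "\<And>k x. x \<in> \<Omega> \<Longrightarrow> \<delta> k / 2 \<le> norm (x - (p + \<delta> k *\<^sub>R n))"
  shows "(\<lambda>k. \<delta> k * (LINT x|lebesgue_on \<Omega>. G x * h (x - (p + \<delta> k *\<^sub>R n)))) \<longlonglongrightarrow>
      G p * (LINT z|lebesgue. indicator {z. z \<bullet> n < -1} z * h z)"
proof -
  let ?f = "\<lambda>z :: real^3. indicator {z. 1 / 2 \<le> norm z} z * (1 / norm z ^ 4) :: real"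
  have fi: "integrable lebesgue ?f"
    using inverse_fourth_power_integrable by (subst integrable_completion) (auto intro: borel_measurable_integrable)
  have hm: "h \<in> borel_measurable lebesgue" using h(1) by (intro measurable_completion) simp
  have K: "0 \<le> K"
  proof -
    have "0 \<le> \<bar>h n\<bar>" by simp
    also have "\<dots> \<le> K" using h(2)[of n] n by simp
    finally show ?thesis .
  qed
  have hf: "\<bar>h z\<bar> \<le> K * ?f z" if "1 / 2 \<le> norm z" for z
    using h(2)[of z] that by simp
  have hs: "{z. z \<bullet> n < -1} \<in> sets lebesgue"
    using open_Collect_less[of "\<lambda>z. z \<bullet> n" "\<lambda>_. -1"] by (simp add: borel_open continuous_intros)
  have lm: "(\<lambda>z. indicator {z. z \<bullet> n < -1} z * h z) \<in> borel_measurable lebesgue"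
    using hs hm by (intro borel_measurable_times borel_measurable_indicator)
  have "compact (G ` closure \<Omega>)" using \<Omega>(1) G by (intro compact_continuous_image) (auto simp: compact_closure)
  then obtain B0 where B0: "\<forall>y\<in>G ` closure \<Omega>. norm y \<le> B0"
    using compact_imp_bounded bounded_iff by metis
  define B where "B = max B0 0"
  have B: "0 \<le> B" "\<And>x. x \<in> \<Omega> \<Longrightarrow> \<bar>G x\<bar> \<le> B"
    using B0 closure_subset[of \<Omega>] by (auto simp: B_def le_max_iff_disj)
  have m\<Omega>: "\<Omega> \<in> sets lebesgue" using \<Omega>(2) by (simp add: borel_open)
  define GI where "GI x = indicator \<Omega> x * G x" for x
  have "G \<in> borel_measurable (lebesgue_on \<Omega>)"
    by (rule continuous_imp_measurable_on_sets_lebesgue[OF continuous_on_subset[OF G closure_subset] m\<Omega>])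
  then have GI: "GI \<in> borel_measurable lebesgue"
    using m\<Omega> by (simp add: borel_measurable_restrict_space_iff GI_def[abs_def])
  have GIB: "\<bar>GI x\<bar> \<le> B" for x using B by (auto simp: GI_def indicator_def)
  define y where "y k = p + \<delta> k *\<^sub>R n" for k
  have scale: "\<delta> k * (LINT x|lebesgue_on \<Omega>. G x * h (x - y k)) = (LINT z|lebesgue. GI (y k + \<delta> k *\<^sub>R z) * h z)"
    and meas: "(\<lambda>z. GI (y k + \<delta> k *\<^sub>R z) * h z) \<in> borel_measurable lebesgue" for k
  proof -
    have hy: "(\<lambda>x. h (x - y k)) \<in> borel_measurable lebesgue"
      by (intro measurable_completion) (use h(1) in simp)
    have m: "(\<lambda>x. GI x * h (x - y k)) \<in> borel_measurable lebesgue" using GI hy by (rule borel_measurable_times)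
    have "(LINT x|lebesgue_on \<Omega>. G x * h (x - y k)) = (LINT x|lebesgue. GI x * h (x - y k))"
      using m\<Omega> by (simp add: integral_restrict_space GI_def mult.assoc)
    also have "\<dots> = \<delta> k ^ 3 * (LINT z|lebesgue. GI (y k + \<delta> k *\<^sub>R z) * h (\<delta> k *\<^sub>R z))"
      using integral_lebesgue_affine(1)[OF m \<delta>(1), of k "y k"] by simp
    also have "\<dots> = \<delta> k ^ 3 * (LINT z|lebesgue. (GI (y k + \<delta> k *\<^sub>R z) * h z) * (1 / \<delta> k ^ 4))"
      by (simp add: h(3)[OF \<delta>(1)])
    also have "\<dots> = \<delta> k ^ 3 * ((LINT z|lebesgue. GI (y k + \<delta> k *\<^sub>R z) * h z) * (1 / \<delta> k ^ 4))"
      by (simp only: integral_mult_left_zero)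
    finally show "\<delta> k * (LINT x|lebesgue_on \<Omega>. G x * h (x - y k)) = (LINT z|lebesgue. GI (y k + \<delta> k *\<^sub>R z) * h z)"
      using \<delta>(1)[of k] by (simp add: power_numeral_reduce)
    show "(\<lambda>z. GI (y k + \<delta> k *\<^sub>R z) * h z) \<in> borel_measurable lebesgue"
      by (rule borel_measurable_times[OF integral_lebesgue_affine(2)[OF GI \<delta>(1)] hm])
  qed
  have "(\<lambda>k. LINT z|lebesgue. GI (y k + \<delta> k *\<^sub>R z) * h z) \<longlonglongrightarrow> (LINT z|lebesgue. G p * (indicator {z. z \<bullet> n < -1} z * h z))"
  proof (rule integral_dominated_convergence)
    show "(\<lambda>z. G p * (indicator {z. z \<bullet> n < -1} z * h z)) \<in> borel_measurable lebesgue"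
      by (rule borel_measurable_times[OF borel_measurable_const lm])
    show "(\<lambda>z. GI (y k + \<delta> k *\<^sub>R z) * h z) \<in> borel_measurable lebesgue" for k by (rule meas)
    show "integrable lebesgue (\<lambda>z. B * (K * ?f z))" by (intro integrable_mult_right fi)
    show "AE z in lebesgue. norm (GI (y k + \<delta> k *\<^sub>R z) * h z) \<le> B * (K * ?f z)" for k
    proof (rule AE_I2)
      fix z
      show "norm (GI (y k + \<delta> k *\<^sub>R z) * h z) \<le> B * (K * ?f z)"
      proof (cases "y k + \<delta> k *\<^sub>R z \<in> \<Omega>")
        case True
        have "\<delta> k * (1 / 2) \<le> \<delta> k * norm z" using \<delta>(3)[OF True, of k] \<delta>(1)[of k] by (simp add: y_def)
        then have "1 / 2 \<le> norm z" using \<delta>(1)[of k] by (simp only: mult_le_cancel_left_pos)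
        from mult_mono[OF GIB hf[OF this] B(1) abs_ge_zero] show ?thesis
          by (simp only: real_norm_def abs_mult)
      next
        case False
        then show ?thesis using B(1) K by (simp add: GI_def)
      qed
    qed
    have neg: "negligible {z. n \<bullet> z = -1}"
      by (rule negligible_hyperplane) (use n in auto)
    have "AE z in lebesgue. z \<bullet> n \<noteq> -1"
      using neg by (intro AE_I'[of "{z. n \<bullet> z = -1}"]) (auto simp: negligible_iff_null_sets inner_commute)
    then show "AE z in lebesgue. (\<lambda>k. GI (y k + \<delta> k *\<^sub>R z) * h z) \<longlonglongrightarrow> G p * (indicator {z. z \<bullet> n < -1} z * h z)"
    proof eventually_elim
      case (elim z)
      have yz: "y k + \<delta> k *\<^sub>R z = p + \<delta> k *\<^sub>R (n + z)" for k by (simp add: y_def scaleR_add_right)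
      have nn: "(n + z) \<bullet> n = 1 + z \<bullet> n" using n by (simp add: inner_add_left norm_eq_1)
      have ev: "\<forall>\<^sub>F k in sequentially. \<delta> k < d" if "0 < d" for d
        using order_tendstoD(2)[OF \<delta>(2) that] .
      show ?case
      proof (cases "z \<bullet> n < -1")
        case True
        then have "(n + z) \<bullet> n < 0" using nn by simp
        then obtain d where d: "d > 0" "\<And>t. 0 < t \<and> t < d \<Longrightarrow> p + t *\<^sub>R (n + z) \<in> \<Omega>" using inside by blast
        have in\<Omega>: "\<forall>\<^sub>F k in sequentially. p + \<delta> k *\<^sub>R (n + z) \<in> \<Omega>"
          using ev[OF d(1)] by eventually_elim (use d(2) \<delta>(1) in blast)
        have "(\<lambda>k. p + \<delta> k *\<^sub>R (n + z)) \<longlonglongrightarrow> p + 0 *\<^sub>R (n + z)"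
          by (intro tendsto_add tendsto_const tendsto_scaleR \<delta>(2))
        then have t: "(\<lambda>k. p + \<delta> k *\<^sub>R (n + z)) \<longlonglongrightarrow> p" by simp
        have "(\<lambda>k. G (p + \<delta> k *\<^sub>R (n + z))) \<longlonglongrightarrow> G p"
          by (rule continuous_on_tendsto_compose[OF G t p])
            (rule eventually_mono[OF in\<Omega>], rule subsetD[OF closure_subset])
        then have "(\<lambda>k. GI (p + \<delta> k *\<^sub>R (n + z))) \<longlonglongrightarrow> G p"
          by (rule Lim_transform_eventually) (rule eventually_mono[OF in\<Omega>], simp add: GI_def)
        then have "(\<lambda>k. GI (p + \<delta> k *\<^sub>R (n + z)) * h z) \<longlonglongrightarrow> G p * h z"
          by (rule tendsto_mult_right)
        then show ?thesis using True by (simp add: yz)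
      next
        case False
        then have "(n + z) \<bullet> n > 0" using nn elim by simp
        then obtain d where d: "d > 0" "\<And>t. 0 < t \<and> t < d \<Longrightarrow> p + t *\<^sub>R (n + z) \<notin> \<Omega>" using outside by blast
        have out: "\<forall>\<^sub>F k in sequentially. p + \<delta> k *\<^sub>R (n + z) \<notin> \<Omega>"
          using ev[OF d(1)] by eventually_elim (use d(2) \<delta>(1) in blast)
        have "(\<lambda>k. GI (y k + \<delta> k *\<^sub>R z) * h z) \<longlonglongrightarrow> 0"
          by (rule tendsto_eventually) (rule eventually_mono[OF out], simp add: GI_def yz)
        then show ?thesis using False by simp
      qed
    qed
  qed
  then show "(\<lambda>k. \<delta> k * (LINT x|lebesgue_on \<Omega>. G x * h (x - (p + \<delta> k *\<^sub>R n)))) \<longlonglongrightarrow>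
      G p * (LINT z|lebesgue. indicator {z. z \<bullet> n < -1} z * h z)"
    unfolding scale[unfolded y_def] y_def by simp
qed

section \<open>Singular free solutions\<close>

text \<open>The fundamental solution of \<open>\<sigma> \<cdot> D\<close>, up to a constant, applied to the spinor \<open>c\<close>.\<close>

definition weyl :: "complex^2 \<Rightarrow> real^3 \<Rightarrow> complex^2" where
  "weyl c z = (1 / norm z ^ 3) *\<^sub>R sigma_vec z c"

text \<open>
  The partial derivatives of \<open>weyl c\<close>, given by a formula so that continuity can be read off.
\<close>

definition weyl_pd :: "complex^2 \<Rightarrow> 3 \<Rightarrow> real^3 \<Rightarrow> complex^2" where
  "weyl_pd c j z = (1 / norm z ^ 3) *\<^sub>R sigma_vec (axis j 1) c - (3 * z $ j / norm z ^ 5) *\<^sub>R sigma_vec z c"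

lemma bounded_linear_sigma_vector: "bounded_linear (\<lambda>z. sigma_vec z c)"
  unfolding linear_conv_bounded_linear[symmetric] by (rule linearI) (simp_all add: sigma_linear_vector)

lemma norm_weyl: "norm (weyl c z) = norm c / norm z ^ 2"
  by (cases "z = 0") (simp_all add: weyl_def norm_sigma sigma_linear_vector power2_eq_square power3_eq_cube)

lemma weyl_derivative:
  assumes "z \<noteq> 0"
  shows "((\<lambda>t. weyl c (z + t *\<^sub>R axis j 1)) has_vector_derivative weyl_pd c j z) (at 0)"
proof -
  let ?e = "axis j 1 :: real^3"
  define q where "q t = z \<bullet> z + 2 * t * z $ j + t\<^sup>2" for t :: real
  have nq: "norm (z + t *\<^sub>R ?e) = sqrt (q t)" for t
    unfolding norm_eq_sqrt_inner q_def
    by (simp add: inner_simps inner_axis inner_axis' inner_commute power2_eq_square algebra_simps)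
  have q0: "sqrt (q 0) = norm z" "0 < q 0" using assms by (simp_all add: q_def norm_eq_sqrt_inner)
  have nz: "norm z \<noteq> 0" using assms by simp
  have "(q has_real_derivative 2 * z $ j) (at 0)"
    unfolding q_def[abs_def] by (auto intro!: derivative_eq_intros)
  from DERIV_chain2[OF DERIV_real_sqrt[OF q0(2)] this]
  have "((\<lambda>t. norm (z + t *\<^sub>R ?e)) has_real_derivative z $ j / norm z) (at 0)"
    unfolding nq using q0(1) by (simp add: field_simps)
  from DERIV_inverse_fun[OF DERIV_power[OF this, of 3]] nz
  have 1: "((\<lambda>t. 1 / norm (z + t *\<^sub>R ?e) ^ 3) has_real_derivative - (3 * z $ j / norm z ^ 5)) (at 0)"
    by (simp add: inverse_eq_divide field_simps power_numeral_reduce)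
  have 2: "((\<lambda>t. sigma_vec (z + t *\<^sub>R ?e) c) has_vector_derivative sigma_vec ?e c) (at 0)"
    unfolding sigma_linear_vector by (auto intro!: derivative_eq_intros simp: has_vector_derivative_def)
  from has_vector_derivative_scaleR[OF 1 2] show ?thesis
    by (simp add: weyl_def[abs_def] weyl_pd_def)
qed

lemma sigma_sum_axis: "(\<Sum>j\<in>UNIV. (z $ j) *\<^sub>R sigma_vec (axis j 1) w) = sigma_vec z w"
  by (simp add: sum_3 vec_eq_iff forall_2 sigma_1 sigma_2 axis_def complex_eq_iff algebra_simps)

text \<open>
  The first terms of the derivatives contribute \<open>3 c / \<bar>z\<bar>\<^sup>3\<close> by \<open>\<sigma>\<^sub>j\<^sup>2 = 1\<close>, and the second ones cancel this by
  \<open>(\<sigma> \<cdot> z)\<^sup>2 = \<bar>z\<bar>\<^sup>2\<close>.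
\<close>

lemma weyl_equation:
  assumes "z \<noteq> 0"
  shows "(\<Sum>j\<in>UNIV. sigma_vec (axis j 1) (weyl_pd c j z)) = 0"
proof -
  note lin = bounded_linear.linear[OF sigma_linear]
  have "(\<Sum>j\<in>UNIV. sigma_vec (axis j 1) (weyl_pd c j z))
    = (1 / norm z ^ 3) *\<^sub>R (\<Sum>j\<in>UNIV. sigma_vec (axis j 1) (sigma_vec (axis j 1) c))
      - (3 / norm z ^ 5) *\<^sub>R (\<Sum>j\<in>UNIV. (z $ j) *\<^sub>R sigma_vec (axis j 1) (sigma_vec z c))"
    unfolding weyl_pd_def linear_diff[OF lin] linear_scale[OF lin] sum_subtractf scaleR_sum_right by simp
  also have "(\<Sum>j\<in>(UNIV::3 set). sigma_vec (axis j 1) (sigma_vec (axis j 1) c)) = 3 *\<^sub>R c"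
    unfolding sigma_square sum_3 by (simp add: inner_axis_axis vec_eq_iff complex_eq_iff)
  also have "(\<Sum>j\<in>UNIV. (z $ j) *\<^sub>R sigma_vec (axis j 1) (sigma_vec z c)) = (z \<bullet> z) *\<^sub>R c"
    unfolding sigma_sum_axis sigma_square ..
  also have "(1 / norm z ^ 3) *\<^sub>R 3 *\<^sub>R c - (3 / norm z ^ 5) *\<^sub>R (z \<bullet> z) *\<^sub>R c = 0"
    using assms by (simp add: power2_norm_eq_inner[symmetric] power_numeral_reduce)
  finally show ?thesis .
qed

lemma continuous_on_weyl:
  assumes "0 \<notin> S"
  shows "continuous_on S (weyl c)" "continuous_on S (weyl_pd c j)"
proof -
  have "norm z \<noteq> 0" if "z \<in> S" for z :: "real^3" using that assms by auto
  then show "continuous_on S (weyl c)" "continuous_on S (weyl_pd c j)"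
    unfolding weyl_def[abs_def] weyl_pd_def[abs_def]
    by (auto intro!: continuous_intros bounded_linear.continuous_on[OF bounded_linear_sigma_vector])
qed

text \<open>
  A classical free solution with a singularity \<open>y\<close> outside of \<open>\<Omega>\<close> is a weak one: multiplied with a test
  function it is continuously differentiable on the whole space.
\<close>

lemma free_solution_weak:
  fixes w :: "real^3 \<Rightarrow> complex^(2+2)"
  assumes \<Omega>: "bounded \<Omega>" "open \<Omega>" and y: "y \<notin> \<Omega>" and wL: "w \<in> L2 \<Omega>"
    and d: "\<And>j x. x \<noteq> y \<Longrightarrow> ((\<lambda>t. w (x + t *\<^sub>R axis j 1)) has_vector_derivative D j x) (at 0)"
    and c: "continuous_on (- {y}) w" "\<And>j. continuous_on (- {y}) (D j)"
    and eq: "\<And>x. x \<noteq> y \<Longrightarrow> (\<Sum>j\<in>UNIV. alpha (axis j 1) (D j x)) = 0"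
    and \<psi>: "\<psi> \<in> test_functions \<Omega>"
  shows "L2_inner \<Omega> (dirac \<psi>) w = 0"
proof -
  obtain K where K: "compact K" "K \<subseteq> \<Omega>" "\<And>x. x \<notin> K \<Longrightarrow> \<psi> x = 0"
    using test_support[OF \<psi>] by blast
  have cK: "closed K" using K(1) by (rule compact_imp_closed)
  have z: "pd j \<psi> x = 0" if "x \<notin> K" for x j
    by (rule pd_zero_outside_closed[OF cK K(3) that])
  have yK: "y \<notin> K" using y K(2) by blast
  let ?a = "\<lambda>j u. \<i> *s alpha (axis j 1) u"
  have la: "bounded_linear (?a j)" for j by (rule bounded_linear_compose[OF i_linear alpha_linear])
  define f where "f j x = \<psi> x \<bullet> ?a j (w x)" for j x
  define g where "g j x = \<psi> x \<bullet> ?a j (D j x) + pd j \<psi> x \<bullet> ?a j (w x)" for j x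
  have cover: "- K \<union> - {y} = UNIV" using yK by blast
  have cont: "continuous_on UNIV h" if "continuous_on (- {y}) h" "\<And>x. x \<notin> K \<Longrightarrow> h x = 0" for h :: "real^3 \<Rightarrow> real"
  proof -
    have "continuous_on (- K) h"
      using continuous_on_cong[of "- K" "- K" h "\<lambda>_. 0"] that(2) by simp
    then have "continuous_on (- K \<union> - {y}) h"
      using that(1) cK by (intro continuous_on_open_Un) auto
    then show ?thesis unfolding cover .
  qed
  have f: "continuous_on UNIV (f j)" for j
    unfolding f_def[abs_def]
    by (rule cont) (auto simp: K(3) intro!: continuous_on_inner test_continuous[OF \<psi>] bounded_linear.continuous_on[OF la] c)
  have g: "continuous_on UNIV (g j)" for j
    unfolding g_def[abs_def]
    by (rule cont) (auto simp: K(3) z intro!: continuous_on_add continuous_on_inner test_continuous[OF \<psi>] test_continuous[OF test_pd[OF \<psi>]]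
        bounded_linear.continuous_on[OF la] c)
  have d': "((\<lambda>t. f j (x + t *\<^sub>R axis j 1)) has_vector_derivative g j x) (at 0)" for j x
  proof (cases "x = y")
    case False
    have "((\<lambda>t. \<psi> (x + t *\<^sub>R axis j 1) \<bullet> ?a j (w (x + t *\<^sub>R axis j 1))) has_vector_derivative
        \<psi> (x + 0 *\<^sub>R axis j 1) \<bullet> ?a j (D j x) + pd j \<psi> x \<bullet> ?a j (w (x + 0 *\<^sub>R axis j 1))) (at 0)"
      by (rule bounded_bilinear.has_vector_derivative[OF bounded_bilinear_inner pd_line0[OF test_differentiable[OF \<psi>]]
            bounded_linear.has_vector_derivative[OF la d[OF False]]])
    then show ?thesis by (simp add: f_def g_def)
  next
    case True
    have "((\<lambda>t. 0 :: real) has_vector_derivative 0) (at 0)" by (rule has_vector_derivative_const)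
    moreover have "open ((\<lambda>t. x + t *\<^sub>R axis j 1) -` (- K))"
      using cK by (intro open_vimage) (auto intro!: continuous_intros)
    ultimately have "((\<lambda>t. f j (x + t *\<^sub>R axis j 1)) has_vector_derivative 0) (at 0)"
      by (rule has_vector_derivative_transform_within_open) (use True yK K(3) in \<open>auto simp: f_def\<close>)
    then show ?thesis using True yK K(3) z by (simp add: g_def)
  qed
  have g0: "integrable lborel (g j)" "integral\<^sup>L lborel (g j) = 0" for j
    by (rule integral_partial_derivative_zero[OF f g d' compact_imp_bounded[OF K(1)]]; simp add: f_def g_def K(3) z)+
  have gz: "g j x = 0" if "x \<notin> \<Omega>" for j x
  proof -
    have "x \<notin> K" using that K(2) by blast
    then show ?thesis by (simp add: g_def K(3) z)
  qed
  have sum: "(\<Sum>j\<in>UNIV. g j x) = dirac \<psi> x \<bullet> w x" for x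
  proof (cases "x = y")
    case True
    then show ?thesis using yK K(3) z by (simp add: g_def dirac_def linear_0[OF bounded_linear.linear[OF i_alpha_linear]])
  next
    case False
    have "(\<Sum>j\<in>UNIV. g j x) = \<psi> x \<bullet> (\<i> *s (\<Sum>j\<in>UNIV. alpha (axis j 1) (D j x))) + dirac \<psi> x \<bullet> w x"
      unfolding g_def sum.distrib dirac_def inner_sum_left i_alpha_symmetric inner_sum_right
        linear_sum[OF bounded_linear.linear[OF i_linear]] ..
    then show ?thesis using eq[OF False] linear_0[OF bounded_linear.linear[OF i_linear]] by simp
  qed
  have cs: "continuous_on UNIV (\<lambda>x. \<Sum>j\<in>UNIV. g j x)" by (intro continuous_on_sum g)
  have "L2_inner \<Omega> (dirac \<psi>) w = (LINT x|lebesgue_on \<Omega>. (\<Sum>j\<in>UNIV. g j x))"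
    by (simp add: L2_inner_def sum)
  also have "\<dots> = (LINT x|lebesgue. indicator \<Omega> x *\<^sub>R (\<Sum>j\<in>UNIV. g j x))"
    by (rule integral_restrict_space) (simp add: borel_open \<Omega>)
  also have "(\<lambda>x. indicator \<Omega> x *\<^sub>R (\<Sum>j\<in>UNIV. g j x)) = (\<lambda>x. \<Sum>j\<in>UNIV. g j x)"
    using gz by (auto simp: indicator_def fun_eq_iff)
  also have "(LINT x|lebesgue. (\<Sum>j\<in>UNIV. g j x)) = (LINT x|lborel. (\<Sum>j\<in>UNIV. g j x))"
    by (rule integral_completion) (simp add: borel_measurable_continuous_onI cs)
  also have "\<dots> = 0" using g0 by simp
  finally show ?thesis .
qed

text \<open>
  The isometry \<open>J\<close> embeds two-component spinors into one of the blocks, and \<open>J'\<close> into the other one, so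
  that both blocks are treated at once.
\<close>

lemma weyl_free_solution:
  assumes \<Omega>: "bounded \<Omega>" "open \<Omega>" and y: "0 < r" "\<And>x. x \<in> \<Omega> \<Longrightarrow> r \<le> norm (x - y)"
    and J: "bounded_linear J" "\<And>a v. alpha a (J v) = J' (sigma_vec a v)" "bounded_linear J'" "\<And>v. norm (J v) = norm v"
  shows "(\<lambda>x. J (weyl c (x - y))) \<in> L2 \<Omega>"
    and "\<psi> \<in> test_functions \<Omega> \<Longrightarrow> L2_inner \<Omega> (dirac \<psi>) (\<lambda>x. J (weyl c (x - y))) = 0"
proof -
  have y\<Omega>: "y \<notin> \<Omega>" using y(2)[of y] y(1) by auto
  have cw: "continuous_on (- {y}) (\<lambda>x. J (weyl c (x - y)))"
    and cd: "continuous_on (- {y}) (\<lambda>x. J (weyl_pd c j (x - y)))" for j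
    by (auto intro!: bounded_linear.continuous_on[OF J(1)] continuous_intros
        continuous_on_compose2[OF continuous_on_weyl(1)[of "- {0}"]] continuous_on_compose2[OF continuous_on_weyl(2)[of "- {0}"]])
  show L: "(\<lambda>x. J (weyl c (x - y))) \<in> L2 \<Omega>"
  proof (rule L2_bounded[OF \<Omega>])
    show "(\<lambda>x. J (weyl c (x - y))) \<in> borel_measurable (lebesgue_on \<Omega>)"
      by (rule continuous_imp_measurable_on_sets_lebesgue[OF continuous_on_subset[OF cw]])
        (use y\<Omega> \<Omega>(2) in \<open>auto simp: borel_open\<close>)
    show "norm (J (weyl c (x - y))) \<le> norm c / r\<^sup>2" if "x \<in> \<Omega>" for x
      unfolding J(4) norm_weyl using y(1) y(2)[OF that]
      by (intro divide_left_mono power_mono mult_pos_pos zero_less_power) auto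
  qed
  show "L2_inner \<Omega> (dirac \<psi>) (\<lambda>x. J (weyl c (x - y))) = 0" if \<psi>: "\<psi> \<in> test_functions \<Omega>"
  proof (rule free_solution_weak[OF \<Omega> y\<Omega> L _ cw cd _ \<psi>])
    fix j x assume "x \<noteq> y"
    then have "((\<lambda>t. weyl c ((x - y) + t *\<^sub>R axis j 1)) has_vector_derivative weyl_pd c j (x - y)) (at 0)"
      by (intro weyl_derivative) simp
    then have "((\<lambda>t. weyl c (x + t *\<^sub>R axis j 1 - y)) has_vector_derivative weyl_pd c j (x - y)) (at 0)"
      by (simp add: algebra_simps)
    then show "((\<lambda>t. J (weyl c (x + t *\<^sub>R axis j 1 - y))) has_vector_derivative J (weyl_pd c j (x - y))) (at 0)"
      by (rule bounded_linear.has_vector_derivative[OF J(1)])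
  next
    fix x assume "x \<noteq> y"
    then show "(\<Sum>j\<in>UNIV. alpha (axis j 1) (J (weyl_pd c j (x - y)))) = 0"
      unfolding J(2) linear_sum[OF bounded_linear.linear[OF J(3)], symmetric]
      by (simp add: weyl_equation linear_0[OF bounded_linear.linear[OF J(3)]])
  qed
qed

section \<open>Integrals over the limiting half space\<close>

lemma lborel_orthogonal_invariant:
  fixes R :: "real^3 \<Rightarrow> real^3"
  assumes R: "orthogonal_transformation R"
  shows "distr lborel borel R = lborel"
proof -
  have lR: "linear R" using R by (rule orthogonal_transformation_linear)
  have mR: "R \<in> borel_measurable borel"
    by (intro borel_measurable_continuous_onI linear_continuous_on) (simp add: lR linear_conv_bounded_linear[symmetric])
  obtain S where S: "orthogonal_transformation S" "\<And>x. S (R x) = x" "\<And>x. R (S x) = x"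
    using orthogonal_transformation_bij[OF R] orthogonal_transformation_inv[OF R]
    by (metis bij_inv_eq_iff)
  have "lborel = distr lborel borel R"
  proof (rule lborel_eqI)
    fix l u :: "real^3" assume le: "\<And>b. b \<in> Basis \<Longrightarrow> l \<bullet> b \<le> u \<bullet> b"
    have vi: "R -` box l u = S ` box l u"
    proof (intro set_eqI iffI)
      fix x assume "x \<in> R -` box l u"
      then have "S (R x) \<in> S ` box l u" by (intro imageI) simp
      then show "x \<in> S ` box l u" by (simp add: S(2))
    next
      fix x assume "x \<in> S ` box l u"
      then show "x \<in> R -` box l u" using S(3) by auto
    qed
    have lm: "S ` box l u \<in> lmeasurable" by (rule measurable_orthogonal_image[OF S(1)]) simp
    have "emeasure (distr lborel borel R) (box l u) = emeasure lborel (S ` box l u)"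
      using mR by (simp add: emeasure_distr vi)
    also have "\<dots> = emeasure lebesgue (S ` box l u)"
    proof -
      have "S ` box l u \<in> sets borel" unfolding vi[symmetric] using measurable_sets[OF mR, of "box l u"] by simp
      then show ?thesis by simp
    qed
    also have "\<dots> = ennreal (measure lebesgue (S ` box l u))"
      by (rule emeasure_eq_measure2[OF lm])
    also have "measure lebesgue (S ` box l u) = measure lebesgue (box l u)"
      by (rule measure_orthogonal_image[OF S(1)]) simp
    also have "ennreal (measure lebesgue (box l u)) = (\<Prod>b\<in>Basis. (u - l) \<bullet> b)"
      using le by simp
    finally show "emeasure (distr lborel borel R) (box l u) = (\<Prod>b\<in>Basis. (u - l) \<bullet> b)" .
  qed simp
  then show ?thesis by simp
qed

lemma integral_orthogonal_invariant:
  fixes f :: "real^3 \<Rightarrow> real" and R :: "real^3 \<Rightarrow> real^3"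
  assumes R: "orthogonal_transformation R" and f: "f \<in> borel_measurable borel"
  shows "(LINT z|lborel. f (R z)) = (LINT z|lborel. f z)"
    and "integrable lborel f \<Longrightarrow> integrable lborel (\<lambda>z. f (R z))"
proof -
  have mR: "R \<in> lborel \<rightarrow>\<^sub>M borel"
    using orthogonal_transformation_linear[OF R]
    by (simp add: borel_measurable_continuous_onI linear_continuous_on linear_conv_bounded_linear[symmetric])
  show "(LINT z|lborel. f (R z)) = (LINT z|lborel. f z)"
    using integral_distr[OF mR f] by (simp add: lborel_orthogonal_invariant[OF R])
  show "integrable lborel f \<Longrightarrow> integrable lborel (\<lambda>z. f (R z))"
    using integrable_distr_eq[OF mR f] by (simp add: lborel_orthogonal_invariant[OF R])
qed

lemma integral_pos_on_open:
  fixes f :: "real^3 \<Rightarrow> real"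
  assumes f: "integrable lborel f" and nn: "\<And>x. 0 \<le> f x" and S: "open S" "S \<noteq> {}" "\<And>x. x \<in> S \<Longrightarrow> 0 < f x"
  shows "0 < integral\<^sup>L lborel f"
proof (rule ccontr)
  assume "\<not> 0 < integral\<^sup>L lborel f"
  moreover have "0 \<le> integral\<^sup>L lborel f" using nn by simp
  ultimately have "AE x in lborel. f x = 0"
    using integral_nonneg_eq_0_iff_AE[OF f] nn by simp
  then have "AE x in lborel. x \<notin> S" by (rule eventually_mono) (use S(3) in fastforce)
  then have "S \<in> null_sets lborel" using S(1) by (simp add: AE_iff_null_sets)
  then have "negligible S" by (simp add: negligible_iff_null_sets null_sets_completionI)
  then show False using open_not_negligible[OF S(1,2)] by blast
qed

text \<open>
  The Gram determinant of \<open>z\<close>, \<open>t\<close> and \<open>n\<close>. Geometrically, \<open>t\<close> and \<open>t \<times> n\<close> are orthogonal and of equal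
  length, and span the plane orthogonal to \<open>n\<close>.
\<close>

lemma gram_determinant:
  fixes z t n :: "real^3"
  assumes "n \<bullet> n = 1" "t \<bullet> n = 0"
  shows "(z \<bullet> t)\<^sup>2 + (z \<bullet> cross3 t n)\<^sup>2 = (t \<bullet> t) * (z \<bullet> z - (z \<bullet> n)\<^sup>2)"
proof -
  have "(z \<bullet> cross3 t n)\<^sup>2 = (z \<bullet> z) * (t \<bullet> t) * (n \<bullet> n) + 2 * (z \<bullet> t) * (t \<bullet> n) * (n \<bullet> z)
      - (z \<bullet> z) * (t \<bullet> n)\<^sup>2 - (t \<bullet> t) * (z \<bullet> n)\<^sup>2 - (n \<bullet> n) * (z \<bullet> t)\<^sup>2"
    by (simp add: cross3_def inner_vec_def sum_3 power2_eq_square algebra_simps)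
  then show ?thesis using assms by (simp add: algebra_simps)
qed

text \<open>
  The quadratic form that the magnetic potential contributes. Averaging over the rotations by multiples
  of a right angle about \<open>n\<close> removes the mixed term and leaves a form of definite sign.
\<close>

lemma tangential_half_space_integral:
  fixes a n t :: "real^3"
  defines "t \<equiv> a - (a \<bullet> n) *\<^sub>R n"
  defines "F \<equiv> \<lambda>z. indicator {z. z \<bullet> n < -1} z * ((2 * (z \<bullet> a) * (z \<bullet> t) - (z \<bullet> z) * (a \<bullet> t)) / norm z ^ 6)"
  assumes n: "norm n = 1" and F: "integrable lborel F" and zero: "integral\<^sup>L lborel F = 0"
  shows "t = 0"
proof (rule ccontr)
  assume "t \<noteq> 0"
  have nn: "n \<bullet> n = 1" using n by (simp add: norm_eq_1)
  have tn: "t \<bullet> n = 0" by (simp add: t_def inner_diff_left nn)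
  have za: "z \<bullet> a = z \<bullet> t + (a \<bullet> n) * (z \<bullet> n)" for z by (simp add: t_def inner_diff_right)
  have at: "a \<bullet> t = t \<bullet> t" using za[of t] tn by (simp add: inner_commute)
  define b where "b = cross3 t n"
  \<comment> \<open>The rotation by a right angle about \<open>n\<close>; it maps the half space to itself.\<close>
  define R where "R z = (z \<bullet> n) *\<^sub>R n + cross3 n z" for z
  have lR: "linear R"
    unfolding R_def
    by (rule linearI) (simp_all add: inner_simps cross_add_right cross_mult_right scaleR_add_left scaleR_add_right algebra_simps)
  have Rn: "R z \<bullet> n = z \<bullet> n" for z by (simp add: R_def inner_add_left nn dot_cross_self)
  have Rt: "R z \<bullet> t = z \<bullet> b" for z
  proof -
    have "cross3 n z \<bullet> t = z \<bullet> cross3 t n" by (simp add: cross3_def inner_vec_def sum_3 algebra_simps)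
    then show ?thesis using tn by (simp add: R_def inner_add_left b_def inner_commute[of n t])
  qed
  have Rb: "R z \<bullet> b = - (z \<bullet> t)" for z
  proof -
    have "cross3 n z \<bullet> cross3 t n = (n \<bullet> t) * (z \<bullet> n) - (n \<bullet> n) * (z \<bullet> t)"
      by (simp add: cross3_def inner_vec_def sum_3 algebra_simps)
    moreover have "n \<bullet> b = 0" by (simp add: b_def dot_cross_self)
    ultimately show ?thesis using tn nn by (simp add: R_def inner_add_left b_def inner_commute[of n t])
  qed
  have RR: "R z \<bullet> R z = z \<bullet> z" for z
  proof -
    have "cross3 n z \<bullet> cross3 n z = (n \<bullet> n) * (z \<bullet> z) - (n \<bullet> z)\<^sup>2"
      by (simp add: cross3_def inner_vec_def sum_3 power2_eq_square algebra_simps)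
    moreover have "n \<bullet> cross3 n z = 0" by (simp add: dot_cross_self)
    ultimately show ?thesis
      using nn by (simp add: R_def inner_simps inner_commute[of z n] inner_commute[of "cross3 n z" n] power2_eq_square)
  qed
  have nR: "norm (R z) = norm z" for z by (simp add: norm_eq_sqrt_inner RR)
  have ot: "orthogonal_transformation R"
    unfolding orthogonal_transformation using lR nR by simp
  have F': "F z = indicator {z. z \<bullet> n < -1} z * ((2 * (z \<bullet> t)\<^sup>2 + 2 * (a \<bullet> n) * (z \<bullet> n) * (z \<bullet> t) - (z \<bullet> z) * (t \<bullet> t)) / norm z ^ 6)" for z
    unfolding F_def za at by (simp add: power2_eq_square algebra_simps)
  let ?H = "\<lambda>z. indicator {z. z \<bullet> n < -1} z * ((z \<bullet> n)\<^sup>2 / norm z ^ 6) :: real"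
  have Hn: "indicator {z. z \<bullet> n < -1} (R z) = (indicator {z. z \<bullet> n < -1} z :: real)" for z
    by (simp add: indicator_def Rn)
  have avg: "F z + F (R z) + F (R (R z)) + F (R (R (R z))) = - 4 * (t \<bullet> t) * ?H z" for z
  proof -
    have "F z + F (R z) + F (R (R z)) + F (R (R (R z)))
      = indicator {z. z \<bullet> n < -1} z * ((4 * ((z \<bullet> t)\<^sup>2 + (z \<bullet> b)\<^sup>2) - 4 * (z \<bullet> z) * (t \<bullet> t)) / norm z ^ 6)"
      unfolding F' Hn Rn Rt Rb RR nR by (simp add: add_divide_distrib diff_divide_distrib algebra_simps)
    also have "\<dots> = - 4 * (t \<bullet> t) * ?H z"
      unfolding b_def gram_determinant[OF nn tn] by (simp add: algebra_simps)
    finally show ?thesis .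
  qed
  have mF: "F \<in> borel_measurable borel" using F by (simp add: borel_measurable_integrable flip: measurable_lborel1)
  have mR: "R \<in> borel_measurable borel"
    using lR by (simp add: borel_measurable_continuous_onI linear_continuous_on linear_conv_bounded_linear[symmetric])
  have m1: "(\<lambda>z. F (R z)) \<in> borel_measurable borel" "(\<lambda>z. F (R (R z))) \<in> borel_measurable borel"
    using measurable_compose[OF mR mF] measurable_compose[OF mR measurable_compose[OF mR mF]] by simp_all
  note I1 = integral_orthogonal_invariant[OF ot mF]
    and I2 = integral_orthogonal_invariant[OF ot m1(1)]
    and I3 = integral_orthogonal_invariant[OF ot m1(2)]
  have i: "integrable lborel (\<lambda>z. F (R z))" "integrable lborel (\<lambda>z. F (R (R z)))" "integrable lborel (\<lambda>z. F (R (R (R z))))"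
    using I1(2)[OF F] I2(2)[OF I1(2)[OF F]] I3(2)[OF I2(2)[OF I1(2)[OF F]]] .
  have H: "integrable lborel ?H"
  proof -
    have "integrable lborel (\<lambda>z. (F z + F (R z) + F (R (R z)) + F (R (R (R z)))) * (- 1 / (4 * (t \<bullet> t))))"
      using F i by simp
    then show ?thesis unfolding avg using \<open>t \<noteq> 0\<close> by simp
  qed
  have "(LINT z|lborel. F z + F (R z) + F (R (R z)) + F (R (R (R z)))) = 0"
    using F i zero I1(1) I2(1) I3(1) by simp
  then have "(LINT z|lborel. ?H z) = 0"
    unfolding avg integral_mult_right_zero using \<open>t \<noteq> 0\<close> by simp
  moreover have "0 < (LINT z|lborel. ?H z)"
  proof (rule integral_pos_on_open[OF H])
    show "open {z. z \<bullet> n < -1}" by (intro open_Collect_less continuous_intros)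
    have "(-2 *\<^sub>R n) \<bullet> n < -1" using nn by simp
    then show "{z. z \<bullet> n < -1} \<noteq> {}" by blast
    fix z assume "z \<in> {z. z \<bullet> n < -1}"
    then have "z \<bullet> n < -1" by simp
    then have "z \<noteq> 0" "z \<bullet> n \<noteq> 0" by auto
    then show "0 < ?H z" using \<open>z \<bullet> n < -1\<close> by simp
  qed simp
  ultimately show False by simp
qed

section \<open>Boundary determination\<close>

lemma L2_Cauchy_Schwarz_sqrt:
  assumes "f \<in> L2 \<Omega>" "g \<in> L2 \<Omega>"
  shows "\<bar>L2_inner \<Omega> f g\<bar> \<le> sqrt (L2_inner \<Omega> f f) * sqrt (L2_inner \<Omega> g g)"
proof -
  have "sqrt ((L2_inner \<Omega> f g)\<^sup>2) \<le> sqrt (L2_inner \<Omega> f f * L2_inner \<Omega> g g)"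
    by (rule real_sqrt_le_mono[OF L2_Cauchy_Schwarz[OF assms]])
  then show ?thesis by (simp add: real_sqrt_mult)
qed

lemma potential_difference_bound:
  assumes V1: "admissible \<Omega> M V\<^sub>1" and V2: "admissible \<Omega> M V\<^sub>2" and f: "f \<in> L2 \<Omega>" and g: "g \<in> L2 \<Omega>"
  shows "(\<lambda>x. V\<^sub>1 x *v f x - V\<^sub>2 x *v f x) \<in> L2 \<Omega>"
    and "\<bar>L2_inner \<Omega> (\<lambda>x. V\<^sub>1 x *v f x - V\<^sub>2 x *v f x) g\<bar> \<le> 2 * M * (sqrt (L2_inner \<Omega> f f) * sqrt (L2_inner \<Omega> g g))"
proof -
  let ?W = "\<lambda>x. V\<^sub>1 x *v f x - V\<^sub>2 x *v f x"
  show W: "?W \<in> L2 \<Omega>" by (intro L2_diff admissible_L2[OF V1 f] admissible_L2[OF V2 f])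
  have M: "0 \<le> M" using V1 by (simp add: admissible_def)
  have "L2_inner \<Omega> ?W ?W \<le> (LINT x|lebesgue_on \<Omega>. (2 * M)\<^sup>2 * (norm (f x))\<^sup>2)"
    unfolding L2_inner_self
  proof (rule integral_mono[OF L2_D(2)[OF W]])
    show "integrable (lebesgue_on \<Omega>) (\<lambda>x. (2 * M)\<^sup>2 * (norm (f x))\<^sup>2)"
      by (rule integrable_mult_right[OF L2_D(2)[OF f]])
    fix x assume "x \<in> space (lebesgue_on \<Omega>)"
    then have "norm (V\<^sub>1 x *v f x) \<le> M * norm (f x)" "norm (V\<^sub>2 x *v f x) \<le> M * norm (f x)"
      using V1 V2 by (simp_all add: admissible_def space_restrict_space)
    then have "norm (?W x) \<le> 2 * M * norm (f x)"
      using norm_triangle_ineq4[of "V\<^sub>1 x *v f x" "V\<^sub>2 x *v f x"] by linarith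
    then have "(norm (?W x))\<^sup>2 \<le> (2 * M * norm (f x))\<^sup>2" by (rule power_mono) simp
    then show "(norm (?W x))\<^sup>2 \<le> (2 * M)\<^sup>2 * (norm (f x))\<^sup>2" by (simp only: power_mult_distrib)
  qed
  also have "\<dots> = (2 * M)\<^sup>2 * L2_inner \<Omega> f f" unfolding L2_inner_self by (rule integral_mult_right_zero)
  finally have "sqrt (L2_inner \<Omega> ?W ?W) \<le> sqrt ((2 * M)\<^sup>2 * L2_inner \<Omega> f f)" by (rule real_sqrt_le_mono)
  also have "\<dots> = 2 * M * sqrt (L2_inner \<Omega> f f)" using M by (simp add: real_sqrt_mult)
  finally have "sqrt (L2_inner \<Omega> ?W ?W) * sqrt (L2_inner \<Omega> g g) \<le> 2 * M * sqrt (L2_inner \<Omega> f f) * sqrt (L2_inner \<Omega> g g)"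
    by (rule mult_right_mono) (simp add: L2_inner_self_nonneg)
  then show "\<bar>L2_inner \<Omega> ?W g\<bar> \<le> 2 * M * (sqrt (L2_inner \<Omega> f f) * sqrt (L2_inner \<Omega> g g))"
    using L2_Cauchy_Schwarz_sqrt[OF W g] by (simp add: mult.assoc)
qed

text \<open>
  Pair the corrected solutions \<open>u + r\<close> and \<open>v + s\<close> in the integral identity and multiply by \<open>\<delta>\<close>. The pairing
  of \<open>u\<close> and \<open>v\<close> converges to the left-hand side. Since \<open>\<delta> \<parallel>u\<parallel>\<^sup>2\<close> and \<open>\<delta> \<parallel>v\<parallel>\<^sup>2\<close> stay bounded while the limits
  superior of \<open>\<delta> \<parallel>r\<parallel>\<^sup>2\<close> and \<open>\<delta> \<parallel>s\<parallel>\<^sup>2\<close> are \<open>O(\<eta>)\<close>, the other pairings are \<open>O(sqrt \<eta>)\<close>. The functions \<open>h i\<close> are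
  the homogeneous parts of the integrand and the \<open>G i\<close> its coefficients.
\<close>

lemma boundary_form_zero:
  fixes G h :: "'i \<Rightarrow> real^3 \<Rightarrow> real"
  assumes \<Omega>: "bounded \<Omega>" "open \<Omega>" and p: "p \<in> closure \<Omega>" and n: "norm n = 1"
    and inside: "\<And>v. v \<bullet> n < 0 \<Longrightarrow> \<exists>d>0. \<forall>t. 0 < t \<and> t < d \<longrightarrow> p + t *\<^sub>R v \<in> \<Omega>"
    and outside: "\<And>v. v \<bullet> n > 0 \<Longrightarrow> \<exists>d>0. \<forall>t. 0 < t \<and> t < d \<longrightarrow> p + t *\<^sub>R v \<notin> \<Omega>"
    and cone: "\<exists>d>0. \<forall>\<delta>. 0 < \<delta> \<longrightarrow> \<delta> < d \<longrightarrow> (\<forall>x\<in>\<Omega>. \<delta> / 2 \<le> norm (x - (p + \<delta> *\<^sub>R n)))"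
    and V1: "admissible \<Omega> M V\<^sub>1" and V2: "admissible \<Omega> M V\<^sub>2"
    and cauchy: "cauchy_data \<Omega> V\<^sub>1 = cauchy_data \<Omega> V\<^sub>2"
    and J: "bounded_linear J" "\<And>a v. alpha a (J v) = J' (sigma_vec a v)" "bounded_linear J'" "\<And>v. norm (J v) = norm v"
    and L: "bounded_linear L" "\<And>a v. alpha a (L v) = L' (sigma_vec a v)" "bounded_linear L'" "\<And>v. norm (L v) = norm v"
    and I: "finite I"
    and form: "\<And>x z. (V\<^sub>1 x *v J (weyl c z) - V\<^sub>2 x *v J (weyl c z)) \<bullet> L (weyl c' z) = (\<Sum>i\<in>I. G i x * h i z)"
    and h: "\<And>i. h i \<in> borel_measurable borel" "\<And>i z. \<bar>h i z\<bar> \<le> K / norm z ^ 4"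
      "\<And>i s z. 0 < s \<Longrightarrow> h i (s *\<^sub>R z) = h i z / s ^ 4"
    and G: "\<And>i. continuous_on (closure \<Omega>) (G i)"
  shows "(\<Sum>i\<in>I. G i p * (LINT z|lebesgue. indicator {z. z \<bullet> n < -1} z * h i z)) = 0"
proof -
  obtain d where d: "0 < d" "\<And>\<delta> x. 0 < \<delta> \<Longrightarrow> \<delta> < d \<Longrightarrow> x \<in> \<Omega> \<Longrightarrow> \<delta> / 2 \<le> norm (x - (p + \<delta> *\<^sub>R n))"
    using cone by blast
  define \<delta> where "\<delta> k = d / 2 * inverse (real (Suc k))" for k
  have \<delta>0: "0 < \<delta> k" for k using d(1) by (simp add: \<delta>_def)
  have \<delta>d: "\<delta> k < d" for k
  proof -
    have "inverse (real (Suc k)) \<le> 1" by (simp add: field_simps)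
    then have "\<delta> k \<le> d / 2 * 1" unfolding \<delta>_def by (rule mult_left_mono) (use d(1) in simp)
    then show ?thesis using d(1) by simp
  qed
  have \<delta>lim: "\<delta> \<longlonglongrightarrow> 0"
    unfolding \<delta>_def[abs_def] by (rule tendsto_mult_right_zero[OF LIMSEQ_inverse_real_of_nat])
  define y where "y k = p + \<delta> k *\<^sub>R n" for k
  have away: "\<delta> k / 2 \<le> norm (x - y k)" if "x \<in> \<Omega>" for k x
    unfolding y_def by (rule d(2)[OF \<delta>0 \<delta>d that])
  have conc: "(\<lambda>k. \<delta> k * (LINT x|lebesgue_on \<Omega>. g x * f (x - y k))) \<longlonglongrightarrow> g p * (LINT z|lebesgue. indicator {z. z \<bullet> n < -1} z * f z)"
    if "f \<in> borel_measurable borel" "\<And>z. \<bar>f z\<bar> \<le> Q / norm z ^ 4" "\<And>s z. 0 < s \<Longrightarrow> f (s *\<^sub>R z) = f z / s ^ 4"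
      "continuous_on (closure \<Omega>) g" for f g :: "real^3 \<Rightarrow> real" and Q
    unfolding y_def
    by (rule concentration_limit[OF \<Omega> p n inside outside that \<delta>0 \<delta>lim away[unfolded y_def]])
  define N :: "real^3 \<Rightarrow> real" where "N z = 1 / norm z ^ 4" for z
  define Z where "Z = (LINT z|lebesgue. indicator {z. z \<bullet> n < -1} z * N z)"
  have N: "N \<in> borel_measurable borel" "\<bar>N z\<bar> \<le> 1 / norm z ^ 4" "0 < s \<Longrightarrow> N (s *\<^sub>R z) = N z / s ^ 4" for s z
    by (simp_all add: N_def[abs_def] power_mult_distrib)
  have Z0: "0 \<le> Z" unfolding Z_def by (rule Bochner_Integration.integral_nonneg) (simp add: N_def)
  have concN: "(\<lambda>k. \<delta> k * (LINT x|lebesgue_on \<Omega>. g x * N (x - y k))) \<longlonglongrightarrow> g p * Z"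
    if "continuous_on (closure \<Omega>) g" for g
    unfolding Z_def by (rule conc[OF N that])
  define u v where "u k x = J (weyl c (x - y k))" and "v k x = L (weyl c' (x - y k))" for k x
  have half\<delta>: "0 < \<delta> k / 2" for k using \<delta>0[of k] by simp
  have u: "u k \<in> L2 \<Omega>" "\<And>\<psi>. \<psi> \<in> test_functions \<Omega> \<Longrightarrow> L2_inner \<Omega> (dirac \<psi>) (u k) = 0" for k
    unfolding u_def[abs_def] by (rule weyl_free_solution[OF \<Omega> half\<delta> away J]; assumption)+
  have v: "v k \<in> L2 \<Omega>" "\<And>\<psi>. \<psi> \<in> test_functions \<Omega> \<Longrightarrow> L2_inner \<Omega> (dirac \<psi>) (v k) = 0" for k
    unfolding v_def[abs_def] by (rule weyl_free_solution[OF \<Omega> half\<delta> away L]; assumption)+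
  have nu: "(norm (u k x))\<^sup>2 = (norm c)\<^sup>2 * N (x - y k)" and nv: "(norm (v k x))\<^sup>2 = (norm c')\<^sup>2 * N (x - y k)" for k x
    unfolding u_def v_def J(4) L(4) norm_weyl N_def by (simp_all add: power_divide power_mult[symmetric])
  \<comment> \<open>The pairing of the uncorrected free solutions converges to the claimed expression \<open>S\<close>.\<close>
  define S where "S = (\<Sum>i\<in>I. G i p * (LINT z|lebesgue. indicator {z. z \<bullet> n < -1} z * h i z))"
  define m where "m k = \<delta> k * L2_inner \<Omega> (\<lambda>x. V\<^sub>1 x *v u k x - V\<^sub>2 x *v u k x) (v k)" for k
  have m\<Omega>: "\<Omega> \<in> sets lebesgue" using \<Omega>(2) by (simp add: borel_open)
  have mS: "m \<longlonglongrightarrow> S"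
  proof -
    have int: "integrable (lebesgue_on \<Omega>) (\<lambda>x. G i x * h i (x - y k))" for i k
    proof -
      have Gm: "G i \<in> borel_measurable (lebesgue_on \<Omega>)"
        by (rule continuous_imp_measurable_on_sets_lebesgue[OF continuous_on_subset[OF G closure_subset] m\<Omega>])
      have "compact (G i ` closure \<Omega>)" using \<Omega>(1) G by (intro compact_continuous_image) (auto simp: compact_closure)
      then obtain B where B: "\<forall>y\<in>G i ` closure \<Omega>. norm y \<le> B"
        using compact_imp_bounded bounded_iff by metis
      have "\<bar>G i x * h i (x - y k)\<bar> \<le> B * (\<bar>K\<bar> / (\<delta> k / 2) ^ 4)" if x: "x \<in> \<Omega>" for x
        unfolding abs_mult
      proof (rule mult_mono)
        show GB: "\<bar>G i x\<bar> \<le> B" using B x closure_subset[of \<Omega>] by auto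
        then show "0 \<le> B" by linarith
        have "\<bar>h i (x - y k)\<bar> \<le> K / norm (x - y k) ^ 4" by (rule h(2))
        also have "\<dots> \<le> \<bar>K\<bar> / norm (x - y k) ^ 4" by (rule divide_right_mono) auto
        also have "\<dots> \<le> \<bar>K\<bar> / (\<delta> k / 2) ^ 4"
          using away[OF x, of k] half\<delta>[of k] by (intro divide_left_mono power_mono mult_pos_pos zero_less_power) auto
        finally show "\<bar>h i (x - y k)\<bar> \<le> \<bar>K\<bar> / (\<delta> k / 2) ^ 4" .
      qed simp
      moreover have "(\<lambda>x. h i (x - y k)) \<in> borel_measurable borel" using h(1) by simp
      ultimately have "(\<lambda>x. G i x * h i (x - y k)) \<in> L2 \<Omega>"
        by (intro L2_bounded[OF \<Omega>] borel_measurable_times[OF Gm measurable_lebesgue_on_of_borel]) auto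
      then show ?thesis by (rule L2_integrable[OF \<Omega>])
    qed
    have meq: "m k = (\<Sum>i\<in>I. \<delta> k * (LINT x|lebesgue_on \<Omega>. G i x * h i (x - y k)))" for k
      unfolding m_def L2_inner_def u_def v_def form
      by (simp add: Bochner_Integration.integral_sum[OF int] sum_distrib_left)
    have "(\<lambda>k. \<Sum>i\<in>I. \<delta> k * (LINT x|lebesgue_on \<Omega>. G i x * h i (x - y k))) \<longlonglongrightarrow> S"
      unfolding S_def by (intro tendsto_sum conc[OF h G])
    then show ?thesis unfolding meq[abs_def] .
  qed
  obtain C1 where C1: "0 < C1" "\<And>\<eta> u. 0 < \<eta> \<Longrightarrow> \<eta> \<le> 1 \<Longrightarrow> u \<in> L2 \<Omega> \<Longrightarrow> (\<forall>\<psi>\<in>test_functions \<Omega>. L2_inner \<Omega> (dirac \<psi>) u = 0) \<Longrightarrow>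
      (\<exists>r\<in>L2 \<Omega>. (\<forall>\<phi>\<in>test_functions \<Omega>. dist_L \<Omega> V\<^sub>1 (\<lambda>x. u x + r x) \<phi> = 0) \<and>
        L2_inner \<Omega> r r \<le> C1 * (LINT x|lebesgue_on \<Omega>. (norm (u x))\<^sup>2 / weight'' (4 * M\<^sup>2 + 1) \<eta> (x $ 1 - p $ 1)))"
    using dirac_solution_near_free_solution[OF \<Omega> V1, of "p $ 1"] by auto
  obtain C2 where C2: "0 < C2" "\<And>\<eta> u. 0 < \<eta> \<Longrightarrow> \<eta> \<le> 1 \<Longrightarrow> u \<in> L2 \<Omega> \<Longrightarrow> (\<forall>\<psi>\<in>test_functions \<Omega>. L2_inner \<Omega> (dirac \<psi>) u = 0) \<Longrightarrow>
      (\<exists>r\<in>L2 \<Omega>. (\<forall>\<phi>\<in>test_functions \<Omega>. dist_L \<Omega> V\<^sub>2 (\<lambda>x. u x + r x) \<phi> = 0) \<and>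
        L2_inner \<Omega> r r \<le> C2 * (LINT x|lebesgue_on \<Omega>. (norm (u x))\<^sup>2 / weight'' (4 * M\<^sup>2 + 1) \<eta> (x $ 1 - p $ 1)))"
    using dirac_solution_near_free_solution[OF \<Omega> V2, of "p $ 1"] by auto
  have M: "0 \<le> M" using V1 by (simp add: admissible_def)
  define a b where "a = (norm c)\<^sup>2 * Z" and "b = (norm c')\<^sup>2 * Z"
  have ab: "0 \<le> a" "0 \<le> b" unfolding a_def b_def using Z0 by simp_all
  \<comment> \<open>For fixed \<open>\<eta>\<close> the identity for the corrected solutions turns the pairing into three terms with at
    least one correction each; \<open>\<delta>\<close> tends to zero before \<open>\<eta>\<close> does.\<close>
  have bound: "\<bar>S\<bar> \<le> 2 * M * (sqrt a * sqrt (C2 * b * \<eta>) + sqrt (C1 * a * \<eta>) * sqrt b + sqrt (C1 * a * \<eta>) * sqrt (C2 * b * \<eta>))"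
    if \<eta>: "0 < \<eta>" "\<eta> \<le> 1" for \<eta>
  proof -
    define g where "g x = 1 / weight'' (4 * M\<^sup>2 + 1) \<eta> (x $ 1 - p $ 1)" for x :: "real^3"
    have wpos: "0 < weight'' (4 * M\<^sup>2 + 1) \<eta> s" for s
      using weight''_ge[of "4 * M\<^sup>2 + 1" \<eta> s] zero_le_power2[of M] by linarith
    have "continuous_on UNIV (\<lambda>x::real^3. weight'' (4 * M\<^sup>2 + 1) \<eta> (x $ 1 - p $ 1))"
      by (intro continuous_on_compose2[OF weight''_continuous[OF \<eta>(1), of UNIV]] continuous_intros) auto
    then have g: "continuous_on (closure \<Omega>) g"
      unfolding g_def using wpos by (auto intro!: continuous_on_divide continuous_on_const less_imp_neq[symmetric] intro: continuous_on_subset)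
    have gp: "g p \<le> \<eta>"
    proof -
      have "1 / \<eta> \<le> weight'' (4 * M\<^sup>2 + 1) \<eta> 0" unfolding weight''_0[OF \<eta>(1)] by simp
      then have "1 / weight'' (4 * M\<^sup>2 + 1) \<eta> 0 \<le> 1 / (1 / \<eta>)" using \<eta>(1) wpos by (intro divide_left_mono) auto
      then show ?thesis by (simp add: g_def)
    qed
    have "\<exists>r\<in>L2 \<Omega>. (\<forall>\<phi>\<in>test_functions \<Omega>. dist_L \<Omega> V\<^sub>1 (\<lambda>x. u k x + r x) \<phi> = 0) \<and>
        L2_inner \<Omega> r r \<le> C1 * (LINT x|lebesgue_on \<Omega>. (norm (u k x))\<^sup>2 / weight'' (4 * M\<^sup>2 + 1) \<eta> (x $ 1 - p $ 1))" for k
      by (rule C1(2)[OF \<eta> u(1)]) (use u(2) in blast)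
    then have "\<forall>k. \<exists>r. r \<in> L2 \<Omega> \<and> (\<forall>\<phi>\<in>test_functions \<Omega>. dist_L \<Omega> V\<^sub>1 (\<lambda>x. u k x + r x) \<phi> = 0) \<and>
        L2_inner \<Omega> r r \<le> C1 * (LINT x|lebesgue_on \<Omega>. (norm (u k x))\<^sup>2 / weight'' (4 * M\<^sup>2 + 1) \<eta> (x $ 1 - p $ 1))"
      by (simp only: Bex_def simp_thms)
    from choice[OF this] obtain r where r: "\<And>k. r k \<in> L2 \<Omega>" "\<And>k \<phi>. \<phi> \<in> test_functions \<Omega> \<Longrightarrow> dist_L \<Omega> V\<^sub>1 (\<lambda>x. u k x + r k x) \<phi> = 0"
      "\<And>k. L2_inner \<Omega> (r k) (r k) \<le> C1 * (LINT x|lebesgue_on \<Omega>. (norm (u k x))\<^sup>2 / weight'' (4 * M\<^sup>2 + 1) \<eta> (x $ 1 - p $ 1))"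
      by blast
    have "\<exists>r\<in>L2 \<Omega>. (\<forall>\<phi>\<in>test_functions \<Omega>. dist_L \<Omega> V\<^sub>2 (\<lambda>x. v k x + r x) \<phi> = 0) \<and>
        L2_inner \<Omega> r r \<le> C2 * (LINT x|lebesgue_on \<Omega>. (norm (v k x))\<^sup>2 / weight'' (4 * M\<^sup>2 + 1) \<eta> (x $ 1 - p $ 1))" for k
      by (rule C2(2)[OF \<eta> v(1)]) (use v(2) in blast)
    then have "\<forall>k. \<exists>r. r \<in> L2 \<Omega> \<and> (\<forall>\<phi>\<in>test_functions \<Omega>. dist_L \<Omega> V\<^sub>2 (\<lambda>x. v k x + r x) \<phi> = 0) \<and>
        L2_inner \<Omega> r r \<le> C2 * (LINT x|lebesgue_on \<Omega>. (norm (v k x))\<^sup>2 / weight'' (4 * M\<^sup>2 + 1) \<eta> (x $ 1 - p $ 1))"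
      by (simp only: Bex_def simp_thms)
    from choice[OF this] obtain s where s: "\<And>k. s k \<in> L2 \<Omega>" "\<And>k \<phi>. \<phi> \<in> test_functions \<Omega> \<Longrightarrow> dist_L \<Omega> V\<^sub>2 (\<lambda>x. v k x + s k x) \<phi> = 0"
      "\<And>k. L2_inner \<Omega> (s k) (s k) \<le> C2 * (LINT x|lebesgue_on \<Omega>. (norm (v k x))\<^sup>2 / weight'' (4 * M\<^sup>2 + 1) \<eta> (x $ 1 - p $ 1))"
      by blast
    define nn where "nn k f = sqrt (\<delta> k * L2_inner \<Omega> f f)" for k and f :: "real^3 \<Rightarrow> complex^(2+2)"
    have nn0: "0 \<le> nn k f" for k f unfolding nn_def using \<delta>0[of k] L2_inner_self_nonneg[of \<Omega> f] by simp
    have W: "\<delta> k * \<bar>L2_inner \<Omega> (\<lambda>x. V\<^sub>1 x *v f x - V\<^sub>2 x *v f x) f'\<bar> \<le> 2 * M * (nn k f * nn k f')"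
      if "f \<in> L2 \<Omega>" "f' \<in> L2 \<Omega>" for f f' k
    proof -
      have "nn k f * nn k f' = (sqrt (\<delta> k) * sqrt (\<delta> k)) * (sqrt (L2_inner \<Omega> f f) * sqrt (L2_inner \<Omega> f' f'))"
        unfolding nn_def real_sqrt_mult by (simp only: mult_ac)
      also have "sqrt (\<delta> k) * sqrt (\<delta> k) = \<delta> k" using \<delta>0[of k] by simp
      finally have "nn k f * nn k f' = \<delta> k * (sqrt (L2_inner \<Omega> f f) * sqrt (L2_inner \<Omega> f' f'))" .
      then show ?thesis
        using mult_left_mono[OF potential_difference_bound(2)[OF V1 V2 that], of "\<delta> k"] \<delta>0[of k] by (simp add: mult_ac)
    qed
    have est: "\<bar>m k\<bar> \<le> 2 * M * (nn k (u k) * nn k (s k) + nn k (r k) * nn k (v k) + nn k (r k) * nn k (s k))" for k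
    proof -
      let ?W = "\<lambda>f x. V\<^sub>1 x *v f x - V\<^sub>2 x *v f x"
      have Wadd: "?W (\<lambda>x. u k x + r k x) = (\<lambda>x. ?W (u k) x + ?W (r k) x)"
        by (simp add: fun_eq_iff matrix_vector_right_distrib)
      have WL: "?W f \<in> L2 \<Omega>" if "f \<in> L2 \<Omega>" for f by (rule potential_difference_bound(1)[OF V1 V2 that that])
      have vs: "(\<lambda>x. v k x + s k x) \<in> L2 \<Omega>" by (rule L2_add[OF v(1) s(1)])
      have "L2_inner \<Omega> (?W (\<lambda>x. u k x + r k x)) (\<lambda>x. v k x + s k x) = 0"
        by (rule integral_identity[OF \<Omega> V1 V2 cauchy L2_add[OF u(1) r(1)] r(2) vs s(2)])
      then have "L2_inner \<Omega> (?W (u k)) (\<lambda>x. v k x + s k x) + L2_inner \<Omega> (?W (r k)) (\<lambda>x. v k x + s k x) = 0"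
        unfolding Wadd L2_inner_add_left[OF WL[OF u(1)] WL[OF r(1)] vs] .
      moreover have "L2_inner \<Omega> F (\<lambda>x. v k x + s k x) = L2_inner \<Omega> F (v k) + L2_inner \<Omega> F (s k)" if "F \<in> L2 \<Omega>" for F
        using L2_inner_add_left[OF v(1) s(1) that] by (simp only: L2_inner_commute[of \<Omega> F])
      ultimately have "L2_inner \<Omega> (?W (u k)) (v k)
          = - (L2_inner \<Omega> (?W (u k)) (s k) + L2_inner \<Omega> (?W (r k)) (v k) + L2_inner \<Omega> (?W (r k)) (s k))"
        using WL[OF u(1)[of k]] WL[OF r(1)[of k]] by simp
      then have "\<bar>L2_inner \<Omega> (?W (u k)) (v k)\<bar>
          \<le> \<bar>L2_inner \<Omega> (?W (u k)) (s k)\<bar> + \<bar>L2_inner \<Omega> (?W (r k)) (v k)\<bar> + \<bar>L2_inner \<Omega> (?W (r k)) (s k)\<bar>"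
        by linarith
      then have "\<delta> k * \<bar>L2_inner \<Omega> (?W (u k)) (v k)\<bar>
          \<le> \<delta> k * (\<bar>L2_inner \<Omega> (?W (u k)) (s k)\<bar> + \<bar>L2_inner \<Omega> (?W (r k)) (v k)\<bar> + \<bar>L2_inner \<Omega> (?W (r k)) (s k)\<bar>)"
        by (rule mult_left_mono) (rule less_imp_le[OF \<delta>0])
      moreover have "\<bar>m k\<bar> = \<delta> k * \<bar>L2_inner \<Omega> (?W (u k)) (v k)\<bar>"
        unfolding m_def abs_mult using \<delta>0[of k] by simp
      ultimately show ?thesis
        using W[OF u(1) s(1), of k k k] W[OF r(1) v(1), of k k k] W[OF r(1) s(1), of k k k]
        by (simp add: distrib_left)
    qed
    have lu: "(\<lambda>k. nn k (u k)) \<longlonglongrightarrow> sqrt a"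
    proof -
      have eq: "\<delta> k * L2_inner \<Omega> (u k) (u k) = (norm c)\<^sup>2 * (\<delta> k * (LINT x|lebesgue_on \<Omega>. 1 * N (x - y k)))" for k
        unfolding L2_inner_self nu by simp
      have "(\<lambda>k. (norm c)\<^sup>2 * (\<delta> k * (LINT x|lebesgue_on \<Omega>. 1 * N (x - y k)))) \<longlonglongrightarrow> (norm c)\<^sup>2 * (1 * Z)"
        by (intro tendsto_mult tendsto_const concN continuous_on_const)
      from tendsto_real_sqrt[OF this] show ?thesis unfolding nn_def eq a_def by simp
    qed
    have lv: "(\<lambda>k. nn k (v k)) \<longlonglongrightarrow> sqrt b"
    proof -
      have eq: "\<delta> k * L2_inner \<Omega> (v k) (v k) = (norm c')\<^sup>2 * (\<delta> k * (LINT x|lebesgue_on \<Omega>. 1 * N (x - y k)))" for k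
        unfolding L2_inner_self nv by simp
      have "(\<lambda>k. (norm c')\<^sup>2 * (\<delta> k * (LINT x|lebesgue_on \<Omega>. 1 * N (x - y k)))) \<longlonglongrightarrow> (norm c')\<^sup>2 * (1 * Z)"
        by (intro tendsto_mult tendsto_const concN continuous_on_const)
      from tendsto_real_sqrt[OF this] show ?thesis unfolding nn_def eq b_def by simp
    qed
    define er es where "er k = sqrt (C1 * ((norm c)\<^sup>2 * (\<delta> k * (LINT x|lebesgue_on \<Omega>. g x * N (x - y k)))))"
      and "es k = sqrt (C2 * ((norm c')\<^sup>2 * (\<delta> k * (LINT x|lebesgue_on \<Omega>. g x * N (x - y k)))))" for k
    have nr: "nn k (r k) \<le> er k" and ns: "nn k (s k) \<le> es k" for k
    proof -
      have "(LINT x|lebesgue_on \<Omega>. (norm (u k x))\<^sup>2 / weight'' (4 * M\<^sup>2 + 1) \<eta> (x $ 1 - p $ 1))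
          = (norm c)\<^sup>2 * (LINT x|lebesgue_on \<Omega>. g x * N (x - y k))"
        unfolding nu g_def by (simp flip: integral_mult_right_zero)
      then show "nn k (r k) \<le> er k"
        using mult_left_mono[OF r(3)[of k] less_imp_le[OF \<delta>0]] unfolding nn_def er_def
        by (intro real_sqrt_le_mono) (simp add: mult_ac)
      have "(LINT x|lebesgue_on \<Omega>. (norm (v k x))\<^sup>2 / weight'' (4 * M\<^sup>2 + 1) \<eta> (x $ 1 - p $ 1))
          = (norm c')\<^sup>2 * (LINT x|lebesgue_on \<Omega>. g x * N (x - y k))"
        unfolding nv g_def by (simp flip: integral_mult_right_zero)
      then show "nn k (s k) \<le> es k"
        using mult_left_mono[OF s(3)[of k] less_imp_le[OF \<delta>0]] unfolding nn_def es_def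
        by (intro real_sqrt_le_mono) (simp add: mult_ac)
    qed
    have ler: "er \<longlonglongrightarrow> sqrt (C1 * ((norm c)\<^sup>2 * (g p * Z)))" and les: "es \<longlonglongrightarrow> sqrt (C2 * ((norm c')\<^sup>2 * (g p * Z)))"
      unfolding er_def[abs_def] es_def[abs_def] 
      by (rule tendsto_real_sqrt[OF tendsto_mult[OF tendsto_const tendsto_mult[OF tendsto_const concN[OF g]]]])+
    have Er: "sqrt (C1 * ((norm c)\<^sup>2 * (g p * Z))) \<le> sqrt (C1 * a * \<eta>)" and Es: "sqrt (C2 * ((norm c')\<^sup>2 * (g p * Z))) \<le> sqrt (C2 * b * \<eta>)"
    proof -
      have 1: "C1 * a * g p \<le> C1 * a * \<eta>" "C2 * b * g p \<le> C2 * b * \<eta>"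
        using gp ab C1(1) C2(1) by (auto intro!: mult_left_mono)
      show "sqrt (C1 * ((norm c)\<^sup>2 * (g p * Z))) \<le> sqrt (C1 * a * \<eta>)" "sqrt (C2 * ((norm c')\<^sup>2 * (g p * Z))) \<le> sqrt (C2 * b * \<eta>)"
        by (rule real_sqrt_le_mono; use 1 in \<open>simp add: a_def b_def mult_ac\<close>)+
    qed
    have est': "\<bar>m k\<bar> \<le> 2 * M * (nn k (u k) * es k + er k * nn k (v k) + er k * es k)" for k
    proof -
      have er0: "0 \<le> er k" "0 \<le> es k" by (rule order_trans[OF nn0 nr], rule order_trans[OF nn0 ns])
      have "nn k (u k) * nn k (s k) + nn k (r k) * nn k (v k) + nn k (r k) * nn k (s k)
          \<le> nn k (u k) * es k + er k * nn k (v k) + er k * es k"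
        by (intro add_mono mult_mono nr ns nn0 er0 order_refl)
      then have "2 * M * (nn k (u k) * nn k (s k) + nn k (r k) * nn k (v k) + nn k (r k) * nn k (s k))
          \<le> 2 * M * (nn k (u k) * es k + er k * nn k (v k) + er k * es k)"
        by (rule mult_left_mono) (use M in simp)
      then show ?thesis using est[of k] by linarith
    qed
    let ?er = "sqrt (C1 * ((norm c)\<^sup>2 * (g p * Z)))" and ?es = "sqrt (C2 * ((norm c')\<^sup>2 * (g p * Z)))"
    have "\<bar>S\<bar> \<le> 2 * M * (sqrt a * ?es + ?er * sqrt b + ?er * ?es)"
    proof (rule LIMSEQ_le[OF tendsto_rabs[OF mS]])
      show "(\<lambda>k. 2 * M * (nn k (u k) * es k + er k * nn k (v k) + er k * es k)) \<longlonglongrightarrow> 2 * M * (sqrt a * ?es + ?er * sqrt b + ?er * ?es)"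
        by (intro tendsto_mult tendsto_add tendsto_const lu lv ler les)
    qed (use est' in blast)
    also have "\<dots> \<le> 2 * M * (sqrt a * sqrt (C2 * b * \<eta>) + sqrt (C1 * a * \<eta>) * sqrt b + sqrt (C1 * a * \<eta>) * sqrt (C2 * b * \<eta>))"
    proof -
      have gp0: "0 \<le> g p" unfolding g_def using wpos by (simp add: less_imp_le)
      show ?thesis
        by (intro mult_left_mono add_mono mult_mono Er Es order_refl real_sqrt_ge_zero mult_nonneg_nonneg)
          (use M ab C1(1) C2(1) \<eta>(1) gp0 Z0 in auto)
    qed
    finally show ?thesis .
  qed
  have "\<bar>S\<bar> \<le> 2 * M * (sqrt a * sqrt (C2 * b * 0) + sqrt (C1 * a * 0) * sqrt b + sqrt (C1 * a * 0) * sqrt (C2 * b * 0))"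
  proof (rule LIMSEQ_le_const)
    show "(\<lambda>k. 2 * M * (sqrt a * sqrt (C2 * b * inverse (real (Suc k))) + sqrt (C1 * a * inverse (real (Suc k))) * sqrt b
        + sqrt (C1 * a * inverse (real (Suc k))) * sqrt (C2 * b * inverse (real (Suc k)))))
      \<longlonglongrightarrow> 2 * M * (sqrt a * sqrt (C2 * b * 0) + sqrt (C1 * a * 0) * sqrt b + sqrt (C1 * a * 0) * sqrt (C2 * b * 0))"
      by (intro tendsto_mult tendsto_add tendsto_const tendsto_real_sqrt LIMSEQ_inverse_real_of_nat)
    have "0 < inverse (real (Suc k))" "inverse (real (Suc k)) \<le> 1" for k by (simp_all add: field_simps)
    then show "\<exists>N. \<forall>k\<ge>N. \<bar>S\<bar> \<le> 2 * M * (sqrt a * sqrt (C2 * b * inverse (real (Suc k))) + sqrt (C1 * a * inverse (real (Suc k))) * sqrt b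
        + sqrt (C1 * a * inverse (real (Suc k))) * sqrt (C2 * b * inverse (real (Suc k))))"
      by (intro exI[of _ 0] allI impI bound)
  qed
  then show ?thesis unfolding S_def by simp
qed

lemma borel_measurable_bounded_linear:
  fixes B :: "'a::euclidean_space \<Rightarrow> 'b::euclidean_space"
  assumes "bounded_linear B" "f \<in> borel_measurable N"
  shows "(\<lambda>x. B (f x)) \<in> borel_measurable N"
  by (rule measurable_compose[OF assms(2)])
    (simp add: assms(1) borel_measurable_continuous_onI linear_continuous_on)

lemma borel_measurable_sigma:
  assumes A: "A \<in> borel_measurable N" and w: "w \<in> borel_measurable N"
  shows "(\<lambda>x. sigma_vec (A x) (w x)) \<in> borel_measurable N"
proof -
  have "(\<lambda>x. \<Sum>j\<in>UNIV. (A x $ j) *\<^sub>R sigma_vec (axis j 1) (w x)) \<in> borel_measurable N"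
    by (intro borel_measurable_sum borel_measurable_scaleR borel_measurable_bounded_linear[OF sigma_linear w]
        borel_measurable_bounded_linear[OF bounded_linear_vec_nth A])
  then show ?thesis by (simp only: sigma_sum_axis)
qed

text \<open>
  All large bounds are allowed, so that two potentials can share one.
\<close>

lemma admissible_potential:
  assumes \<Omega>: "bounded \<Omega>" "open \<Omega>"
    and c: "continuous_on (closure \<Omega>) A" "continuous_on (closure \<Omega>) qp" "continuous_on (closure \<Omega>) qm"
  shows "\<exists>M0. \<forall>M\<ge>M0. admissible \<Omega> M (potential A qp qm)"
proof -
  have bd: "\<exists>B. \<forall>x\<in>\<Omega>. norm (f x) \<le> B" if "continuous_on (closure \<Omega>) f" for f :: "real^3 \<Rightarrow> 'b::euclidean_space"
  proof -
    have "compact (f ` closure \<Omega>)" using \<Omega>(1) that by (intro compact_continuous_image) (auto simp: compact_closure)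
    then obtain B where "\<forall>y\<in>f ` closure \<Omega>. norm y \<le> B"
      using compact_imp_bounded bounded_iff by metis
    then show ?thesis using closure_subset[of \<Omega>] by (intro exI[of _ B]) auto
  qed
  obtain B1 B2 B3 where B: "\<forall>x\<in>\<Omega>. norm (A x) \<le> B1" "\<forall>x\<in>\<Omega>. norm (qp x) \<le> B2" "\<forall>x\<in>\<Omega>. norm (qm x) \<le> B3"
    using bd[OF c(1)] bd[OF c(2)] bd[OF c(3)] by blast
  define B0 where "B0 = max (max B1 B2) (max B3 0)"
  have m\<Omega>: "\<Omega> \<in> sets lebesgue" using \<Omega>(2) by (simp add: borel_open)
  have mc: "A \<in> borel_measurable (lebesgue_on \<Omega>)" "qp \<in> borel_measurable (lebesgue_on \<Omega>)" "qm \<in> borel_measurable (lebesgue_on \<Omega>)"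
    by (rule continuous_imp_measurable_on_sets_lebesgue[OF continuous_on_subset[OF _ closure_subset] m\<Omega>], rule c)+
  have "admissible \<Omega> M (potential A qp qm)" if M: "4 * B0 \<le> M" for M
    unfolding admissible_def
  proof (intro conjI ballI allI)
    show "0 \<le> M" using M by (simp add: B0_def)
    show "norm (potential A qp qm x *v u) \<le> M * norm u" if x: "x \<in> \<Omega>" for x u
    proof -
      have "norm (potential A qp qm x *v u) \<le> 4 * B0 * norm u"
        by (rule norm_potential_le) (use B x in \<open>auto simp: B0_def le_max_iff_disj\<close>)
      also have "\<dots> \<le> M * norm u" by (rule mult_right_mono[OF M norm_ge_zero])
      finally show ?thesis .
    qed
    show "(potential A qp qm x *v u) \<bullet> v = u \<bullet> (potential A qp qm x *v v)" for x u v
      by (rule potential_symmetric)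
    fix u :: "real^3 \<Rightarrow> complex^(2+2)" assume u: "u \<in> borel_measurable (lebesgue_on \<Omega>)"
    note ul = borel_measurable_bounded_linear[OF upper_linear u] borel_measurable_bounded_linear[OF lower_linear u]
    have "(\<lambda>x. join (sigma_vec (A x) (lower (u x)) + qp x *\<^sub>R upper (u x)) 0 + join 0 (sigma_vec (A x) (upper (u x)) + qm x *\<^sub>R lower (u x)))
        \<in> borel_measurable (lebesgue_on \<Omega>)"
      by (intro borel_measurable_add borel_measurable_bounded_linear[OF join_linear(1)] borel_measurable_bounded_linear[OF join_linear(2)]
          borel_measurable_sigma borel_measurable_scaleR ul mc)
    moreover have "join (sigma_vec (A x) (lower (u x)) + qp x *\<^sub>R upper (u x)) 0 + join 0 (sigma_vec (A x) (upper (u x)) + qm x *\<^sub>R lower (u x))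
        = potential A qp qm x *v u x" for x
      by (rule spinor_eqI) (simp_all add: upper_potential lower_potential)
    ultimately show "(\<lambda>x. potential A qp qm x *v u x) \<in> borel_measurable (lebesgue_on \<Omega>)" by simp
  qed
  then show ?thesis by blast
qed

lemma norm_join: "norm (join v 0) = norm v" "norm (join 0 w) = norm w"
  by (simp_all add: norm_eq_sqrt_inner inner_spinor)

lemma alpha_join: "alpha a (join v 0) = join 0 (sigma_vec a v)" "alpha a (join 0 w) = join (sigma_vec a w) 0"
  by (rule spinor_eqI; simp add: linear_0[OF bounded_linear.linear[OF sigma_linear]])+

lemma weyl_scale: "0 < s \<Longrightarrow> weyl c (s *\<^sub>R z) = (1 / s\<^sup>2) *\<^sub>R weyl c z"
  by (simp add: weyl_def sigma_linear_vector power_mult_distrib power2_eq_square power3_eq_cube)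

lemma borel_measurable_weyl: "weyl c \<in> borel_measurable borel"
  unfolding weyl_def[abs_def]
  by (intro borel_measurable_scaleR borel_measurable_bounded_linear[OF bounded_linear_sigma_vector]) measurable

text \<open>
  Moving \<open>\<sigma> \<cdot> z\<close> from the second factor to the first one produces the conjugate \<open>(\<sigma> \<cdot> z) (\<sigma> \<cdot> a) (\<sigma> \<cdot> z)\<close>. The
  spinor \<open>(\<sigma> \<cdot> t) c\<close> in the second factor makes the result a quadratic form in \<open>z\<close> that sees only \<open>a\<close> and
  \<open>t\<close>.
\<close>

lemma sigma_weyl_inner:
  "sigma_vec a (weyl c z) \<bullet> weyl (sigma_vec t c) z = (2 * (z \<bullet> a) * (z \<bullet> t) - (z \<bullet> z) * (a \<bullet> t)) / norm z ^ 6 * (c \<bullet> c)"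
proof -
  note lin = linear_scale[OF bounded_linear.linear[OF sigma_linear]]
  have "sigma_vec a (sigma_vec z c) \<bullet> sigma_vec z (sigma_vec t c) = sigma_vec z (sigma_vec a (sigma_vec z c)) \<bullet> sigma_vec t c"
    by (rule sigma_symmetric[symmetric])
  also have "\<dots> = (2 * (z \<bullet> a) * (z \<bullet> t) - (z \<bullet> z) * (a \<bullet> t)) * (c \<bullet> c)"
    unfolding sigma_conjugate by (simp add: inner_diff_left inner_sigma_sigma algebra_simps)
  finally show ?thesis
    unfolding weyl_def lin by (simp add: power_add[symmetric])
qed

theorem theorem1p3:
  fixes \<Omega> :: "(real^3) set"
    and A\<^sub>1 A\<^sub>2 :: "real^3 \<Rightarrow> real^3"
    and qp\<^sub>1 qm\<^sub>1 qp\<^sub>2 qm\<^sub>2 :: "real^3 \<Rightarrow> real"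
  assumes "bounded \<Omega>" and "C1_domain \<Omega>"
    and "A\<^sub>1 \<in> W1inf_cont \<Omega>" and "qp\<^sub>1 \<in> W1inf_cont \<Omega>" and "qm\<^sub>1 \<in> W1inf_cont \<Omega>"
    and "A\<^sub>2 \<in> W1inf_cont \<Omega>" and "qp\<^sub>2 \<in> W1inf_cont \<Omega>" and "qm\<^sub>2 \<in> W1inf_cont \<Omega>"
    and "cauchy_data \<Omega> (potential A\<^sub>1 qp\<^sub>1 qm\<^sub>1) = cauchy_data \<Omega> (potential A\<^sub>2 qp\<^sub>2 qm\<^sub>2)"
  shows "\<forall>x\<in>frontier \<Omega>. tangential \<Omega> A\<^sub>1 x = tangential \<Omega> A\<^sub>2 x \<and>
           qp\<^sub>1 x = qp\<^sub>2 x \<and> qm\<^sub>1 x = qm\<^sub>2 x"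
proof
  fix p assume p: "p \<in> frontier \<Omega>"
  have \<Omega>: "bounded \<Omega>" "open \<Omega>" using assms(1,2) by (auto simp: C1_domain_def)
  have c: "continuous_on (closure \<Omega>) A\<^sub>1" "continuous_on (closure \<Omega>) qp\<^sub>1" "continuous_on (closure \<Omega>) qm\<^sub>1"
    "continuous_on (closure \<Omega>) A\<^sub>2" "continuous_on (closure \<Omega>) qp\<^sub>2" "continuous_on (closure \<Omega>) qm\<^sub>2"
    using assms(3-8) by (auto simp: W1inf_cont_def)
  let ?V1 = "potential A\<^sub>1 qp\<^sub>1 qm\<^sub>1" and ?V2 = "potential A\<^sub>2 qp\<^sub>2 qm\<^sub>2"
  obtain M1 M2 where "\<forall>M\<ge>M1. admissible \<Omega> M ?V1" "\<forall>M\<ge>M2. admissible \<Omega> M ?V2"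
    using admissible_potential[OF \<Omega> c(1-3)] admissible_potential[OF \<Omega> c(4-6)] by blast
  then have V: "admissible \<Omega> (max M1 M2) ?V1" "admissible \<Omega> (max M1 M2) ?V2" by simp_all
  obtain T r \<gamma> G where chart: "C1_chart \<Omega> p T r \<gamma> G" using assms(2) p unfolding C1_domain_def by blast
  obtain n where cn: "chart_normal p T G n" using chart_normal_exists[OF chart] by blast
  have on: "outer_normal \<Omega> p = n" by (rule outer_normal_eq[OF chart p cn])
  note ray = chart_normal_ray[OF chart p cn]
  have pc: "p \<in> closure \<Omega>" and p\<Omega>: "p \<notin> \<Omega>" using p \<Omega>(2) by (auto simp: frontier_def interior_open)
  note form0 = boundary_form_zero[OF \<Omega> pc ray exterior_cone[OF chart p\<Omega> cn ray(1)] V assms(9)]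
  \<comment> \<open>Any unit spinor serves: the forms below depend on \<open>e\<close> through its norm only.\<close>
  define e :: "complex^2" where "e = axis 1 1"
  have e: "norm e = 1" "e \<bullet> e = 1" by (simp_all add: e_def norm_axis_1 inner_axis_axis)
  let ?N = "\<lambda>z :: real^3. 1 / norm z ^ 4" and ?H = "{z. z \<bullet> n < -1}"
  have N: "?N \<in> borel_measurable borel" "\<bar>?N z\<bar> \<le> 1 / norm z ^ 4" "0 < s \<Longrightarrow> ?N (s *\<^sub>R z) = ?N z / s ^ 4" for s z
    by (simp_all add: power_mult_distrib)
  have Ni: "integrable lborel (\<lambda>z. indicator ?H z * ?N z)" by (rule half_space_integrable[OF ray(1) N(1,2)])
  have "(LINT z|lebesgue. indicator ?H z * ?N z) = (LINT z|lborel. indicator ?H z * ?N z)"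
    by (rule integral_completion) (use Ni in \<open>rule borel_measurable_integrable\<close>)
  also have "0 < \<dots>"
  proof (rule integral_pos_on_open[OF Ni])
    show "open ?H" by (intro open_Collect_less continuous_intros)
    have "(-2 *\<^sub>R n) \<bullet> n < -1" using ray(1) by (simp add: norm_eq_1)
    then show "?H \<noteq> {}" by blast
    fix z assume "z \<in> ?H"
    then show "0 < indicator ?H z * ?N z" by auto
  qed simp
  finally have Npos: "0 < (LINT z|lebesgue. indicator ?H z * ?N z)" .
  have ww: "weyl e z \<bullet> weyl e z = ?N z" for z
    by (simp add: norm_weyl e(1) power_divide power_mult[symmetric] flip: power2_norm_eq_inner)
  \<comment> \<open>Both solutions live in the upper block, where \<open>P\<^sub>0(A)\<close>, being off-diagonal, is invisible.\<close>
  have "(\<Sum>i\<in>{()}. (qp\<^sub>1 p - qp\<^sub>2 p) * (LINT z|lebesgue. indicator ?H z * ?N z)) = 0"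
    by (rule form0[OF _ _ join_linear(1) alpha_join(1) join_linear(2) norm_join(1) join_linear(1) alpha_join(1) join_linear(2) norm_join(1),
          where c=e and c'=e and G="\<lambda>_ x. qp\<^sub>1 x - qp\<^sub>2 x" and h="\<lambda>_. ?N" and K=1])
      (use N c in \<open>auto simp: inner_spinor upper_potential ww inner_diff_left diff_divide_distrib linear_0[OF bounded_linear.linear[OF sigma_linear]] intro!: continuous_on_diff\<close>)
  then have qp: "qp\<^sub>1 p = qp\<^sub>2 p" using Npos by simp
  have "(\<Sum>i\<in>{()}. (qm\<^sub>1 p - qm\<^sub>2 p) * (LINT z|lebesgue. indicator ?H z * ?N z)) = 0"
    by (rule form0[OF _ _ join_linear(2) alpha_join(2) join_linear(1) norm_join(2) join_linear(2) alpha_join(2) join_linear(1) norm_join(2),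
          where c=e and c'=e and G="\<lambda>_ x. qm\<^sub>1 x - qm\<^sub>2 x" and h="\<lambda>_. ?N" and K=1])
      (use N c in \<open>auto simp: inner_spinor lower_potential ww inner_diff_left diff_divide_distrib linear_0[OF bounded_linear.linear[OF sigma_linear]] intro!: continuous_on_diff\<close>)
  then have qm: "qm\<^sub>1 p = qm\<^sub>2 p" using Npos by simp
  define a where "a = A\<^sub>1 p - A\<^sub>2 p"
  define t where "t = a - (a \<bullet> n) *\<^sub>R n"
  \<comment> \<open>One solution in each block makes \<open>q\<^sub>\<plusminus>\<close> invisible; the coefficients are now the components of \<open>A\<^sub>1 - A\<^sub>2\<close>.\<close>
  define h where "h j z = sigma_vec (axis j 1) (weyl e z) \<bullet> weyl (sigma_vec t e) z" for j :: 3 and z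
  have h: "h j \<in> borel_measurable borel" "\<bar>h j z\<bar> \<le> norm t / norm z ^ 4" "0 < s \<Longrightarrow> h j (s *\<^sub>R z) = h j z / s ^ 4" for j z s
  proof -
    show "h j \<in> borel_measurable borel"
      unfolding h_def[abs_def]
      by (intro borel_measurable_inner borel_measurable_bounded_linear[OF sigma_linear] borel_measurable_weyl)
    have "\<bar>h j z\<bar> \<le> norm (sigma_vec (axis j 1) (weyl e z)) * norm (weyl (sigma_vec t e) z)"
      unfolding h_def by (rule Cauchy_Schwarz_ineq2)
    also have "\<dots> = norm t / norm z ^ 4"
      by (simp add: norm_sigma norm_weyl e(1) norm_axis_1 power_add[symmetric])
    finally show "\<bar>h j z\<bar> \<le> norm t / norm z ^ 4" .
    show "h j (s *\<^sub>R z) = h j z / s ^ 4" if "0 < s"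
      unfolding h_def weyl_scale[OF that] linear_scale[OF bounded_linear.linear[OF sigma_linear]]
      by (simp add: power_add[symmetric])
  qed
  have sum_h: "(\<Sum>j\<in>UNIV. (b $ j) * h j z) = sigma_vec b (weyl e z) \<bullet> weyl (sigma_vec t e) z" for b z
    unfolding h_def sigma_sum_axis[symmetric, of b "weyl e z"] inner_sum_left by simp
  have "(\<Sum>j\<in>(UNIV :: 3 set). (A\<^sub>1 p $ j - A\<^sub>2 p $ j) * (LINT z|lebesgue. indicator ?H z * h j z)) = 0"
  proof (rule form0[OF _ _ join_linear(2) alpha_join(2) join_linear(1) norm_join(2) join_linear(1) alpha_join(1) join_linear(2) norm_join(1),
        where c=e and c'="sigma_vec t e" and G="\<lambda>j x. A\<^sub>1 x $ j - A\<^sub>2 x $ j" and h=h and K="norm t"])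
    show "(?V1 x *v join 0 (weyl e z) - ?V2 x *v join 0 (weyl e z)) \<bullet> join (weyl (sigma_vec t e) z) 0
        = (\<Sum>j\<in>UNIV. (A\<^sub>1 x $ j - A\<^sub>2 x $ j) * h j z)" for x z
    proof -
      have "sigma_vec (A\<^sub>1 x) (weyl e z) - sigma_vec (A\<^sub>2 x) (weyl e z) = sigma_vec (A\<^sub>1 x - A\<^sub>2 x) (weyl e z)"
        by (rule linear_diff[OF bounded_linear.linear[OF bounded_linear_sigma_vector], symmetric])
      then show ?thesis
        using sum_h[of "A\<^sub>1 x - A\<^sub>2 x" z] by (simp add: inner_spinor upper_potential)
    qed
  qed (use h c in \<open>auto intro!: continuous_on_diff continuous_on_component\<close>)
  then have zero: "(\<Sum>j\<in>UNIV. (a $ j) * (LINT z|lebesgue. indicator ?H z * h j z)) = 0"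
    by (simp add: a_def)
  let ?F = "\<lambda>z. indicator ?H z * ((2 * (z \<bullet> a) * (z \<bullet> t) - (z \<bullet> z) * (a \<bullet> t)) / norm z ^ 6)"
  have F: "?F z = (\<Sum>j\<in>UNIV. (a $ j) * (indicator ?H z * h j z))" for z
  proof -
    have "(\<Sum>j\<in>UNIV. (a $ j) * (indicator ?H z * h j z)) = indicator ?H z * (\<Sum>j\<in>UNIV. (a $ j) * h j z)"
      by (simp add: sum_distrib_left mult.left_commute)
    then show ?thesis unfolding sum_h sigma_weyl_inner e(2) by simp
  qed
  have hi: "integrable lborel (\<lambda>z. indicator ?H z * h j z)" for j
    by (rule half_space_integrable[OF ray(1) h(1,2)])
  have hl: "(LINT z|lebesgue. indicator ?H z * h j z) = (LINT z|lborel. indicator ?H z * h j z)" for j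
    by (rule integral_completion) (use hi in \<open>rule borel_measurable_integrable\<close>)
  have "t = 0"
    unfolding t_def
  proof (rule tangential_half_space_integral[OF ray(1)], unfold t_def[symmetric])
    show "integrable lborel ?F" unfolding F using hi by simp
    show "integral\<^sup>L lborel ?F = 0" unfolding F using hi zero by (simp add: hl)
  qed
  then have "tangential \<Omega> A\<^sub>1 p = tangential \<Omega> A\<^sub>2 p"
    by (simp add: tangential_def on t_def a_def inner_diff_left scaleR_diff_left algebra_simps)
  then show "tangential \<Omega> A\<^sub>1 p = tangential \<Omega> A\<^sub>2 p \<and> qp\<^sub>1 p = qp\<^sub>2 p \<and> qm\<^sub>1 p = qm\<^sub>2 p"
    using qp qm by simp
qed

end
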